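(* Let $\gamma\in(\frac23,2)$ and let $(\overline M,\overline g)$ be a warped product spacetime of type $0$ or $-1$ associated with $\gamma$. Let $K>0$ be such that $$\|\phi\|_{C(M)}^2\le K^2\left(\|\phi\|_{L^2(M)}^2+\|\Delta\phi\|_{L^2(M)}^2\right)\quad\text{for all }\phi\in C^\infty(M).$$ Let $\epsilon>0$ and let $\mathcal{A}\in\mathbb{R}$ satisfy $|\mathcal A|>\frac{K}{\left|1-\frac2\gamma\right|}\epsilon$ in type $0$, respectively $|\mathcal A|>K\epsilon$ in type $-1$. Let $\psi_{\mathrm{hom}}(t,x):=\mathcal{A}\,t^{1-\frac2\gamma}$ in type $0$, respectively $\psi_{\mathrm{hom}}(t,x):=\mathcal{A}\int_t^\infty a(s)^{-3}\,ds$ in type $-1$. Let $\psi$ be a smooth wave on $(\overline M,\overline g)$ with leading coefficient $A$. If $$a(t_0)^6\left[E(t_0,\psi-\psi_{\mathrm{hom}})+E\big(t_0,\Delta(\psi-\psi_{\mathrm{hom}})\big)\right]\le\epsilon^2$$ holds for some $t_0>0$, then $A$ is non-vanishing, i.e. $A(x)\ne0$ for all $x\in M$.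
   Context: $(M,g)$ is a closed three-dimensional smooth Riemannian manifold with Levi-Civita connection $\nabla$, Laplace-Beltrami operator $\Delta=g^{ij}\nabla_i\nabla_j$ and volume measure $\mathrm{vol}_M$. A warped product spacetime is $\overline M=(0,\infty)\times M$ with $\overline g=-dt^2+a(t)^2g$. It is of type $0$ (associated with $\gamma$) if $a(t)=t^{\frac{2}{3\gamma}}$ (normalised by scaling). It is of type $-1$ if, for some constant $B>0$, $a$ is the unique function continuous on $[0,\infty)$, positive and smooth on $(0,\infty)$, with $a(0)=0$ and $\dot a=\sqrt{\frac{8\pi B}{3}a^{2-3\gamma}+1}$ on $(0,\infty)$. A smooth wave is $\psi\in C^\infty(\overline M)$ with $-\partial_t^2\psi+a^{-2}\Delta\psi-3\frac{\dot a}{a}\partial_t\psi=0$. Energy: for smooth $\phi:\overline M\to\mathbb{R}$, $E(t,\phi)=\int_M |\partial_t\phi(t,\cdot)|^2+a(t)^{-2}|\nabla\phi(t,\cdot)|_g^2\,\mathrm{vol}_M$. Leading coefficient: for a smooth wave $\psi$ and $\gamma<2$, $A\in C^\infty(M)$ denotes the unique smooth function with $\psi(t,x)/\chi(t)\to A(x)$ as $t\downarrow0$ uniformly in $x\in M$, where $\chi(t)=t^{1-\frac2\gamma}$ in type $0$ and $\chi(t)=\int_t^\infty a(s)^{-3}ds$ in type $-1$ (such $A$ always exists). *)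

theory Defs
  imports "HOL-Analysis.Analysis"
begin

section \<open>Smooth functions on open subsets of Euclidean spaces\<close>

text \<open>Only meaningful for open \<open>S\<close>. In finite dimension, continuity of all iterated directional
  derivatives up to order \<open>k\<close> is the usual \<open>C^k\<close> condition.\<close>

primrec Ck_on ::
  "nat \<Rightarrow> 'a::euclidean_space set \<Rightarrow> ('a \<Rightarrow> 'b::real_normed_vector) \<Rightarrow> bool" where
  "Ck_on 0 S f \<longleftrightarrow> continuous_on S f"
| "Ck_on (Suc k) S f \<longleftrightarrow> (\<forall>x\<in>S. f differentiable (at x)) \<and>
     (\<forall>v. Ck_on k S (\<lambda>x. frechet_derivative f (at x) v))"

definition smooth_on ::
  "'a::euclidean_space set \<Rightarrow> ('a \<Rightarrow> 'b::real_normed_vector) \<Rightarrow> bool" where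
  "smooth_on S f \<longleftrightarrow> (\<forall>k. Ck_on k S f)"

definition partial :: "'n \<Rightarrow> (real^'n \<Rightarrow> real) \<Rightarrow> real^'n \<Rightarrow> real" where
  "partial i f y = frechet_derivative f (at y) (axis i 1)"


section \<open>Smooth manifolds\<close>

text \<open>The manifold is the whole type \<open>'m\<close>, its dimension is \<open>CARD('n)\<close>. A chart is a pair of its
  domain and its coordinate map; outside its domain the coordinate map is irrelevant. Charts are
  onto open subsets of \<open>real^'n\<close>, so there is no boundary.\<close>

type_synonym ('m, 'n) chart = "'m set \<times> ('m \<Rightarrow> real^'n)"

definition cdom :: "('m, 'n) chart \<Rightarrow> 'm set" where
  "cdom c = fst c"

definition coord :: "('m, 'n) chart \<Rightarrow> 'm \<Rightarrow> real^'n" where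
  "coord c = snd c"

definition cimg :: "('m, 'n) chart \<Rightarrow> (real^'n) set" where
  "cimg c = coord c ` cdom c"

definition param :: "('m, 'n) chart \<Rightarrow> real^'n \<Rightarrow> 'm" where
  "param c = inv_into (cdom c) (coord c)"

definition transition :: "('m, 'n) chart \<Rightarrow> ('m, 'n) chart \<Rightarrow> real^'n \<Rightarrow> real^'n" where
  "transition c d = coord d \<circ> param c"

definition smooth_atlas ::
  "('m::{t2_space, second_countable_topology}, 'n::finite) chart set \<Rightarrow> bool" where
  "smooth_atlas At \<longleftrightarrow>
     (\<forall>c\<in>At. open (cdom c) \<and> open (cimg c) \<and>
        homeomorphism (cdom c) (cimg c) (coord c) (param c)) \<and>
     (\<Union>c\<in>At. cdom c) = UNIV \<and>
     (\<forall>c\<in>At. \<forall>d\<in>At. smooth_on (coord c ` (cdom c \<inter> cdom d)) (transition c d))"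

definition smooth_fun :: "('m, 'n::finite) chart set \<Rightarrow> ('m \<Rightarrow> real) \<Rightarrow> bool" where
  "smooth_fun At f \<longleftrightarrow> (\<forall>c\<in>At. smooth_on (cimg c) (f \<circ> param c))"

text \<open>Smoothness on the product manifold \<open>(0,\<infinity>) \<times> M\<close>, tested in the product charts. Values at
  \<open>t \<le> 0\<close> are irrelevant.\<close>

definition smooth_spacetime_fun ::
  "('m, 'n::finite) chart set \<Rightarrow> (real \<Rightarrow> 'm \<Rightarrow> real) \<Rightarrow> bool" where
  "smooth_spacetime_fun At \<psi> \<longleftrightarrow>
     (\<forall>c\<in>At. smooth_on ({0<..} \<times> cimg c) (\<lambda>(t, y). \<psi> t (param c y)))"


section \<open>Riemannian metrics\<close>

text \<open>A metric is given by its Gram matrices \<open>g c y = (g_ij)\<close> with respect to the coordinate frame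
  of the chart \<open>c\<close> at the coordinate point \<open>y\<close>; the last condition is the transformation law of a
  covariant 2-tensor.\<close>

type_synonym ('m, 'n) metric = "('m, 'n) chart \<Rightarrow> real^'n \<Rightarrow> real^'n^'n"

definition riemannian_metric ::
  "('m, 'n::finite) chart set \<Rightarrow> ('m, 'n) metric \<Rightarrow> bool" where
  "riemannian_metric At g \<longleftrightarrow>
     (\<forall>c\<in>At. smooth_on (cimg c) (g c) \<and>
        (\<forall>y\<in>cimg c. transpose (g c y) = g c y \<and>
           (\<forall>v. v \<noteq> 0 \<longrightarrow> 0 < v \<bullet> (g c y *v v)))) \<and>
     (\<forall>c\<in>At. \<forall>d\<in>At. \<forall>y\<in>coord c ` (cdom c \<inter> cdom d).
        let J = matrix (frechet_derivative (transition c d) (at y))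
        in g c y = transpose J ** g d (transition c d y) ** J)"

text \<open>The Riemannian volume measure is the Borel measure with density \<open>sqrt (det (g_ij))\<close> in every
  chart. Since countably many chart domains cover the manifold, this determines it uniquely.\<close>

definition riemannian_volume ::
  "('m::{t2_space, second_countable_topology}, 'n::finite) chart set \<Rightarrow> ('m, 'n) metric \<Rightarrow>
     'm measure \<Rightarrow> bool" where
  "riemannian_volume At g vol \<longleftrightarrow> sets vol = sets borel \<and>
     (\<forall>c\<in>At. \<forall>S\<in>sets borel. S \<subseteq> cdom c \<longrightarrow>
        emeasure vol S = (\<integral>\<^sup>+y\<in>coord c ` S. ennreal (sqrt (det (g c y))) \<partial>lborel))"

text \<open>Coordinate expressions, with \<open>G y = (g_ij)\<close> on an open subset of \<open>real^'n\<close> and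
  \<open>matrix_inv (G y) = (g^ij)\<close>.\<close>

text \<open>\<open>christoffel G k i j\<close> is \<open>\<Gamma>^k_ij\<close>, for the Levi-Civita connection.\<close>

definition christoffel ::
  "(real^'n \<Rightarrow> real^'n^'n) \<Rightarrow> 'n \<Rightarrow> 'n \<Rightarrow> 'n \<Rightarrow> real^'n \<Rightarrow> real" where
  "christoffel G k i j y = (\<Sum>l\<in>UNIV. matrix_inv (G y) $ k $ l *
     (partial i (\<lambda>z. G z $ j $ l) y + partial j (\<lambda>z. G z $ i $ l) y
      - partial l (\<lambda>z. G z $ i $ j) y)) / 2"

text \<open>\<open>\<nabla>_i \<nabla>_j f\<close>\<close>

definition hessian_coord ::
  "(real^'n \<Rightarrow> real^'n^'n) \<Rightarrow> (real^'n \<Rightarrow> real) \<Rightarrow> 'n \<Rightarrow> 'n \<Rightarrow> real^'n \<Rightarrow> real" where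
  "hessian_coord G f i j y =
     partial i (partial j f) y - (\<Sum>k\<in>UNIV. christoffel G k i j y * partial k f y)"

definition laplacian_coord ::
  "(real^'n \<Rightarrow> real^'n^'n) \<Rightarrow> (real^'n \<Rightarrow> real) \<Rightarrow> real^'n \<Rightarrow> real" where
  "laplacian_coord G f y =
     (\<Sum>i\<in>UNIV. \<Sum>j\<in>UNIV. matrix_inv (G y) $ i $ j * hessian_coord G f i j y)"

definition gradient_coord ::
  "(real^'n \<Rightarrow> real^'n^'n) \<Rightarrow> (real^'n \<Rightarrow> real) \<Rightarrow> real^'n \<Rightarrow> real^'n" where
  "gradient_coord G f y = matrix_inv (G y) *v (\<chi> i. partial i f y)"

text \<open>The Laplacian and \<open>|\<nabla>f|_g^2\<close> at a point are evaluated in an arbitrary chart around it; for a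
  Riemannian metric and a smooth \<open>f\<close> the result does not depend on that chart.\<close>

definition chart_at :: "('m, 'n) chart set \<Rightarrow> 'm \<Rightarrow> ('m, 'n) chart" where
  "chart_at At x = (SOME c. c \<in> At \<and> x \<in> cdom c)"

definition laplacian ::
  "('m, 'n::finite) chart set \<Rightarrow> ('m, 'n) metric \<Rightarrow> ('m \<Rightarrow> real) \<Rightarrow> 'm \<Rightarrow> real" where
  "laplacian At g f x =
     (let c = chart_at At x in laplacian_coord (g c) (f \<circ> param c) (coord c x))"

definition grad_norm_sq ::
  "('m, 'n::finite) chart set \<Rightarrow> ('m, 'n) metric \<Rightarrow> ('m \<Rightarrow> real) \<Rightarrow> 'm \<Rightarrow> real" where
  "grad_norm_sq At g f x =
     (let c = chart_at At x; y = coord c x; v = gradient_coord (g c) (f \<circ> param c) y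
      in v \<bullet> (g c y *v v))"

definition L2_norm :: "'m measure \<Rightarrow> ('m \<Rightarrow> real) \<Rightarrow> real" where
  "L2_norm vol f = sqrt (\<integral>x. (f x)\<^sup>2 \<partial>vol)"

text \<open>Only used for bounded functions.\<close>

definition sup_norm :: "('m \<Rightarrow> real) \<Rightarrow> real" where
  "sup_norm f = (SUP x. \<bar>f x\<bar>)"


section \<open>Warped product spacetimes and waves\<close>

datatype spacetime_type = Type_0 | Type_minus_1

text \<open>In type 0 only the values of \<open>a\<close> at positive times are prescribed (and relevant).\<close>

fun scale_factor :: "spacetime_type \<Rightarrow> real \<Rightarrow> (real \<Rightarrow> real) \<Rightarrow> bool" where
  "scale_factor Type_0 \<gamma> a \<longleftrightarrow> (\<forall>t>0. a t = t powr (2 / (3 * \<gamma>)))"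
| "scale_factor Type_minus_1 \<gamma> a \<longleftrightarrow>
     (\<exists>B>0. continuous_on {0..} a \<and> (\<forall>t>0. 0 < a t) \<and> smooth_on {0<..} a \<and> a 0 = 0 \<and>
        (\<forall>t>0. (a has_real_derivative
           sqrt (8 * pi * B / 3 * a t powr (2 - 3 * \<gamma>) + 1)) (at t)))"

fun chi_profile :: "spacetime_type \<Rightarrow> real \<Rightarrow> (real \<Rightarrow> real) \<Rightarrow> real \<Rightarrow> real" where
  "chi_profile Type_0 \<gamma> a t = t powr (1 - 2 / \<gamma>)"
| "chi_profile Type_minus_1 \<gamma> a t = (LBINT s:{t..}. 1 / a s ^ 3)"

definition dt :: "(real \<Rightarrow> 'm \<Rightarrow> real) \<Rightarrow> real \<Rightarrow> 'm \<Rightarrow> real" where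
  "dt \<psi> t x = deriv (\<lambda>s. \<psi> s x) t"

definition smooth_wave ::
  "('m, 'n::finite) chart set \<Rightarrow> ('m, 'n) metric \<Rightarrow> (real \<Rightarrow> real) \<Rightarrow>
     (real \<Rightarrow> 'm \<Rightarrow> real) \<Rightarrow> bool" where
  "smooth_wave At g a \<psi> \<longleftrightarrow> smooth_spacetime_fun At \<psi> \<and>
     (\<forall>t>0. \<forall>x. - dt (dt \<psi>) t x + 1 / (a t)\<^sup>2 * laplacian At g (\<psi> t) x
                - 3 * (deriv a t / a t) * dt \<psi> t x = 0)"

definition energy ::
  "('m, 'n::finite) chart set \<Rightarrow> ('m, 'n) metric \<Rightarrow> 'm measure \<Rightarrow> (real \<Rightarrow> real) \<Rightarrow>
     real \<Rightarrow> (real \<Rightarrow> 'm \<Rightarrow> real) \<Rightarrow> real" where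
  "energy At g vol a t \<phi> =
     (\<integral>x. \<bar>dt \<phi> t x\<bar>\<^sup>2 + 1 / (a t)\<^sup>2 * grad_norm_sq At g (\<phi> t) x \<partial>vol)"

definition leading_coefficient ::
  "('m, 'n::finite) chart set \<Rightarrow> spacetime_type \<Rightarrow> real \<Rightarrow> (real \<Rightarrow> real) \<Rightarrow>
     (real \<Rightarrow> 'm \<Rightarrow> real) \<Rightarrow> ('m \<Rightarrow> real) \<Rightarrow> bool" where
  "leading_coefficient At ty \<gamma> a \<psi> A \<longleftrightarrow> smooth_fun At A \<and>
     uniform_limit UNIV (\<lambda>t x. \<psi> t x / chi_profile ty \<gamma> a t) A (at_right 0)"

definition psi_hom ::
  "spacetime_type \<Rightarrow> real \<Rightarrow> (real \<Rightarrow> real) \<Rightarrow> real \<Rightarrow> real \<Rightarrow> 'm \<Rightarrow> real" where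
  "psi_hom ty \<gamma> a \<A> t x = \<A> * chi_profile ty \<gamma> a t"

end

theory Submission
  imports Defs
begin

text \<open>
  The difference \<open>\<phi> = \<psi> - \<psi>_hom\<close> is again a wave. By Green's identity the time derivative of
  \<open>a^6 E(t, \<phi>)\<close> is \<open>4 a^3 a'\<close> times the integral of \<open>|\<nabla>\<phi>|^2\<close>, so the smallness at \<open>t\<^sub>0\<close> persists for
  all earlier times, for \<open>\<phi>\<close> and for the wave \<open>\<Delta>\<phi>\<close>. The Sobolev bound turns this into
  \<open>|\<partial>_t \<phi>| \<le> K \<epsilon> / a^3\<close>. As \<open>\<chi>' = \<kappa> / a^3\<close> with \<open>\<kappa> = 1 - 2/\<gamma>\<close> or \<open>\<kappa> = -1\<close> and \<open>\<chi> \<rightarrow> \<infinity>\<close>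
  at \<open>t = 0\<close>, integrating and dividing by \<open>\<chi>\<close> yields \<open>|A - \<A>| \<le> K \<epsilon> / |\<kappa>| < |\<A>|\<close>.

  Green's identity rests on translation invariance of Lebesgue measure in each chart and a
  \<open>C^1\<close> partition of unity. Testing it against bump functions also shows that the Laplacian does not
  depend on the chart, without transforming Christoffel symbols.
\<close>

text \<open>The weight a^6 is dictated by friction: with P the integral of |\<partial>_t \<phi>|^2,
  the wave equation gives P' the summand -6 (a'/a) P, which the derivative of a^6 cancels, and only
  the Dirichlet term survives, with a sign. Its square root a^3 is the reciprocal of \<chi>' up to
  the factor \<kappa>, so the pointwise bound integrates to a multiple of \<chi>. Two energies occur
  because the Sobolev hypothesis, applied to \<partial>_t \<phi>, asks for the L^2 norm of its
  Laplacian; this is the time derivative of \<Delta>\<psi>, from which the homogeneous part has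
  dropped out. The main obstacle is \<open>laplacian\<close>: it evaluates a Hessian formula in a
  chart chosen separately at each point, so not even its continuity is evident. The weak formulation
  helps: the divergence form, obtained from Jacobi's formula, pairs the Laplacian with a test
  function and leaves first derivatives only, which transform by the chain rule. Test functions are
  differentiated once, so squares of truncated quadratics can serve as bumps.\<close>

section \<open>Calculus of iterated derivatives\<close>

lemma frechet_derivativeI:
  "(f has_derivative f') (at x) \<Longrightarrow> frechet_derivative f (at x) = f'"
  using frechet_derivative_at by metis

lemma Ck_on_SucD:
  assumes "Ck_on (Suc k) S f"
  shows "x \<in> S \<Longrightarrow> (f has_derivative frechet_derivative f (at x)) (at x)"
    and "Ck_on k S (\<lambda>x. frechet_derivative f (at x) v)"
  using assms by (auto simp: frechet_derivative_works[symmetric])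

text \<open>On an open set the two functions agree near every point, so they share the derivative
  there and the induction can pass to directional derivatives.\<close>

lemma Ck_on_cong:
  assumes "open S" "\<And>x. x \<in> S \<Longrightarrow> f x = g x" "Ck_on k S f"
  shows "Ck_on k S g"
  using assms(2,3)
proof (induction k arbitrary: f g)
  case 0
  then show ?case using continuous_on_cong by (metis Ck_on.simps(1))
next
  case (Suc k)
  have der: "(g has_derivative frechet_derivative f (at x)) (at x)" if "x \<in> S" for x
    using has_derivative_transform_within_open[OF Ck_on_SucD(1)[OF Suc.prems(2) that] \<open>open S\<close> that]
      Suc.prems(1) by blast
  have "Ck_on k S (\<lambda>x. frechet_derivative g (at x) v)" for v
    by (rule Suc.IH[OF _ Ck_on_SucD(2)[OF Suc.prems(2), of v]])
       (use der frechet_derivativeI in metis)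
  moreover have "g differentiable (at x)" if "x \<in> S" for x
    using der[OF that] by (auto simp: differentiable_def)
  ultimately show ?case by simp
qed

text \<open>The introduction rule behind the closure properties: a formula \<open>f'\<close> for the
  derivative on \<open>S\<close> may stand in for the chosen
  \<open>frechet_derivative\<close>.\<close>

lemma Ck_on_SucI:
  assumes "open S" "\<And>x. x \<in> S \<Longrightarrow> (f has_derivative f' x) (at x)"
    and "\<And>v. Ck_on k S (\<lambda>x. f' x v)"
  shows "Ck_on (Suc k) S f"
proof -
  have "Ck_on k S (\<lambda>x. frechet_derivative f (at x) v)" for v
    by (rule Ck_on_cong[OF assms(1) _ assms(3)[of v]])
       (use assms(2) frechet_derivativeI in metis)
  then show ?thesis using assms(2) by (auto simp: differentiable_def)
qed

lemma Ck_on_Suc_imp: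
  assumes "Ck_on (Suc k) S f" shows "Ck_on k S f"
  using assms
proof (induction k arbitrary: f)
  case 0
  then show ?case
    by (auto intro!: continuous_at_imp_continuous_on differentiable_imp_continuous_within)
next
  case (Suc k)
  then show ?case by (metis Ck_on.simps(2))
qed

lemma Ck_on_imp_continuous_on: "Ck_on k S f \<Longrightarrow> continuous_on S f"
  by (induction k) (use Ck_on_Suc_imp in \<open>auto simp del: Ck_on.simps(2)\<close>)

text \<open>Made for functions given by different formulas near different points, such as a bump
  seen in a foreign chart.\<close>

lemma Ck_on_local:
  assumes "\<And>x. x \<in> S \<Longrightarrow> \<exists>U. open U \<and> x \<in> U \<and> Ck_on k U f"
  shows "Ck_on k S f"
  using assms
proof (induction k arbitrary: f)
  case 0
  then show ?case
    by (metis Ck_on.simps(1) continuous_at_imp_continuous_on continuous_on_eq_continuous_at)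
next
  case (Suc k)
  show ?case
    unfolding Ck_on.simps
  proof (intro conjI ballI allI Suc.IH)
    fix x assume "x \<in> S"
    then show "f differentiable at x" using Suc.prems by fastforce
  next
    fix v x assume "x \<in> S"
    then obtain U where "open U" "x \<in> U" "Ck_on (Suc k) U f" using Suc.prems by blast
    then show "\<exists>U. open U \<and> x \<in> U \<and> Ck_on k U (\<lambda>x. frechet_derivative f (at x) v)"
      by (intro exI[of _ U]) simp
  qed
qed

lemma Ck_on_const: "open S \<Longrightarrow> Ck_on k S (\<lambda>x. c)"
proof (induction k arbitrary: c)
  case (Suc k)
  show ?case
    by (rule Ck_on_SucI[where f' = "\<lambda>x v. 0"]) (use Suc in auto)
qed auto

lemma Ck_on_add:
  assumes "open S" "Ck_on k S f" "Ck_on k S g"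
  shows "Ck_on k S (\<lambda>x. f x + g x)"
  using assms(2,3)
proof (induction k arbitrary: f g)
  case 0
  then show ?case by (auto intro!: continuous_on_add)
next
  case (Suc k)
  show ?case
    by (rule Ck_on_SucI[OF \<open>open S\<close> has_derivative_add[OF Ck_on_SucD(1)[OF Suc.prems(1)]
          Ck_on_SucD(1)[OF Suc.prems(2)]] Suc.IH])
       (use Suc.prems Ck_on_SucD(2) in auto)
qed

lemma Ck_on_bounded_linear:
  assumes "open S" "bounded_linear L" "Ck_on k S f"
  shows "Ck_on k S (\<lambda>x. L (f x))"
  using assms(3)
proof (induction k arbitrary: f)
  case 0
  then show ?case
    using bounded_linear.continuous_on[OF assms(2)] by simp
next
  case (Suc k)
  show ?case
    by (rule Ck_on_SucI[OF \<open>open S\<close> bounded_linear.has_derivative[OF assms(2)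
          Ck_on_SucD(1)[OF Suc.prems]] Suc.IH])
       (use Suc.prems Ck_on_SucD(2) in auto)
qed

lemma Ck_on_sum:
  assumes "open S" "\<And>i. i \<in> I \<Longrightarrow> Ck_on k S (f i)"
  shows "Ck_on k S (\<lambda>x. \<Sum>i\<in>I. f i x)"
  using assms(2)
  by (induction I rule: infinite_finite_induct) (auto intro!: Ck_on_const Ck_on_add assms(1))

lemma Ck_on_mult:
  fixes f g :: "'a::euclidean_space \<Rightarrow> real"
  assumes "open S" "Ck_on k S f" "Ck_on k S g"
  shows "Ck_on k S (\<lambda>x. f x * g x)"
  using assms(2,3)
proof (induction k arbitrary: f g)
  case 0
  then show ?case by (auto intro!: continuous_on_mult)
next
  case (Suc k)
  show ?case
    by (rule Ck_on_SucI[OF \<open>open S\<close> has_derivative_mult[OF Ck_on_SucD(1)[OF Suc.prems(1)]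
          Ck_on_SucD(1)[OF Suc.prems(2)]]], assumption, assumption)
       (intro Ck_on_add[OF assms(1)] Suc.IH Ck_on_SucD(2)[OF Suc.prems(1)] Ck_on_SucD(2)[OF Suc.prems(2)]
         Ck_on_Suc_imp[OF Suc.prems(1)] Ck_on_Suc_imp[OF Suc.prems(2)])
qed

lemma Ck_on_diff:
  fixes f g :: "'a::euclidean_space \<Rightarrow> real"
  assumes "open S" "Ck_on k S f" "Ck_on k S g"
  shows "Ck_on k S (\<lambda>x. f x - g x)"
  using Ck_on_add[OF assms(1,2) Ck_on_bounded_linear[OF assms(1) bounded_linear_minus[OF bounded_linear_ident] assms(3)]]
  by simp

lemma Ck_on_prod:
  fixes f :: "'i \<Rightarrow> 'a::euclidean_space \<Rightarrow> real"
  assumes "open S" "\<And>i. i \<in> I \<Longrightarrow> Ck_on k S (f i)"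
  shows "Ck_on k S (\<lambda>x. \<Prod>i\<in>I. f i x)"
  using assms(2)
  by (induction I rule: infinite_finite_induct) (auto intro!: Ck_on_const Ck_on_mult assms(1))

lemma Ck_on_inverse:
  fixes f :: "'a::euclidean_space \<Rightarrow> real"
  assumes "open S" "\<And>x. x \<in> S \<Longrightarrow> f x \<noteq> 0" "Ck_on k S f"
  shows "Ck_on k S (\<lambda>x. inverse (f x))"
  using assms(3)
proof (induction k)
  case 0
  then show ?case by (auto intro!: continuous_on_inverse assms(2))
next
  case (Suc k)
  have "Ck_on k S (\<lambda>x. - 1 * (inverse (f x) * frechet_derivative f (at x) v * inverse (f x)))" for v
    by (intro Ck_on_mult[OF assms(1)] Ck_on_const Suc.IH Ck_on_Suc_imp[OF Suc.prems] assms(1)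
        Ck_on_SucD(2)[OF Suc.prems])
  then show ?case
    by (intro Ck_on_SucI[OF \<open>open S\<close> Deriv.has_derivative_inverse[OF assms(2) Ck_on_SucD(1)[OF Suc.prems]]])
       (auto)
qed

lemma Ck_on_affine:
  fixes L :: "'a::euclidean_space \<Rightarrow> 'b::euclidean_space"
  assumes "open S" "bounded_linear L"
  shows "Ck_on k S (\<lambda>x. b + L x)"
proof (cases k)
  case 0
  then show ?thesis
    using bounded_linear.continuous_on[OF assms(2) continuous_on_id]
    by (auto intro!: continuous_intros)
next
  case (Suc j)
  have "((\<lambda>x. b + L x) has_derivative L) (at x)" for x
    using has_derivative_add[OF has_derivative_const bounded_linear.has_derivative[OF assms(2) has_derivative_ident]]
    by fastforce
  then show ?thesis unfolding Suc
    by (intro Ck_on_SucI[where f' = "\<lambda>x. L"] Ck_on_const assms(1))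
qed

lemma linear_euclidean_sum:
  fixes f :: "'a::euclidean_space \<Rightarrow> 'b::real_vector"
  assumes "linear f"
  shows "f v = (\<Sum>b\<in>Basis. (v \<bullet> b) *\<^sub>R f b)"
proof -
  have "f v = f (\<Sum>b\<in>Basis. (v \<bullet> b) *\<^sub>R b)" by (simp add: euclidean_representation)
  then show ?thesis using assms by (simp add: linear_sum linear_scale)
qed

lemma Ck_on_compose:
  fixes f :: "'b::euclidean_space \<Rightarrow> real" and \<phi> :: "'a::euclidean_space \<Rightarrow> 'b"
  assumes "open S" "\<phi> ` S \<subseteq> T" "Ck_on k T f" "Ck_on k S \<phi>"
  shows "Ck_on k S (\<lambda>x. f (\<phi> x))"
  using assms(3,4)
proof (induction k arbitrary: f)
  case 0
  then show ?case using assms(2) by (auto intro: continuous_on_compose2)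
next
  case (Suc k)
  let ?f' = "\<lambda>y. frechet_derivative f (at y)"
  let ?\<phi>' = "\<lambda>x. frechet_derivative \<phi> (at x)"
  have der: "((\<lambda>x. f (\<phi> x)) has_derivative (\<lambda>v. ?f' (\<phi> x) (?\<phi>' x v))) (at x)" if "x \<in> S" for x
    using has_derivative_compose[OF Ck_on_SucD(1)[OF Suc.prems(2) that] Ck_on_SucD(1)[OF Suc.prems(1)]]
      that assms(2) by (auto simp: image_subset_iff)
  \<comment> \<open>In the chain rule the direction itself varies with \<open>x\<close>. Expanding
    it in the basis leaves derivatives of \<open>f\<close> in fixed directions, to which the
    induction hypothesis applies.\<close>
  have "Ck_on k S (\<lambda>x. ?f' (\<phi> x) (?\<phi>' x v))" for v
  proof (rule Ck_on_cong[OF assms(1)])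
    show "Ck_on k S (\<lambda>x. \<Sum>b\<in>Basis. (?\<phi>' x v \<bullet> b) * ?f' (\<phi> x) b)"
      by (intro Ck_on_sum Ck_on_mult assms(1) Suc.IH Ck_on_SucD(2)[OF Suc.prems(1)]
          Ck_on_Suc_imp[OF Suc.prems(2)]
          Ck_on_bounded_linear[OF assms(1) bounded_linear_inner_left Ck_on_SucD(2)[OF Suc.prems(2)]])
    fix x assume "x \<in> S"
    then have "linear (?f' (\<phi> x))"
      using Ck_on_SucD(1)[OF Suc.prems(1), of "\<phi> x"] assms(2) has_derivative_linear by blast
    from linear_euclidean_sum[OF this, of "?\<phi>' x v"]
    show "(\<Sum>b\<in>Basis. (?\<phi>' x v \<bullet> b) * ?f' (\<phi> x) b) = ?f' (\<phi> x) (?\<phi>' x v)" by simp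
  qed
  then show ?case by (intro Ck_on_SucI[OF assms(1) der])
qed

section \<open>Closure properties of smooth functions on open sets\<close>

lemma smooth_onD:
  assumes "smooth_on S f"
  shows smooth_on_has_derivative: "x \<in> S \<Longrightarrow> (f has_derivative frechet_derivative f (at x)) (at x)"
    and smooth_on_directional: "smooth_on S (\<lambda>x. frechet_derivative f (at x) v)"
    and smooth_on_imp_continuous_on: "continuous_on S f"
  using assms Ck_on_SucD[of _ S f] Ck_on_imp_continuous_on unfolding smooth_on_def by blast+

lemma smooth_on_cong:
  "open S \<Longrightarrow> (\<And>x. x \<in> S \<Longrightarrow> f x = g x) \<Longrightarrow> smooth_on S f \<Longrightarrow> smooth_on S g"
  unfolding smooth_on_def using Ck_on_cong by blast

lemma smooth_on_const: "open S \<Longrightarrow> smooth_on S (\<lambda>x. c)"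
  unfolding smooth_on_def using Ck_on_const by blast

lemma smooth_on_add: 
  "open S \<Longrightarrow> smooth_on S f \<Longrightarrow> smooth_on S g \<Longrightarrow> smooth_on S (\<lambda>x. f x + g x)"
  unfolding smooth_on_def using Ck_on_add by blast

lemma smooth_on_diff: 
  fixes f g :: "'a::euclidean_space \<Rightarrow> real"
  shows "open S \<Longrightarrow> smooth_on S f \<Longrightarrow> smooth_on S g \<Longrightarrow> smooth_on S (\<lambda>x. f x - g x)"
  unfolding smooth_on_def using Ck_on_diff by blast

lemma smooth_on_mult: 
  fixes f g :: "'a::euclidean_space \<Rightarrow> real"
  shows "open S \<Longrightarrow> smooth_on S f \<Longrightarrow> smooth_on S g \<Longrightarrow> smooth_on S (\<lambda>x. f x * g x)"
  unfolding smooth_on_def using Ck_on_mult by blast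

lemma smooth_on_inverse: 
  fixes f :: "'a::euclidean_space \<Rightarrow> real"
  shows "open S \<Longrightarrow> (\<And>x. x \<in> S \<Longrightarrow> f x \<noteq> 0) \<Longrightarrow> smooth_on S f \<Longrightarrow> smooth_on S (\<lambda>x. inverse (f x))"
  unfolding smooth_on_def using Ck_on_inverse by blast

lemma smooth_on_sum:
  "open S \<Longrightarrow> (\<And>i. i \<in> I \<Longrightarrow> smooth_on S (f i)) \<Longrightarrow> smooth_on S (\<lambda>x. \<Sum>i\<in>I. f i x)"
  unfolding smooth_on_def by (simp add: Ck_on_sum)

lemma smooth_on_prod:
  fixes f :: "'i \<Rightarrow> 'a::euclidean_space \<Rightarrow> real"
  shows "open S \<Longrightarrow> (\<And>i. i \<in> I \<Longrightarrow> smooth_on S (f i)) \<Longrightarrow> smooth_on S (\<lambda>x. \<Prod>i\<in>I. f i x)"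
  unfolding smooth_on_def by (simp add: Ck_on_prod)

lemma smooth_on_bounded_linear:
  "open S \<Longrightarrow> bounded_linear L \<Longrightarrow> smooth_on S f \<Longrightarrow> smooth_on S (\<lambda>x. L (f x))"
  unfolding smooth_on_def using Ck_on_bounded_linear by blast

lemma smooth_on_compose_affine:
  fixes f :: "'b::euclidean_space \<Rightarrow> real" and L :: "'a::euclidean_space \<Rightarrow> 'b"
  assumes "open S" "bounded_linear L" "(\<lambda>x. b + L x) ` S \<subseteq> T" "smooth_on T f"
  shows "smooth_on S (\<lambda>x. f (b + L x))"
  using Ck_on_compose[OF assms(1,3) _ Ck_on_affine[OF assms(1,2)]] assms(4)
  unfolding smooth_on_def by blast

lemma smooth_on_partial: "smooth_on S f \<Longrightarrow> smooth_on S (partial i f)"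
  unfolding partial_def[abs_def] by (rule smooth_on_directional)

text \<open>The mean value theorem is applied twice: along \<open>u\<close> to the increment of
  \<open>f\<close> in direction \<open>v\<close>, then along \<open>v\<close> to the derivative of
  \<open>f\<close> along \<open>u\<close>. The second difference itself is symmetric in
  \<open>u\<close> and \<open>v\<close>.\<close>

lemma mixed_difference_mvt:
  fixes f :: "'a::real_normed_vector \<Rightarrow> real"
  assumes "0 < s"
    and "\<And>\<sigma> \<rho>. 0 \<le> \<sigma> \<Longrightarrow> \<sigma> \<le> s \<Longrightarrow> 0 \<le> \<rho> \<Longrightarrow> \<rho> \<le> s \<Longrightarrow>
      p + \<sigma> *\<^sub>R u + \<rho> *\<^sub>R v \<in> U"
    and f': "\<And>x. x \<in> U \<Longrightarrow> (f has_derivative f' x) (at x)"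
    and f'': "\<And>x. x \<in> U \<Longrightarrow> ((\<lambda>x. f' x u) has_derivative f'' x) (at x)"
  obtains \<sigma> \<rho> where "0 < \<sigma>" "\<sigma> < s" "0 < \<rho>" "\<rho> < s"
    "f (p + s *\<^sub>R u + s *\<^sub>R v) - f (p + s *\<^sub>R u) - f (p + s *\<^sub>R v) + f p
      = s * s * f'' (p + \<sigma> *\<^sub>R u + \<rho> *\<^sub>R v) v"
proof -
  let ?D = "\<lambda>\<sigma>. f (p + \<sigma> *\<^sub>R u + s *\<^sub>R v) - f (p + \<sigma> *\<^sub>R u)"
  have lin: "f' x (c *\<^sub>R w) = c * f' x w" if "x \<in> U" for x c w
    using has_derivative_linear[OF f'[OF that]] by (simp add: linear_scale)
  have lin2: "f'' x (c *\<^sub>R w) = c * f'' x w" if "x \<in> U" for x c w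
    using has_derivative_linear[OF f''[OF that]] by (simp add: linear_scale)
  have ray: "((\<lambda>\<sigma>. f (p + \<sigma> *\<^sub>R u + r *\<^sub>R v)) has_real_derivative f' (p + \<sigma> *\<^sub>R u + r *\<^sub>R v) u) (at \<sigma>)"
    if "p + \<sigma> *\<^sub>R u + r *\<^sub>R v \<in> U" for \<sigma> r
  proof -
    have "((\<lambda>\<sigma>. f (p + \<sigma> *\<^sub>R u + r *\<^sub>R v)) has_derivative (\<lambda>h. f' (p + \<sigma> *\<^sub>R u + r *\<^sub>R v) (h *\<^sub>R u))) (at \<sigma>)"
      by (rule has_derivative_compose[of "\<lambda>\<sigma>. p + \<sigma> *\<^sub>R u + r *\<^sub>R v" "\<lambda>h. h *\<^sub>R u" \<sigma> UNIV f, OF _ f'[OF that]])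
         (auto intro!: derivative_eq_intros)
    then show ?thesis
      by (simp add: has_field_derivative_def lin[OF that] mult_commute_abs)
  qed
  have "\<exists>\<sigma>>0. \<sigma> < s \<and> ?D s - ?D 0 = (s - 0) * (f' (p + \<sigma> *\<^sub>R u + s *\<^sub>R v) u - f' (p + \<sigma> *\<^sub>R u + 0 *\<^sub>R v) u)"
    by (rule MVT2[OF \<open>0 < s\<close>])
       (use ray[of _ s] ray[of _ 0] assms(1) assms(2)[of _ s] assms(2)[of _ 0]
         in \<open>auto intro!: DERIV_diff\<close>)
  then obtain \<sigma> where \<sigma>: "0 < \<sigma>" "\<sigma> < s"
    "?D s - ?D 0 = s * (f' (p + \<sigma> *\<^sub>R u + s *\<^sub>R v) u - f' (p + \<sigma> *\<^sub>R u + 0 *\<^sub>R v) u)" by auto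
  have "\<exists>\<rho>>0. \<rho> < s \<and> f' (p + \<sigma> *\<^sub>R u + s *\<^sub>R v) u - f' (p + \<sigma> *\<^sub>R u + 0 *\<^sub>R v) u
     = (s - 0) * f'' (p + \<sigma> *\<^sub>R u + \<rho> *\<^sub>R v) v"
  proof (rule MVT2[OF \<open>0 < s\<close>])
    fix r assume "0 \<le> r" "r \<le> s"
    then have U: "p + \<sigma> *\<^sub>R u + r *\<^sub>R v \<in> U" using assms(2) \<sigma> by simp
    have "((\<lambda>r. f' (p + \<sigma> *\<^sub>R u + r *\<^sub>R v) u) has_derivative (\<lambda>h. f'' (p + \<sigma> *\<^sub>R u + r *\<^sub>R v) (h *\<^sub>R v))) (at r)"
      by (rule has_derivative_compose[of "\<lambda>r. p + \<sigma> *\<^sub>R u + r *\<^sub>R v" "\<lambda>h. h *\<^sub>R v" r UNIV "\<lambda>x. f' x u", OF _ f''[OF U]])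
         (auto intro!: derivative_eq_intros)
    then show "((\<lambda>r. f' (p + \<sigma> *\<^sub>R u + r *\<^sub>R v) u) has_real_derivative f'' (p + \<sigma> *\<^sub>R u + r *\<^sub>R v) v) (at r)"
      by (simp add: has_field_derivative_def lin2[OF U] mult_commute_abs)
  qed
  then obtain \<rho> where \<rho>: "0 < \<rho>" "\<rho> < s"
    "f' (p + \<sigma> *\<^sub>R u + s *\<^sub>R v) u - f' (p + \<sigma> *\<^sub>R u + 0 *\<^sub>R v) u = s * f'' (p + \<sigma> *\<^sub>R u + \<rho> *\<^sub>R v) v"
    by auto
  show ?thesis
    by (rule that[OF \<sigma>(1,2) \<rho>(1,2)]) (use \<sigma>(3) \<rho>(3) in \<open>simp add: algebra_simps\<close>)
qed

text \<open>Both iterated derivatives are limits of the same second difference quotient.\<close>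

lemma frechet_derivative_commute:
  fixes f :: "'a::euclidean_space \<Rightarrow> real"
  assumes "open U" "smooth_on U f" "p \<in> U"
  shows "frechet_derivative (\<lambda>x. frechet_derivative f (at x) u) (at p) v
       = frechet_derivative (\<lambda>x. frechet_derivative f (at x) v) (at p) u"
proof (rule ccontr)
  define D where "D u v x = frechet_derivative (\<lambda>x. frechet_derivative f (at x) u) (at x) v" for u v x
  assume "\<not> ?thesis"
  then have ne: "D u v p \<noteq> D v u p" by (simp add: D_def)
  \<comment> \<open>Half the gap: no single value lies closer than \<open>e\<close> to both
    \<open>D u v p\<close> and \<open>D v u p\<close>.\<close>
  define e where "e = dist (D u v p) (D v u p) / 2"
  have "e > 0" using ne by (simp add: e_def)
  have cont: "isCont (D w w') p" for w w'
    using smooth_on_imp_continuous_on[OF smooth_on_directional[OF smooth_on_directional[OF assms(2), of w], of w']]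
      assms(1,3) continuous_on_eq_continuous_at unfolding D_def by blast
  have "eventually (\<lambda>x. dist (D w w' x) (D w w' p) < e) (nhds p)" for w w'
    using cont[of w w'] \<open>e > 0\<close> unfolding isCont_def tendsto_at_iff_tendsto_nhds
    by (rule tendstoD)
  then have "eventually (\<lambda>x. dist (D u v x) (D u v p) < e \<and> dist (D v u x) (D v u p) < e \<and> x \<in> U) (nhds p)"
    by (intro eventually_conj) (use assms eventually_nhds in blast)+
  then obtain d where d: "d > 0"
    "\<And>x. dist x p < d \<Longrightarrow> dist (D u v x) (D u v p) < e \<and> dist (D v u x) (D v u p) < e \<and> x \<in> U"
    by (auto simp: eventually_nhds_metric)
  \<comment> \<open>Small enough for the whole parallelogram with sides \<open>s *\<^sub>R u\<close>
    and \<open>s *\<^sub>R v\<close> at \<open>p\<close> to lie within distance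
    \<open>d / 2\<close>; the summand 1 keeps the denominator positive when both directions
    vanish.\<close>
  define s where "s = d / (norm u + norm v + 1) / 2"
  have N: "norm u + norm v + 1 > 0" by (simp add: add_nonneg_pos)
  have s: "s > 0" using d N by (simp add: s_def)
  have near: "dist (p + \<sigma> *\<^sub>R u + \<rho> *\<^sub>R v) p < d" "dist (p + \<rho> *\<^sub>R v + \<sigma> *\<^sub>R u) p < d"
    if "0 \<le> \<sigma>" "\<sigma> \<le> s" "0 \<le> \<rho>" "\<rho> \<le> s" for \<sigma> \<rho>
  proof -
    have "norm (\<sigma> *\<^sub>R u + \<rho> *\<^sub>R v) \<le> s * norm u + s * norm v"
      using that by (intro norm_triangle_le add_mono) (auto intro!: mult_right_mono)
    also have "\<dots> \<le> s * (norm u + norm v + 1)" using s by (simp add: algebra_simps)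
    also have "\<dots> = d / 2"
      unfolding s_def by (metis N less_imp_neq nonzero_eq_divide_eq times_divide_eq_left divide_divide_eq_left mult.commute)
    also have "\<dots> < d" using d by simp
    finally have *: "norm (\<sigma> *\<^sub>R u + \<rho> *\<^sub>R v) < d" .
    then show "dist (p + \<sigma> *\<^sub>R u + \<rho> *\<^sub>R v) p < d" by (simp add: dist_norm add.assoc)
    show "dist (p + \<rho> *\<^sub>R v + \<sigma> *\<^sub>R u) p < d" using * by (simp add: dist_norm add.assoc add.commute)
  qed
  have nearU: "p + \<sigma> *\<^sub>R u + \<rho> *\<^sub>R v \<in> U" "p + \<rho> *\<^sub>R v + \<sigma> *\<^sub>R u \<in> U"
    if "0 \<le> \<sigma>" "\<sigma> \<le> s" "0 \<le> \<rho>" "\<rho> \<le> s" for \<sigma> \<rho>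
    using near[OF that] d(2) by blast+
  have der1: "(f has_derivative frechet_derivative f (at x)) (at x)" if "x \<in> U" for x
    using smooth_on_has_derivative[OF assms(2) that] .
  have der2: "((\<lambda>x. frechet_derivative f (at x) w) has_derivative (\<lambda>w'. D w w' x)) (at x)" if "x \<in> U" for x w
    using smooth_on_has_derivative[OF smooth_on_directional[OF assms(2)] that] unfolding D_def .
  obtain \<sigma> \<rho> where 1: "0 < \<sigma>" "\<sigma> < s" "0 < \<rho>" "\<rho> < s"
    "f (p + s *\<^sub>R u + s *\<^sub>R v) - f (p + s *\<^sub>R u) - f (p + s *\<^sub>R v) + f p
      = s * s * D u v (p + \<sigma> *\<^sub>R u + \<rho> *\<^sub>R v)"
    by (rule mixed_difference_mvt[where U = U, OF s nearU(1) der1 der2])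
  obtain \<sigma>' \<rho>' where 2: "0 < \<sigma>'" "\<sigma>' < s" "0 < \<rho>'" "\<rho>' < s"
    "f (p + s *\<^sub>R v + s *\<^sub>R u) - f (p + s *\<^sub>R v) - f (p + s *\<^sub>R u) + f p
      = s * s * D v u (p + \<sigma>' *\<^sub>R v + \<rho>' *\<^sub>R u)"
    by (rule mixed_difference_mvt[where U = U, OF s nearU(2) der1 der2])
  have "s * s * D u v (p + \<sigma> *\<^sub>R u + \<rho> *\<^sub>R v) = s * s * D v u (p + \<sigma>' *\<^sub>R v + \<rho>' *\<^sub>R u)"
    using 1(5) 2(5) by (simp add: algebra_simps)
  then have eq: "D u v (p + \<sigma> *\<^sub>R u + \<rho> *\<^sub>R v) = D v u (p + \<sigma>' *\<^sub>R v + \<rho>' *\<^sub>R u)" using s by simp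
  have "dist (D u v (p + \<sigma> *\<^sub>R u + \<rho> *\<^sub>R v)) (D u v p) < e"
    using d(2)[OF near(1)] 1 by simp
  moreover have "dist (D v u (p + \<sigma>' *\<^sub>R v + \<rho>' *\<^sub>R u)) (D v u p) < e"
    using d(2)[OF near(2)] 2 by simp
  ultimately show False
    using dist_triangle2[of "D u v p" "D v u p" "D v u (p + \<sigma>' *\<^sub>R v + \<rho>' *\<^sub>R u)"] eq
    unfolding e_def by (simp add: dist_commute)
qed

section \<open>Linear algebra of Gram matrices\<close>

lemma has_derivative_matrix_nth:
  assumes "(F has_derivative F') (at x)"
  shows "((\<lambda>x. F x $ i $ j) has_derivative (\<lambda>v. F' v $ i $ j)) (at x)"
  by (intro bounded_linear.has_derivative[OF bounded_linear_vec_nth] assms)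

text \<open>Jacobi's formula. The product rule replaces one row of \<open>F x\<close> at a time by
  the corresponding row of \<open>F' v\<close>. Expressed by means of \<open>H\<close> as a
  combination of the rows of \<open>F x\<close>, this row contributes only its diagonal coefficient,
  by Cramer's rule.\<close>

lemma has_derivative_det:
  fixes F :: "'a::real_normed_vector \<Rightarrow> real^'n^'n"
  assumes F: "(F has_derivative F') (at x)" and H: "H ** F x = mat 1"
  shows "((\<lambda>x. det (F x)) has_derivative
           (\<lambda>v. det (F x) * (\<Sum>i\<in>UNIV. \<Sum>k\<in>UNIV. H $ k $ i * F' v $ i $ k))) (at x)"
proof -
  let ?P = "{p. p permutes (UNIV :: 'n set)}"
  let ?R = "\<lambda>v i. \<chi> j. if j = i then F' v $ i else F x $ j"
  have "((\<lambda>x. det (F x)) has_derivative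
          (\<lambda>v. \<Sum>p\<in>?P. of_int (sign p) * (\<Sum>i\<in>UNIV. F' v $ i $ p i * (\<Prod>j\<in>UNIV - {i}. F x $ j $ p j)))) (at x)"
    unfolding det_def
    by (intro has_derivative_sum has_derivative_mult_right has_derivative_prod
        has_derivative_matrix_nth F)
  moreover have "(\<Sum>p\<in>?P. of_int (sign p) * (\<Sum>i\<in>UNIV. F' v $ i $ p i * (\<Prod>j\<in>UNIV - {i}. F x $ j $ p j)))
       = det (F x) * (\<Sum>i\<in>UNIV. \<Sum>k\<in>UNIV. H $ k $ i * F' v $ i $ k)" for v
  proof -
    have 1: "F' v $ i $ p i * (\<Prod>j\<in>UNIV - {i}. F x $ j $ p j) = (\<Prod>j\<in>UNIV. ?R v i $ j $ p j)" for i p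
      by (subst prod.remove[of UNIV i]) (auto intro!: prod.cong)
    have 2: "det (?R v i) = (F' v ** H) $ i $ i * det (F x)" for i
    proof -
      have "F' v = F' v ** H ** F x" using H by (metis matrix_mul_assoc matrix_mul_rid)
      then have "F' v $ i $ l = (\<Sum>k\<in>UNIV. (F' v ** H) $ i $ k * F x $ k $ l)" for l
        by (simp add: matrix_matrix_mult_def[of "F' v ** H" "F x"] vec_eq_iff)
      then have "F' v $ i = (\<Sum>k\<in>UNIV. (F' v ** H) $ i $ k *s row k (F x))"
        by (simp add: vec_eq_iff row_def)
      then have "?R v i = (\<chi> j. if j = i then (\<Sum>k\<in>UNIV. (F' v ** H) $ i $ k *s row k (F x)) else row j (F x))"
        by (auto simp: vec_eq_iff row_def)
      then show ?thesis using cramer_lemma_transpose[of i "(F' v ** H) $ i" "F x"] by simp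
    qed
    have "(\<Sum>p\<in>?P. of_int (sign p) * (\<Sum>i\<in>UNIV. F' v $ i $ p i * (\<Prod>j\<in>UNIV - {i}. F x $ j $ p j)))
      = (\<Sum>i\<in>UNIV. det (?R v i))"
      unfolding 1 det_def sum_distrib_left by (subst sum.swap) simp
    also have "\<dots> = det (F x) * (\<Sum>i\<in>UNIV. \<Sum>k\<in>UNIV. H $ k $ i * F' v $ i $ k)"
      unfolding 2 by (simp add: matrix_matrix_mult_def sum_distrib_left sum_distrib_right mult_ac)
    finally show ?thesis .
  qed
  ultimately show ?thesis by simp
qed

section \<open>Positive definite matrices, their determinants and inverses\<close>

definition pos_def_matrix :: "real^'n^'n \<Rightarrow> bool" where
  "pos_def_matrix A \<longleftrightarrow> (\<forall>v. v \<noteq> 0 \<longrightarrow> 0 < v \<bullet> (A *v v))"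

lemma pos_def_matrix_invertible:
  assumes "pos_def_matrix A" shows "invertible A"
proof -
  have "A *v x = 0 \<Longrightarrow> x = 0" for x
    using assms unfolding pos_def_matrix_def by (metis inner_zero_right less_irrefl)
  then show ?thesis
    unfolding invertible_left_inverse matrix_left_invertible_ker by blast
qed

lemma matrix_inv:
  assumes "invertible A"
  shows "A ** matrix_inv A = mat 1" "matrix_inv A ** A = mat 1"
  using assms someI_ex[of "\<lambda>A'. A ** A' = mat 1 \<and> A' ** A = mat 1"]
  unfolding invertible_def matrix_inv_def by auto

text \<open>The determinant does not vanish on the segment from \<open>A\<close> to the unit matrix.\<close>

lemma pos_def_matrix_det_pos:
  fixes A :: "real^'n^'n"
  assumes "pos_def_matrix A" shows "0 < det A"
proof (rule ccontr)
  assume "\<not> 0 < det A"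
  let ?B = "\<lambda>s::real. s *\<^sub>R A + (1 - s) *\<^sub>R mat 1"
  have nz: "det (?B s) \<noteq> 0" if "0 \<le> s" "s \<le> 1" for s
  proof -
    have "0 < v \<bullet> (?B s *v v)" if "v \<noteq> 0" for v
    proof -
      have eq: "v \<bullet> (?B s *v v) = s * (v \<bullet> (A *v v)) + (1 - s) * (v \<bullet> v)"
        by (simp add: matrix_vector_mult_add_rdistrib inner_add_right scaleR_matrix_vector_assoc[symmetric])
      have "0 < v \<bullet> (A *v v)" using assms that by (simp add: pos_def_matrix_def)
      moreover have "0 < v \<bullet> v" using that by simp
      ultimately show ?thesis
        using \<open>0 \<le> s\<close> \<open>s \<le> 1\<close> unfolding eq
        by (cases "s = 0") (auto intro!: add_pos_nonneg)
    qed
    then have "pos_def_matrix (?B s)" by (simp add: pos_def_matrix_def)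
    then show ?thesis using pos_def_matrix_invertible invertible_det_nz by blast
  qed
  have "\<exists>s\<ge>0. s \<le> 1 \<and> det (?B s) = 0"
  proof (rule IVT2')
    show "continuous_on {0..1} (\<lambda>s. det (?B s))"
      unfolding det_def by (auto intro!: continuous_intros)
  qed (use \<open>\<not> 0 < det A\<close> in auto)
  then show False using nz by blast
qed

text \<open>Cramer's rule, in a form that displays the entries of the inverse as quotients of
  determinants, from which their smooth dependence on the matrix can be read off.\<close>

lemma matrix_inv_nth:
  fixes A :: "real^'n^'n"
  assumes "invertible A"
  shows "matrix_inv A $ j $ k = det (\<chi> i l. if l = j then axis k 1 $ i else A $ i $ l) / det A"
proof -
  have "A *v (matrix_inv A *v axis k 1) = axis k 1"
    by (simp add: matrix_vector_mul_assoc matrix_inv[OF assms])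
  moreover have "det A \<noteq> 0" using assms invertible_det_nz by blast
  ultimately have "matrix_inv A *v axis k 1 = (\<chi> j. det (\<chi> i l. if l = j then axis k 1 $ i else A $ i $ l) / det A)"
    using cramer by blast
  moreover have "matrix_inv A $ j $ k = (matrix_inv A *v axis k 1) $ j"
    by (simp add: matrix_vector_mult_basis column_def)
  ultimately show ?thesis by simp
qed

lemma smooth_on_det:
  fixes F :: "'a::euclidean_space \<Rightarrow> real^'n^'n"
  assumes "open S" "\<And>i j. smooth_on S (\<lambda>x. F x $ i $ j)"
  shows "smooth_on S (\<lambda>x. det (F x))"
  unfolding det_def
  by (intro smooth_on_sum smooth_on_mult smooth_on_prod smooth_on_const assms)

lemma smooth_on_matrix_inv:
  fixes F :: "'a::euclidean_space \<Rightarrow> real^'n^'n"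
  assumes "open S" "\<And>i j. smooth_on S (\<lambda>x. F x $ i $ j)" "\<And>x. x \<in> S \<Longrightarrow> invertible (F x)"
  shows "smooth_on S (\<lambda>x. matrix_inv (F x) $ j $ k)"
proof (rule smooth_on_cong[OF assms(1)])
  have "smooth_on S (\<lambda>x. if l = j then axis k 1 $ i else F x $ i $ l)" for i l
    by (cases "l = j") (auto intro!: smooth_on_const assms)
  then show "smooth_on S (\<lambda>x. det (\<chi> i l. if l = j then axis k 1 $ i else F x $ i $ l) * inverse (det (F x)))"
    using assms(3) invertible_det_nz
    by (intro smooth_on_mult smooth_on_inverse smooth_on_det assms) auto
qed (simp add: matrix_inv_nth assms(3) divide_inverse)

lemma matrix_inv_symmetric:
  fixes A :: "real^'n^'n"
  assumes "invertible A" "transpose A = A"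
  shows "matrix_inv A $ i $ j = matrix_inv A $ j $ i"
proof -
  let ?H = "matrix_inv A"
  have "transpose ?H ** A = mat 1"
    using matrix_inv(1)[OF assms(1)] assms(2) by (metis matrix_transpose_mul transpose_mat)
  then have "transpose ?H = ?H"
    using matrix_inv(1)[OF assms(1)] by (metis matrix_mul_assoc matrix_mul_lid matrix_mul_rid)
  then have "transpose ?H $ i $ j = ?H $ i $ j" by simp
  then show ?thesis by (simp add: transpose_def)
qed

text \<open>With \<open>T i a b\<close> for the i-th partial derivative of g_ab and \<open>H\<close>
  for the inverse metric, the left side is the trace g^kl \<Gamma>^j_kl. The first two terms of the
  Christoffel symbol contribute equally by the symmetry of \<open>H\<close>; the third becomes the
  logarithmic derivative of the determinant. Only summation indices are renamed.\<close>

lemma christoffel_contraction: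
  fixes H :: "'n::finite \<Rightarrow> 'n \<Rightarrow> real" and T :: "'n \<Rightarrow> 'n \<Rightarrow> 'n \<Rightarrow> real"
  assumes H: "\<And>i j. H i j = H j i"
  shows "(\<Sum>k\<in>UNIV. \<Sum>l\<in>UNIV. H k l * ((\<Sum>m\<in>UNIV. H j m * (T k l m + T l k m - T m k l)) / 2))
    = (\<Sum>i\<in>UNIV. \<Sum>a\<in>UNIV. \<Sum>b\<in>UNIV. H i a * T i a b * H b j)
      - (\<Sum>i\<in>UNIV. (\<Sum>a\<in>UNIV. \<Sum>b\<in>UNIV. H b a * T i a b) * H i j) / 2"
proof -
  have "(\<Sum>k\<in>UNIV. \<Sum>l\<in>UNIV. H k l * ((\<Sum>m\<in>UNIV. H j m * (T k l m + T l k m - T m k l)) / 2))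
    = ((\<Sum>k\<in>UNIV. \<Sum>l\<in>UNIV. \<Sum>m\<in>UNIV. H k l * (H j m * T k l m))
      + (\<Sum>k\<in>UNIV. \<Sum>l\<in>UNIV. \<Sum>m\<in>UNIV. H k l * (H j m * T l k m))
      - (\<Sum>k\<in>UNIV. \<Sum>l\<in>UNIV. \<Sum>m\<in>UNIV. H k l * (H j m * T m k l))) / 2"
    by (simp add: sum_distrib_left sum.distrib sum_subtractf distrib_left right_diff_distrib
        sum_divide_distrib add_divide_distrib diff_divide_distrib)
  moreover have "(\<Sum>k\<in>UNIV. \<Sum>l\<in>UNIV. \<Sum>m\<in>UNIV. H k l * (H j m * T l k m))
    = (\<Sum>k\<in>UNIV. \<Sum>l\<in>UNIV. \<Sum>m\<in>UNIV. H k l * (H j m * T k l m))"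
    by (subst sum.swap) (simp add: H)
  moreover have "(\<Sum>k\<in>UNIV. \<Sum>l\<in>UNIV. \<Sum>m\<in>UNIV. H k l * (H j m * T k l m))
    = (\<Sum>i\<in>UNIV. \<Sum>a\<in>UNIV. \<Sum>b\<in>UNIV. H i a * T i a b * H b j)"
    using H[of j] by (simp add: mult_ac)
  moreover have "(\<Sum>k\<in>UNIV. \<Sum>l\<in>UNIV. \<Sum>m\<in>UNIV. H k l * (H j m * T m k l))
    = (\<Sum>i\<in>UNIV. (\<Sum>a\<in>UNIV. \<Sum>b\<in>UNIV. H b a * T i a b) * H i j)"
  proof -
    have "(\<Sum>k\<in>UNIV. \<Sum>l\<in>UNIV. \<Sum>m\<in>UNIV. H k l * (H j m * T m k l))
      = (\<Sum>k\<in>UNIV. \<Sum>m\<in>UNIV. \<Sum>l\<in>UNIV. H k l * (H j m * T m k l))"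
      by (intro sum.cong refl sum.swap)
    also have "\<dots> = (\<Sum>m\<in>UNIV. \<Sum>k\<in>UNIV. \<Sum>l\<in>UNIV. H k l * (H j m * T m k l))"
      by (rule sum.swap)
    also have "\<dots> = (\<Sum>i\<in>UNIV. (\<Sum>a\<in>UNIV. \<Sum>b\<in>UNIV. H b a * T i a b) * H i j)"
      unfolding sum_distrib_right
      by (intro sum.cong refl) (metis H mult.assoc mult.commute)
    finally show ?thesis .
  qed
  ultimately show ?thesis by simp
qed

section \<open>Integration by parts in Euclidean space\<close>

lemma has_real_derivative_along:
  assumes "(f has_derivative f') (at (x + s *\<^sub>R v))"
  shows "((\<lambda>s. f (x + s *\<^sub>R v)) has_real_derivative f' v) (at s)"
proof -
  have "((\<lambda>s. f (x + s *\<^sub>R v)) has_derivative (\<lambda>h. f' (h *\<^sub>R v))) (at s)"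
    by (rule has_derivative_compose[of "\<lambda>s. x + s *\<^sub>R v" "\<lambda>h. h *\<^sub>R v" s UNIV f, OF _ assms])
       (auto intro!: derivative_eq_intros)
  moreover have "f' (h *\<^sub>R v) = h * f' v" for h
    using has_derivative_linear[OF assms] by (simp add: linear_scale)
  ultimately show ?thesis by (simp add: has_field_derivative_def mult_commute_abs)
qed

text \<open>By translation invariance all difference quotients of \<open>F\<close> have integral zero.\<close>

lemma integral_directional_derivative_eq_0:
  fixes F :: "'a::euclidean_space \<Rightarrow> real"
  assumes F: "\<And>x. (F has_derivative F' x) (at x)"
    and cont: "continuous_on UNIV (\<lambda>x. F' x v)"
    and K: "compact K" "\<And>x. x \<notin> K \<Longrightarrow> F x = 0" "\<And>x. x \<notin> K \<Longrightarrow> F' x v = 0"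
  shows "(LINT x|lborel. F' x v) = 0"
proof -
  define h where "h n = inverse (real (Suc n))" for n
  have h: "0 < h n" "h n \<le> 1" for n by (auto simp: h_def inverse_le_1_iff)
  have h0: "h \<longlonglongrightarrow> 0" unfolding h_def by (rule LIMSEQ_inverse_real_of_nat)
  define q where "q n x = (F (x + h n *\<^sub>R v) - F x) / h n" for n x
  have contF: "continuous_on UNIV F"
    by (meson F continuous_at_imp_continuous_on has_derivative_continuous)
  have intF: "integrable lborel F"
  proof -
    have "F = (\<lambda>x. indicator K x *\<^sub>R F x)" using K by (auto simp: indicator_def fun_eq_iff)
    then show ?thesis
      using borel_integrable_compact[OF K(1) continuous_on_subset[OF contF]] by simp
  qed
  have trans: "integrable lborel (\<lambda>x. F (x + c))" "(LINT x|lborel. F (x + c)) = (LINT x|lborel. F x)" for c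
  proof -
    have m: "F \<in> borel_measurable borel" using contF by (rule borel_measurable_continuous_onI)
    have "integrable (distr lborel borel ((+) c)) F" using intF by (simp add: lborel_distr_plus)
    then show "integrable lborel (\<lambda>x. F (x + c))"
      by (subst (asm) integrable_distr_eq) (auto simp: add.commute m)
    have "(LINT x|distr lborel borel ((+) c). F x) = (LINT x|lborel. F (x + c))"
      by (subst integral_distr) (auto simp: add.commute m)
    then show "(LINT x|lborel. F (x + c)) = (LINT x|lborel. F x)" by (simp add: lborel_distr_plus)
  qed
  have q0: "(LINT x|lborel. q n x) = 0" for n
    unfolding q_def using trans intF by simp
  obtain M where M: "\<And>x. \<bar>F' x v\<bar> \<le> M" "0 \<le> M"
  proof -
    have "compact ((\<lambda>x. F' x v) ` K)"
      by (intro compact_continuous_image continuous_on_subset[OF cont] K) auto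
    then obtain M where "\<And>x. x \<in> K \<Longrightarrow> \<bar>F' x v\<bar> \<le> M"
      using compact_imp_bounded[THEN bounded_normE] by (metis bounded_iff imageI real_norm_def compact_imp_bounded)
    then have "\<bar>F' x v\<bar> \<le> \<bar>M\<bar>" for x using K(3) by (cases "x \<in> K") fastforce+
    then show ?thesis by (rule that) simp
  qed
  obtain R where R: "\<And>x. x \<in> K \<Longrightarrow> norm x \<le> R"
    using compact_imp_bounded[OF K(1)] by (auto simp: bounded_iff)
  \<comment> \<open>The dominating function: each quotient is a value of the derivative by the mean
    value theorem. As steps have length at most \<open>norm v\<close>, a point outside the larger
    ball and its translate both miss \<open>K\<close>.\<close>
  have bound: "\<bar>q n x\<bar> \<le> M * indicator (cball 0 (R + norm v)) x" for n x
  proof (cases "x \<in> cball 0 (R + norm v)")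
    case True
    have "\<exists>z>0. z < h n \<and> F (x + h n *\<^sub>R v) - F (x + 0 *\<^sub>R v) = (h n - 0) * F' (x + z *\<^sub>R v) v"
      by (rule MVT2[OF h(1)]) (intro has_real_derivative_along F)
    then obtain z where "F (x + h n *\<^sub>R v) - F x = h n * F' (x + z *\<^sub>R v) v" by auto
    then have "q n x = F' (x + z *\<^sub>R v) v" using h(1)[of n] by (simp add: q_def)
    then show ?thesis using M True by simp
  next
    case False
    then have "R + norm v < norm x" by simp
    have "norm (h n *\<^sub>R v) \<le> norm v" using h[of n] by (simp add: mult_left_le_one_le)
    then have "R < norm (x + h n *\<^sub>R v)"
      using \<open>R + norm v < norm x\<close> norm_diff_ineq[of x "h n *\<^sub>R v"] by linarith
    moreover have "R < norm x" using \<open>R + norm v < norm x\<close> norm_ge_zero[of v] by linarith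
    ultimately have "x \<notin> K" "x + h n *\<^sub>R v \<notin> K" using R by force+
    then show ?thesis using False K(2) by (simp add: q_def)
  qed
  have "(\<lambda>n. LINT x|lborel. q n x) \<longlonglongrightarrow> (LINT x|lborel. F' x v)"
  proof (rule integral_dominated_convergence)
    show "(\<lambda>x. F' x v) \<in> borel_measurable lborel"
      using borel_measurable_continuous_onI[OF cont] by simp
    show "q n \<in> borel_measurable lborel" for n
      unfolding q_def using trans(1) intF by (auto intro!: borel_measurable_diff borel_measurable_divide dest: borel_measurable_integrable)
    show "integrable lborel (\<lambda>x. M * indicator (cball 0 (R + norm v)) x)"
      by (intro integrable_mult_right) (auto intro!: emeasure_compact_finite)
    show "AE x in lborel. norm (q n x) \<le> M * indicator (cball 0 (R + norm v)) x" for n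
      using bound by simp
    have "(\<lambda>n. q n x) \<longlonglongrightarrow> F' x v" for x
    proof -
      have "((\<lambda>s. (F (x + s *\<^sub>R v) - F x) / s) \<longlongrightarrow> F' x v) (at 0)"
        using has_real_derivative_along[of F "F' x" x 0 v] F[of x]
        by (simp add: has_field_derivative_iff)
      moreover have "filterlim h (at 0) sequentially"
        using h0 h(1) by (auto simp: filterlim_at less_imp_neq[symmetric] intro!: always_eventually)
      ultimately show ?thesis unfolding q_def by (rule filterlim_compose)
    qed
    then show "AE x in lborel. (\<lambda>n. q n x) \<longlonglongrightarrow> F' x v" by simp
  qed
  then show ?thesis unfolding q0 by (simp add: LIMSEQ_const_iff)
qed

text \<open>Extension by zero reduces this to the whole space. The extension is differentiable on
  \<open>U\<close>, and also on the open complement of \<open>K\<close>, where it vanishes; the two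
  sets cover everything because \<open>K\<close> lies inside \<open>U\<close>.\<close>

lemma set_integral_directional_derivative_eq_0:
  fixes F :: "'a::euclidean_space \<Rightarrow> real"
  assumes U: "open U" and F: "Ck_on 1 U F"
    and K: "compact K" "K \<subseteq> U" "\<And>x. x \<in> U - K \<Longrightarrow> F x = 0"
  shows "set_integrable lborel U (\<lambda>x. frechet_derivative F (at x) v)"
    and "(LINT x:U|lborel. frechet_derivative F (at x) v) = 0"
proof -
  let ?F = "\<lambda>x. if x \<in> U then F x else 0"
  define F' where "F' x = (if x \<in> K then frechet_derivative F (at x) else (\<lambda>v. 0))" for x
  note F1 = Ck_on_SucD[OF F[unfolded One_nat_def]]
  have out: "(?F has_derivative (\<lambda>v. 0)) (at x)" if "x \<notin> K" for x
    by (rule has_derivative_transform_within_open[OF has_derivative_const[of 0], of "-K"])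
       (use that K compact_imp_closed[OF K(1)] in auto)
  have "in": "(?F has_derivative frechet_derivative F (at x)) (at x)" if "x \<in> U" for x
    by (rule has_derivative_transform_within_open[OF F1(1)[OF that] U that]) auto
  have D: "(?F has_derivative F' x) (at x)" for x
    using "in"[of x] out[of x] K(2) by (cases "x \<in> K") (auto simp: F'_def)
  have eq: "frechet_derivative F (at x) = F' x" if "x \<in> U" for x
    using D[of x] "in"[OF that] has_derivative_unique by blast
  have "isCont (\<lambda>x. F' x v) x" for x
  proof (cases "x \<in> U")
    case True
    have "continuous_on U (\<lambda>x. F' x v)"
      by (rule continuous_on_eq[OF F1(2)[of v, unfolded Ck_on.simps(1)]]) (simp add: eq)
    then show ?thesis using U True continuous_on_eq_continuous_at by blast
  next
    case False
    have "continuous_on (-K) (\<lambda>x. F' x v)"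
      by (rule continuous_on_eq[of _ "\<lambda>x. 0"]) (auto simp: F'_def)
    then show ?thesis
      using compact_imp_closed[OF K(1)] False K(2) continuous_on_eq_continuous_at
      by (metis ComplI open_Compl subsetD)
  qed
  then have C: "continuous_on S (\<lambda>x. F' x v)" for S by (simp add: continuous_at_imp_continuous_on)
  have ind: "(\<lambda>x. indicator U x *\<^sub>R frechet_derivative F (at x) v) = (\<lambda>x. indicator K x *\<^sub>R F' x v)"
       "(\<lambda>x. indicator U x *\<^sub>R frechet_derivative F (at x) v) = (\<lambda>x. F' x v)"
    using eq K(2) by (auto simp: fun_eq_iff indicator_def F'_def)
  show "set_integrable lborel U (\<lambda>x. frechet_derivative F (at x) v)"
    unfolding set_integrable_def ind(1) by (rule borel_integrable_compact[OF K(1) C])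
  show "(LINT x:U|lborel. frechet_derivative F (at x) v) = 0"
    unfolding set_lebesgue_integral_def ind(2)
    by (rule integral_directional_derivative_eq_0[OF D C K(1)]) (use K in \<open>auto simp: F'_def\<close>)
qed

section \<open>Green's identity in a chart\<close>

lemma partialI:
  "(f has_derivative f') (at y) \<Longrightarrow> partial i f y = f' (axis i 1)"
  by (simp add: partial_def frechet_derivativeI)

lemma partial_mult:
  assumes "f differentiable at y" "g differentiable at y"
  shows "partial i (\<lambda>z. f z * g z) y = f y * partial i g y + partial i f y * g y"
  using partialI[OF has_derivative_mult[OF assms[unfolded frechet_derivative_works]]]
  by (simp add: partial_def)

lemma partial_sum:
  assumes "\<And>k. k \<in> I \<Longrightarrow> f k differentiable at y"
  shows "partial i (\<lambda>z. \<Sum>k\<in>I. f k z) y = (\<Sum>k\<in>I. partial i (f k) y)"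
  using partialI[OF has_derivative_sum[OF assms[unfolded frechet_derivative_works]]]
  by (simp add: partial_def)

lemma smooth_on_imp_differentiable: "smooth_on S f \<Longrightarrow> x \<in> S \<Longrightarrow> f differentiable at x"
  using smooth_on_has_derivative differentiable_def by blast

definition volume_density :: "(real^'n \<Rightarrow> real^'n^'n) \<Rightarrow> real^'n \<Rightarrow> real" where
  "volume_density G y = sqrt (det (G y))"

text \<open>The polarisation of |\<nabla>f|_g^2: Green's identity pairs the gradients of two
  different functions.\<close>

definition gradient_product ::
  "(real^'n \<Rightarrow> real^'n^'n) \<Rightarrow> (real^'n \<Rightarrow> real) \<Rightarrow> (real^'n \<Rightarrow> real) \<Rightarrow> real^'n \<Rightarrow> real" where
  "gradient_product G h f y =
     (\<Sum>i\<in>UNIV. \<Sum>j\<in>UNIV. matrix_inv (G y) $ i $ j * partial i h y * partial j f y)"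

lemma gradient_product_eq_inner:
  "gradient_product G h f y = (\<chi> i. partial i h y) \<bullet> (matrix_inv (G y) *v (\<chi> j. partial j f y))"
  by (simp add: gradient_product_def inner_vec_def matrix_vector_mult_def sum_distrib_left mult_ac)

locale coordinate_metric =
  fixes U :: "(real^'n) set" and G :: "real^'n \<Rightarrow> real^'n^'n"
  assumes open_U: "open U" and smooth_G: "smooth_on U G"
    and sym_G: "\<And>y. y \<in> U \<Longrightarrow> transpose (G y) = G y"
    and pos_G: "\<And>y. y \<in> U \<Longrightarrow> pos_def_matrix (G y)"
begin

abbreviation H :: "'n \<Rightarrow> 'n \<Rightarrow> real^'n \<Rightarrow> real" where
  "H i j y \<equiv> matrix_inv (G y) $ i $ j"

abbreviation sqrt_det :: "real^'n \<Rightarrow> real" where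
  "sqrt_det \<equiv> volume_density G"

abbreviation grad_prod :: "(real^'n \<Rightarrow> real) \<Rightarrow> (real^'n \<Rightarrow> real) \<Rightarrow> real^'n \<Rightarrow> real" where
  "grad_prod \<equiv> gradient_product G"

text \<open>The gradient of \<open>f\<close> as a vector density. The factor \<open>sqrt_det\<close>
  turns the covariant divergence into a plain sum of partial derivatives.\<close>

definition flux :: "(real^'n \<Rightarrow> real) \<Rightarrow> 'n \<Rightarrow> real^'n \<Rightarrow> real" where
  "flux f i y = (\<Sum>j\<in>UNIV. sqrt_det y * H i j y * partial j f y)"

lemma invertible_G: "y \<in> U \<Longrightarrow> invertible (G y)"
  using pos_G pos_def_matrix_invertible by blast

lemma H_sym: "y \<in> U \<Longrightarrow> H i j y = H j i y"
  using matrix_inv_symmetric invertible_G sym_G by blast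

lemma smooth_G_nth: "smooth_on U (\<lambda>y. G y $ i $ j)"
  using smooth_on_bounded_linear[OF open_U bounded_linear_vec_nth
      smooth_on_bounded_linear[OF open_U bounded_linear_vec_nth smooth_G]] .

lemma smooth_H: "smooth_on U (H i j)"
  by (intro smooth_on_matrix_inv open_U smooth_G_nth invertible_G)

lemma smooth_christoffel: "smooth_on U (christoffel G k i j)"
proof -
  have "smooth_on U (\<lambda>y. (\<Sum>l\<in>UNIV. H k l y * (partial i (\<lambda>z. G z $ j $ l) y
     + partial j (\<lambda>z. G z $ i $ l) y - partial l (\<lambda>z. G z $ i $ j) y)) * (1 / 2))"
    by (rule smooth_on_mult[OF open_U smooth_on_sum[OF open_U smooth_on_mult[OF open_U smooth_H
        smooth_on_diff[OF open_U smooth_on_add[OF open_U]]]] smooth_on_const[OF open_U]])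
       (rule smooth_on_partial[OF smooth_G_nth])+
  then show ?thesis by (simp add: christoffel_def[abs_def])
qed

lemma partial_G: 
  "y \<in> U \<Longrightarrow> partial i (\<lambda>z. G z $ a $ b) y = frechet_derivative G (at y) (axis i 1) $ a $ b"
  by (rule partialI[OF has_derivative_matrix_nth[OF smooth_on_has_derivative[OF smooth_G]]])

lemma sqrt_det_pos: "y \<in> U \<Longrightarrow> 0 < sqrt_det y"
  using pos_def_matrix_det_pos[OF pos_G] by (simp add: volume_density_def)

lemma sqrt_det_has_derivative:
  assumes "y \<in> U"
  shows "(sqrt_det has_derivative (\<lambda>v. sqrt_det y / 2 *
      (\<Sum>a\<in>UNIV. \<Sum>b\<in>UNIV. H b a y * frechet_derivative G (at y) v $ a $ b))) (at y)"
proof -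
  have pos: "0 < det (G y)" using pos_def_matrix_det_pos[OF pos_G[OF assms]] .
  have "((\<lambda>y. sqrt (det (G y))) has_derivative (\<lambda>v. det (G y) * (\<Sum>a\<in>UNIV. \<Sum>b\<in>UNIV. H b a y * frechet_derivative G (at y) v $ a $ b)
      * (inverse (sqrt (det (G y))) / 2))) (at y)"
    using has_derivative_compose[OF has_derivative_det[OF smooth_on_has_derivative[OF smooth_G assms] matrix_inv(2)[OF invertible_G[OF assms]]]
     DERIV_real_sqrt[OF pos, unfolded has_field_derivative_def]]
    by (simp add: mult_ac)
  moreover have "det (G y) * x * (inverse (sqrt (det (G y))) / 2) = sqrt_det y / 2 * x" for x
    using pos unfolding volume_density_def 
    by (simp add: field_simps)
  ultimately have "((\<lambda>y. sqrt (det (G y))) has_derivative (\<lambda>v. sqrt_det y / 2 *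
      (\<Sum>a\<in>UNIV. \<Sum>b\<in>UNIV. H b a y * frechet_derivative G (at y) v $ a $ b))) (at y)"
    by (simp only:)
  moreover have "(\<lambda>y. sqrt (det (G y))) = sqrt_det" by (simp add: fun_eq_iff volume_density_def)
  ultimately show ?thesis by (simp only:)
qed

lemma partial_sqrt_det:
  assumes "y \<in> U"
  shows "partial i sqrt_det y = sqrt_det y / 2 * (\<Sum>a\<in>UNIV. \<Sum>b\<in>UNIV. H b a y * partial i (\<lambda>z. G z $ a $ b) y)"
  using partialI[OF sqrt_det_has_derivative[OF assms]] by (simp add: partial_G assms)

lemma sqrt_det_differentiable: "y \<in> U \<Longrightarrow> sqrt_det differentiable at y"
  using sqrt_det_has_derivative differentiable_def by blast

text \<open>The formula for the derivative contains \<open>sqrt_det\<close> again, whose continuity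
  comes from its differentiability; the remaining factors come from the smooth metric and its
  inverse.\<close>

lemma Ck_on_sqrt_det: "Ck_on 1 U sqrt_det"
proof -
  have c: "continuous_on U sqrt_det"
    using sqrt_det_differentiable differentiable_imp_continuous_within
    by (blast intro: continuous_at_imp_continuous_on)
  have d: "continuous_on U (\<lambda>x. frechet_derivative G (at x) v $ a $ b)" for v a b
    by (intro continuous_intros smooth_on_imp_continuous_on[OF smooth_on_directional[OF smooth_G]])
  show ?thesis unfolding One_nat_def
    by (rule Ck_on_SucI[OF open_U sqrt_det_has_derivative])
       (auto intro!: continuous_intros c d smooth_on_imp_continuous_on[OF smooth_H])
qed

text \<open>Differentiate the identity \<open>G z ** matrix_inv (G z) = mat 1\<close>, valid on all
  of \<open>U\<close>, entry by entry and multiply by the inverse matrix from the left.\<close>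

lemma partial_H:
  assumes y: "y \<in> U"
  shows "partial i (H j k) y = - (\<Sum>a\<in>UNIV. \<Sum>b\<in>UNIV. H j a y * partial i (\<lambda>z. G z $ a $ b) y * H b k y)"
proof -
  let ?D = "\<chi> a b. partial i (\<lambda>z. G z $ a $ b) y" and ?E = "\<chi> a b. partial i (H a b) y"
  note dG = smooth_on_imp_differentiable[OF smooth_G_nth y]
  note dH = smooth_on_imp_differentiable[OF smooth_H y]
  have "?D ** matrix_inv (G y) + G y ** ?E = 0"
  proof -
    have "(?D ** matrix_inv (G y) + G y ** ?E) $ a $ b = 0" for a b
    proof -
      have "partial i (\<lambda>z. (G z ** matrix_inv (G z)) $ a $ b) y = (\<Sum>l\<in>UNIV. partial i (\<lambda>z. G z $ a $ l * H l b z) y)"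
        by (simp add: matrix_matrix_mult_def partial_sum differentiable_mult dG dH)
      also have "\<dots> = (?D ** matrix_inv (G y) + G y ** ?E) $ a $ b"
        by (simp add: matrix_matrix_mult_def partial_mult dG dH sum.distrib add.commute)
      finally have "(?D ** matrix_inv (G y) + G y ** ?E) $ a $ b = partial i (\<lambda>z. (G z ** matrix_inv (G z)) $ a $ b) y" by simp
      moreover have "((\<lambda>z. (G z ** matrix_inv (G z)) $ a $ b) has_derivative (\<lambda>v. 0)) (at y)"
        by (rule has_derivative_transform_within_open[OF has_derivative_const open_U y, of "mat 1 $ a $ b"])
           (simp add: matrix_inv(1)[OF invertible_G])
      ultimately show ?thesis by (simp add: partialI)
    qed
    then show ?thesis by (simp add: vec_eq_iff)
  qed
  then have "matrix_inv (G y) ** (?D ** matrix_inv (G y)) + ?E = 0"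
  proof -
    assume *: "?D ** matrix_inv (G y) + G y ** ?E = 0"
    have "matrix_inv (G y) ** (?D ** matrix_inv (G y)) + ?E
      = matrix_inv (G y) ** (?D ** matrix_inv (G y) + G y ** ?E)"
      unfolding matrix_add_ldistrib matrix_mul_assoc[of _ "G y"] matrix_inv(2)[OF invertible_G[OF y]]
      by simp
    also have "\<dots> = 0" unfolding * by (simp add: vec_eq_iff matrix_matrix_mult_def)
    finally show ?thesis .
  qed
  then have "?E $ j $ k = - (matrix_inv (G y) ** (?D ** matrix_inv (G y))) $ j $ k"
    by (simp add: eq_neg_iff_add_eq_0 vec_eq_iff add.commute)
  then show ?thesis
    by (simp add: matrix_matrix_mult_def sum_distrib_left mult.assoc)
qed

text \<open>The link between the Hessian form and the divergence form of the Laplacian. The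
  derivatives of the inverse and of the volume density, both expressed by derivatives of
  \<open>G\<close>, combine to the right side of \<open>christoffel_contraction\<close>.\<close>

lemma divergence_sqrt_det_H:
  assumes y: "y \<in> U"
  shows "(\<Sum>i\<in>UNIV. partial i (\<lambda>z. sqrt_det z * H i j z) y)
    = - (sqrt_det y * (\<Sum>k\<in>UNIV. \<Sum>l\<in>UNIV. H k l y * christoffel G j k l y))"
proof -
  let ?T = "\<lambda>i a b. partial i (\<lambda>z. G z $ a $ b) y"
  have "(\<Sum>i\<in>UNIV. partial i (\<lambda>z. sqrt_det z * H i j z) y)
     = - (sqrt_det y * ((\<Sum>i\<in>UNIV. \<Sum>a\<in>UNIV. \<Sum>b\<in>UNIV. H i a y * ?T i a b * H b j y)
      - (\<Sum>i\<in>UNIV. (\<Sum>a\<in>UNIV. \<Sum>b\<in>UNIV. H b a y * ?T i a b) * H i j y) / 2))"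
    by (simp add: partial_mult sqrt_det_differentiable y smooth_on_imp_differentiable[OF smooth_H y]
        partial_H partial_sqrt_det sum.distrib sum_distrib_left sum_negf sum_divide_distrib
        sum_subtractf right_diff_distrib mult_ac)
  also have "\<dots> = - (sqrt_det y * (\<Sum>k\<in>UNIV. \<Sum>l\<in>UNIV. H k l y * christoffel G j k l y))"
    unfolding christoffel_def
    using christoffel_contraction[of "\<lambda>i j. H i j y" j ?T] H_sym[OF y] by simp
  finally show ?thesis .
qed

text \<open>By the product rule the derivative falls either on the partials of \<open>f\<close>,
  giving the second-order part of the Laplacian, or on the coefficients, giving its Christoffel
  part.\<close>

lemma divergence_flux:
  assumes f: "smooth_on U f" and y: "y \<in> U"
  shows "(\<Sum>i\<in>UNIV. partial i (flux f i) y) = sqrt_det y * laplacian_coord G f y"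
proof -
  have df: "partial j f differentiable at y" for j
    using smooth_on_imp_differentiable[OF smooth_on_partial[OF f] y] .
  have d: "(\<lambda>z. sqrt_det z * H i j z) differentiable at y" for i j
    by (intro differentiable_mult sqrt_det_differentiable[OF y] smooth_on_imp_differentiable[OF smooth_H y])
  have "(\<Sum>i\<in>UNIV. partial i (flux f i) y)
     = (\<Sum>i\<in>UNIV. \<Sum>j\<in>UNIV. sqrt_det y * H i j y * partial i (partial j f) y
          + partial i (\<lambda>z. sqrt_det z * H i j z) y * partial j f y)"
    unfolding flux_def[abs_def] by (simp add: partial_sum partial_mult[OF d df] differentiable_mult d df)
  also have "\<dots> = (\<Sum>i\<in>UNIV. \<Sum>j\<in>UNIV. sqrt_det y * H i j y * partial i (partial j f) y)
      + (\<Sum>j\<in>UNIV. (\<Sum>i\<in>UNIV. partial i (\<lambda>z. sqrt_det z * H i j z) y) * partial j f y)"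
    unfolding sum.distrib sum_distrib_right by (subst (3) sum.swap) simp
  also have "\<dots> = sqrt_det y * laplacian_coord G f y"
  proof -
    have "(\<Sum>j\<in>UNIV. (\<Sum>k\<in>UNIV. \<Sum>l\<in>UNIV. H k l y * christoffel G j k l y) * partial j f y)
      = (\<Sum>i\<in>UNIV. \<Sum>j\<in>UNIV. H i j y * (\<Sum>k\<in>UNIV. christoffel G k i j y * partial k f y))"
    proof -
      have "(\<Sum>j\<in>UNIV. (\<Sum>k\<in>UNIV. \<Sum>l\<in>UNIV. H k l y * christoffel G j k l y) * partial j f y)
        = (\<Sum>k\<in>UNIV. \<Sum>j\<in>UNIV. \<Sum>l\<in>UNIV. H k l y * christoffel G j k l y * partial j f y)"
        unfolding sum_distrib_right by (rule sum.swap)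
      also have "\<dots> = (\<Sum>k\<in>UNIV. \<Sum>l\<in>UNIV. \<Sum>j\<in>UNIV. H k l y * christoffel G j k l y * partial j f y)"
        by (intro sum.cong refl sum.swap)
      finally show ?thesis by (simp add: sum_distrib_left mult.assoc)
    qed
    then show ?thesis
      unfolding laplacian_coord_def hessian_coord_def divergence_sqrt_det_H[OF y]
      by (simp add: right_diff_distrib sum_subtractf sum_distrib_left[symmetric] mult.assoc sum_negf
          sum_distrib_right[symmetric])
  qed
  finally show ?thesis .
qed

lemma smooth_laplacian_coord: "smooth_on U f \<Longrightarrow> smooth_on U (laplacian_coord G f)"
  unfolding laplacian_coord_def[abs_def] hessian_coord_def
  by (intro smooth_on_sum smooth_on_mult smooth_on_diff smooth_H smooth_on_partial
        smooth_christoffel open_U)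

lemma continuous_on_grad_prod:
  assumes "Ck_on 1 U h" "Ck_on 1 U f"
  shows "continuous_on U (grad_prod h f)"
proof -
  have "continuous_on U (partial i h)" "continuous_on U (partial i f)" for i
    using assms by (simp_all add: partial_def[abs_def])
  then show ?thesis
    unfolding gradient_product_def[abs_def]
    by (intro continuous_intros smooth_on_imp_continuous_on[OF smooth_H])
qed

text \<open>The integrand is the coordinate divergence of \<open>h\<close> times
  \<open>flux f\<close>, a C^1 field vanishing off \<open>K\<close>, so every summand of the
  divergence integrates to zero.\<close>

lemma green_chart:
  assumes f: "smooth_on U f" and h: "Ck_on 1 U h"
    and K: "compact K" "K \<subseteq> U" "\<And>y. y \<in> U - K \<Longrightarrow> h y = 0"
  shows "(LINT y:U|lborel. sqrt_det y * (h y * laplacian_coord G f y + grad_prod h f y)) = 0"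
proof -
  have C: "Ck_on 1 U (flux f i)" for i
    unfolding flux_def[abs_def]
    using smooth_H smooth_on_partial[OF f] unfolding smooth_on_def
    by (intro Ck_on_sum Ck_on_mult Ck_on_sqrt_det open_U) auto
  have F: "Ck_on 1 U (\<lambda>z. h z * flux f i z)" for i
    by (intro Ck_on_mult open_U h C)
  have eq: "(\<Sum>i\<in>UNIV. frechet_derivative (\<lambda>z. h z * flux f i z) (at y) (axis i 1))
     = sqrt_det y * (h y * laplacian_coord G f y + grad_prod h f y)" if y: "y \<in> U" for y
  proof -
    have d: "h differentiable at y" "flux f i differentiable at y" for i
      using h C[of i] y by auto
    have "(\<Sum>i\<in>UNIV. frechet_derivative (\<lambda>z. h z * flux f i z) (at y) (axis i 1))
        = (\<Sum>i\<in>UNIV. h y * partial i (flux f i) y + partial i h y * flux f i y)"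
      by (simp add: partial_def[symmetric] partial_mult[OF d])
    also have "\<dots> = h y * (sqrt_det y * laplacian_coord G f y) + sqrt_det y * grad_prod h f y"
      unfolding sum.distrib sum_distrib_left[symmetric] divergence_flux[OF f y]
      by (simp add: flux_def gradient_product_def sum_distrib_left mult_ac)
    finally show ?thesis by (simp add: algebra_simps)
  qed
  have "(LINT y:U|lborel. sqrt_det y * (h y * laplacian_coord G f y + grad_prod h f y))
    = (LINT y:U|lborel. (\<Sum>i\<in>UNIV. frechet_derivative (\<lambda>z. h z * flux f i z) (at y) (axis i 1)))"
    by (rule set_lebesgue_integral_cong) (use open_U eq in auto)
  also have "\<dots> = (\<Sum>i\<in>UNIV. LINT y:U|lborel. frechet_derivative (\<lambda>z. h z * flux f i z) (at y) (axis i 1))"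
    using set_integral_directional_derivative_eq_0(1)[OF open_U F K(1,2)] K(3)
    unfolding set_lebesgue_integral_def set_integrable_def scaleR_sum_right
    by (subst Bochner_Integration.integral_sum) auto
  also have "\<dots> = 0"
    using set_integral_directional_derivative_eq_0(2)[OF open_U F K(1,2)] K(3) by simp
  finally show ?thesis .
qed

end

section \<open>Green's identity on a closed Riemannian manifold\<close>

locale closed_riemannian_manifold =
  fixes At :: "('m::{t2_space, second_countable_topology}, 'n::finite) chart set"
    and g :: "('m, 'n) metric" and vol :: "'m measure"
  assumes compact_M: "compact (UNIV :: 'm set)" and atlas: "smooth_atlas At"
    and metric_g: "riemannian_metric At g" and volume: "riemannian_volume At g vol"
begin

section \<open>Charts, and continuity tested in charts\<close>

lemma
  assumes "c \<in> At"
  shows open_cdom: "open (cdom c)" and open_cimg: "open (cimg c)"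
    and homeo_chart: "homeomorphism (cdom c) (cimg c) (coord c) (param c)"
  using assms atlas by (auto simp: smooth_atlas_def)

lemma
  assumes "c \<in> At"
  shows coord_in: "x \<in> cdom c \<Longrightarrow> coord c x \<in> cimg c"
    and param_in: "y \<in> cimg c \<Longrightarrow> param c y \<in> cdom c"
    and param_coord: "x \<in> cdom c \<Longrightarrow> param c (coord c x) = x"
    and coord_param: "y \<in> cimg c \<Longrightarrow> coord c (param c y) = y"
    and continuous_coord: "continuous_on (cdom c) (coord c)"
    and continuous_param: "continuous_on (cimg c) (param c)"
  using homeo_chart[OF assms] by (auto simp: homeomorphism_def)

lemma chart_at_in: "chart_at At x \<in> At" "x \<in> cdom (chart_at At x)"
proof -
  have "x \<in> (\<Union>c\<in>At. cdom c)" using atlas by (simp add: smooth_atlas_def)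
  then have "\<exists>c. c \<in> At \<and> x \<in> cdom c" by blast
  then have "chart_at At x \<in> At \<and> x \<in> cdom (chart_at At x)"
    unfolding chart_at_def by (rule someI_ex)
  then show "chart_at At x \<in> At" "x \<in> cdom (chart_at At x)" by auto
qed

lemma coord_image:
  assumes "c \<in> At" "V \<subseteq> cdom c"
  shows "coord c ` V = {y \<in> cimg c. param c y \<in> V}"
proof (intro equalityI subsetI)
  fix y assume "y \<in> {y \<in> cimg c. param c y \<in> V}"
  then show "y \<in> coord c ` V"
    using coord_param[OF assms(1)] by (intro image_eqI[of _ _ "param c y"]) auto
next
  fix y assume "y \<in> coord c ` V"
  then show "y \<in> {y \<in> cimg c. param c y \<in> V}"
    using assms(2) coord_in[OF assms(1)] param_coord[OF assms(1)] by auto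
qed

lemma open_param_vimage:
  assumes "c \<in> At" "open V"
  shows "open {y \<in> cimg c. param c y \<in> V}"
  using continuous_open_preimage[OF continuous_param[OF assms(1)] open_cimg[OF assms(1)] assms(2)]
  by (simp add: vimage_def Int_def)

lemma open_coord_image: "c \<in> At \<Longrightarrow> open V \<Longrightarrow> V \<subseteq> cdom c \<Longrightarrow> open (coord c ` V)"
  using coord_image open_param_vimage by simp

lemma open_param_image:
  assumes "c \<in> At" "open W" "W \<subseteq> cimg c"
  shows "open (param c ` W)"
proof -
  have "x \<in> param c ` W" if "x \<in> cdom c" "coord c x \<in> W" for x
    using that param_coord[OF assms(1) that(1)] by (intro image_eqI[of _ _ "coord c x"]) auto
  then have "param c ` W = cdom c \<inter> coord c -` W"
    using assms(3) coord_param[OF assms(1)] param_in[OF assms(1)] by auto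
  then show ?thesis
    using continuous_open_preimage[OF continuous_coord[OF assms(1)] open_cdom[OF assms(1)] assms(2)] by simp
qed

lemma compact_param_image: "c \<in> At \<Longrightarrow> compact K \<Longrightarrow> K \<subseteq> cimg c \<Longrightarrow> compact (param c ` K)"
  using compact_continuous_image continuous_on_subset continuous_param by metis

lemma coordinate_metric_chart: "c \<in> At \<Longrightarrow> coordinate_metric (cimg c) (g c)"
  using metric_g open_cimg
  by unfold_locales (auto simp: riemannian_metric_def pos_def_matrix_def)

lemma continuous_on_charts:
  fixes u :: "'m \<Rightarrow> 'b::topological_space"
  assumes "\<And>c. c \<in> At \<Longrightarrow> continuous_on (cimg c) (\<lambda>y. u (param c y))"
  shows "continuous_on UNIV u"
proof (rule continuous_at_imp_continuous_on, rule ballI)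
  fix x
  let ?c = "chart_at At x"
  note c = chart_at_in[of x]
  have "continuous_on (cdom ?c) (\<lambda>x. u (param ?c (coord ?c x)))"
    using coord_in[OF c(1)]
    by (intro continuous_on_compose2[OF assms[OF c(1)] continuous_coord[OF c(1)]]) auto
  then have "continuous_on (cdom ?c) u"
    by (rule continuous_on_eq) (simp add: param_coord[OF c(1)])
  then show "isCont u x"
    using c open_cdom continuous_on_eq_continuous_at by blast
qed

lemma continuous_on_charts_product:
  fixes u :: "'t::t2_space \<times> 'm \<Rightarrow> 'b::topological_space"
  assumes "open I" "\<And>c. c \<in> At \<Longrightarrow> continuous_on (I \<times> cimg c) (\<lambda>(t, y). u (t, param c y))"
  shows "continuous_on (I \<times> UNIV) u"
proof (rule continuous_at_imp_continuous_on, rule ballI)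
  fix p :: "'t \<times> 'm" assume p: "p \<in> I \<times> UNIV"
  let ?c = "chart_at At (snd p)"
  note c = chart_at_in[of "snd p"]
  have "continuous_on (I \<times> cdom ?c) (\<lambda>q. (fst q, coord ?c (snd q)))"
    by (intro continuous_intros continuous_on_compose2[OF continuous_coord[OF c(1)]]) auto
  then have "continuous_on (I \<times> cdom ?c) (\<lambda>q. case (fst q, coord ?c (snd q)) of (t, y) \<Rightarrow> u (t, param ?c y))"
    using coord_in[OF c(1)]
    by (intro continuous_on_compose2[OF assms(2)[OF c(1)], of _ "\<lambda>q. (fst q, coord ?c (snd q))"]) auto
  then have "continuous_on (I \<times> cdom ?c) u"
    by (rule continuous_on_eq) (auto simp: param_coord[OF c(1)])
  moreover have "open (I \<times> cdom ?c)" "p \<in> I \<times> cdom ?c"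
    using open_Times[OF assms(1) open_cdom[OF c(1)]] p c(2) by (auto simp: mem_Times_iff)
  ultimately show "isCont u p"
    using continuous_on_eq_continuous_at by blast
qed

section \<open>Changes of charts and the gradient product\<close>

lemma transition_smooth:
  assumes "c \<in> At" "d \<in> At"
  shows "smooth_on (coord c ` (cdom c \<inter> cdom d)) (transition c d)"
    "open (coord c ` (cdom c \<inter> cdom d))"
  using assms atlas open_coord_image[OF assms(1) open_Int[OF open_cdom open_cdom]]
  by (simp_all add: smooth_atlas_def)

lemma transition_coord: "c \<in> At \<Longrightarrow> x \<in> cdom c \<Longrightarrow> transition c d (coord c x) = coord d x"
  by (simp add: transition_def param_coord)

lemma metric_transform:
  assumes "c \<in> At" "d \<in> At" "x \<in> cdom c" "x \<in> cdom d"
    and "J = matrix (frechet_derivative (transition c d) (at (coord c x)))"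
  shows "g c (coord c x) = transpose J ** g d (coord d x) ** J"
proof -
  have "coord c x \<in> coord c ` (cdom c \<inter> cdom d)" using assms by blast
  then show ?thesis
    using metric_g assms(1,2) transition_coord[OF assms(1,3), of d]
    unfolding riemannian_metric_def assms(5) Let_def by metis
qed

text \<open>The chart is a parameter here, whereas \<open>laplacian\<close> selects one anew at each
  point. Regularity in \<open>x\<close> is visible only with the chart kept fixed.\<close>

definition lap :: "('m, 'n) chart \<Rightarrow> ('m \<Rightarrow> real) \<Rightarrow> 'm \<Rightarrow> real" where
  "lap c f x = laplacian_coord (g c) (f \<circ> param c) (coord c x)"

definition gprod :: "('m, 'n) chart \<Rightarrow> ('m \<Rightarrow> real) \<Rightarrow> ('m \<Rightarrow> real) \<Rightarrow> 'm \<Rightarrow> real" where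
  "gprod c h f x = gradient_product (g c) (h \<circ> param c) (f \<circ> param c) (coord c x)"

text \<open>The class of test functions in Green's identity; it contains the bumps, which are built
  from squares of truncated quadratics.\<close>

definition C1_fun :: "('m \<Rightarrow> real) \<Rightarrow> bool" where
  "C1_fun u \<longleftrightarrow> (\<forall>c\<in>At. Ck_on 1 (cimg c) (u \<circ> param c))"

lemma smooth_imp_C1_fun: "smooth_fun At f \<Longrightarrow> C1_fun f"
  unfolding smooth_fun_def C1_fun_def smooth_on_def by blast

lemma C1_fun_differentiable:
  "C1_fun f \<Longrightarrow> c \<in> At \<Longrightarrow> y \<in> cimg c \<Longrightarrow> (f \<circ> param c) differentiable at y"
  by (auto simp: C1_fun_def)

lemma C1_fun_continuous:
  assumes "C1_fun f" shows "continuous_on UNIV f"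
proof (rule continuous_on_charts)
  fix c assume "c \<in> At"
  then have "Ck_on 1 (cimg c) (f \<circ> param c)" using assms by (simp add: C1_fun_def)
  from Ck_on_imp_continuous_on[OF this]
  show "continuous_on (cimg c) (\<lambda>y. f (param c y))" by (simp add: comp_def)
qed

lemma C1_fun_mult: "C1_fun u \<Longrightarrow> C1_fun v \<Longrightarrow> C1_fun (\<lambda>x. u x * v x)"
  by (simp add: C1_fun_def comp_def Ck_on_mult open_cimg del: Ck_on.simps One_nat_def)

lemma C1_fun_sum: "(\<And>i. i \<in> I \<Longrightarrow> C1_fun (u i)) \<Longrightarrow> C1_fun (\<lambda>x. \<Sum>i\<in>I. u i x)"
  by (simp add: C1_fun_def comp_def Ck_on_sum open_cimg del: Ck_on.simps One_nat_def)

lemma C1_fun_inverse: "C1_fun u \<Longrightarrow> (\<And>x. u x \<noteq> 0) \<Longrightarrow> C1_fun (\<lambda>x. inverse (u x))"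
  by (simp add: C1_fun_def comp_def Ck_on_inverse open_cimg del: Ck_on.simps One_nat_def)

text \<open>Chain rule for \<open>h \<circ> param c\<close>, which near the point is
  \<open>h \<circ> param d\<close> after the transition map: differentials transform by the
  transposed Jacobian.\<close>

lemma partial_transition:
  assumes cd: "c \<in> At" "d \<in> At" "x \<in> cdom c" "x \<in> cdom d"
    and J: "J = matrix (frechet_derivative (transition c d) (at (coord c x)))"
    and h: "(h \<circ> param d) differentiable at (coord d x)"
  shows "(\<chi> i. partial i (h \<circ> param c) (coord c x)) = transpose J *v (\<chi> i. partial i (h \<circ> param d) (coord d x))"
proof -
  let ?W = "coord c ` (cdom c \<inter> cdom d)" and ?y = "coord c x"
  let ?T = "frechet_derivative (transition c d) (at ?y)"
  let ?h = "frechet_derivative (h \<circ> param d) (at (coord d x))"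
  have y: "?y \<in> ?W" using cd by blast
  have T: "(transition c d has_derivative ?T) (at ?y)"
    by (rule smooth_on_has_derivative[OF transition_smooth(1)[OF cd(1,2)] y])
  have hd: "(h \<circ> param d has_derivative ?h) (at (coord d x))"
    using h frechet_derivative_works by blast
  have "((\<lambda>z. (h \<circ> param d) (transition c d z)) has_derivative (\<lambda>v. ?h (?T v))) (at ?y)"
    by (rule has_derivative_compose[OF T]) (simp only: transition_coord[OF cd(1,3)] hd)
  then have "(h \<circ> param c has_derivative (\<lambda>v. ?h (?T v))) (at ?y)"
    by (rule has_derivative_transform_within_open[OF _ transition_smooth(2)[OF cd(1,2)] y])
       (auto simp: transition_def param_coord cd)
  then have "partial i (h \<circ> param c) ?y = ?h (?T (axis i 1))" for i
    by (rule partialI)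
  moreover have "?h (?T (axis i 1)) = (\<Sum>a\<in>UNIV. J $ a $ i * partial a (h \<circ> param d) (coord d x))" for i
  proof -
    have "?T (axis i 1) = (\<Sum>a\<in>UNIV. J $ a $ i *\<^sub>R axis a 1)"
      unfolding J matrix_def by (simp add: vec_eq_iff axis_def if_distrib sum.delta cong: if_cong)
    then show ?thesis
      using has_derivative_linear[OF hd]
      by (simp add: linear_sum linear_scale partial_def)
  qed
  ultimately show ?thesis
    by (simp add: vec_eq_iff matrix_vector_mult_def transpose_def)
qed

text \<open>The Gram matrices satisfy A = J^T B J, hence J A^-1 J^T = B^-1, and this is exactly the
  matrix that appears when both differentials are transformed by J^T. No second derivative of the
  transition map enters.\<close>

lemma gprod_chart:
  assumes cd: "c \<in> At" "d \<in> At" "x \<in> cdom c" "x \<in> cdom d"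
    and "(h \<circ> param d) differentiable at (coord d x)" "(f \<circ> param d) differentiable at (coord d x)"
  shows "gprod c h f x = gprod d h f x"
proof -
  interpret C: coordinate_metric "cimg c" "g c" by (rule coordinate_metric_chart[OF cd(1)])
  interpret D: coordinate_metric "cimg d" "g d" by (rule coordinate_metric_chart[OF cd(2)])
  define J where "J = matrix (frechet_derivative (transition c d) (at (coord c x)))"
  let ?A = "g c (coord c x)" and ?B = "g d (coord d x)"
  let ?A' = "matrix_inv ?A" and ?B' = "matrix_inv ?B"
  let ?p = "\<lambda>h. \<chi> i. partial i (h \<circ> param d) (coord d x)"
  note Ai = matrix_inv[OF C.invertible_G[OF coord_in[OF cd(1,3)]]]
  note Bi = matrix_inv[OF D.invertible_G[OF coord_in[OF cd(2,4)]]]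
  have A: "?A = transpose J ** ?B ** J" by (rule metric_transform[OF cd J_def])
  \<comment> \<open>This exhibits a left inverse of \<open>J\<close>, which for a square matrix is
    also a right inverse; invertibility of the Jacobian thus comes from the metric, without the
    inverse transition map.\<close>
  have "?A' ** transpose J ** ?B ** J = mat 1" using Ai(2) unfolding A by (simp add: matrix_mul_assoc)
  then have "J ** (?A' ** transpose J ** ?B) = mat 1" using matrix_left_right_inverse by blast
  then have "(J ** ?A' ** transpose J) ** ?B = mat 1" by (simp add: matrix_mul_assoc)
  then have B': "J ** ?A' ** transpose J = ?B'"
    using Bi by (metis matrix_mul_assoc matrix_mul_lid matrix_mul_rid)
  have "gprod c h f x = (transpose J *v ?p h) \<bullet> (?A' *v (transpose J *v ?p f))"
    unfolding gprod_def gradient_product_eq_inner using partial_transition[OF cd J_def] assms(5,6) by simp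
  also have "\<dots> = ?p h \<bullet> ((J ** ?A' ** transpose J) *v ?p f)"
  proof -
    have "(transpose J *v ?p h) \<bullet> w = ?p h \<bullet> (J *v w)" for w by (simp add: dot_lmul_matrix)
    then show ?thesis by (simp only: matrix_vector_mul_assoc matrix_mul_assoc)
  qed
  also have "\<dots> = gprod d h f x"
    unfolding B' gprod_def gradient_product_eq_inner ..
  finally show ?thesis .
qed

lemma gprod_eq_0:
  assumes "c \<in> At" "open V" "x \<in> V" "x \<in> cdom c" "\<And>z. z \<in> V \<Longrightarrow> h z = 0"
  shows "gprod c h f x = 0"
proof -
  have "(h \<circ> param c has_derivative (\<lambda>v. 0)) (at (coord c x))"
    by (rule has_derivative_transform_within_open[OF has_derivative_const open_param_vimage[OF assms(1,2)], of _ 0])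
       (use assms in \<open>auto simp: coord_in param_coord\<close>)
  then have "partial i (h \<circ> param c) (coord c x) = 0" for i by (rule partialI)
  then show ?thesis by (simp add: gprod_def gradient_product_def)
qed

lemma continuous_on_lap:
  assumes "c \<in> At" "smooth_fun At f"
  shows "continuous_on (cdom c) (lap c f)"
proof -
  interpret C: coordinate_metric "cimg c" "g c" by (rule coordinate_metric_chart[OF assms(1)])
  have "continuous_on (cimg c) (laplacian_coord (g c) (f \<circ> param c))"
    using assms by (intro smooth_on_imp_continuous_on C.smooth_laplacian_coord) (auto simp: smooth_fun_def)
  then show ?thesis unfolding lap_def[abs_def]
    by (rule continuous_on_compose2[OF _ continuous_coord[OF assms(1)]]) (use coord_in[OF assms(1)] in auto)
qed

lemma continuous_on_gprod:
  assumes "c \<in> At" "Ck_on 1 (cimg c) (h \<circ> param c)" "Ck_on 1 (cimg c) (f \<circ> param c)"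
  shows "continuous_on (cdom c) (gprod c h f)"
proof -
  interpret C: coordinate_metric "cimg c" "g c" by (rule coordinate_metric_chart[OF assms(1)])
  show ?thesis unfolding gprod_def[abs_def]
    by (rule continuous_on_compose2[OF C.continuous_on_grad_prod[OF assms(2,3)] continuous_coord[OF assms(1)]])
       (use coord_in[OF assms(1)] in auto)
qed

section \<open>The volume measure and integration in one chart\<close>

lemma sets_vol [measurable_cong]: "sets vol = sets borel"
  using volume by (simp add: riemannian_volume_def)

lemma space_vol [simp]: "space vol = UNIV"
  using sets_eq_imp_space_eq[OF sets_vol] by simp

lemma emeasure_vol:
  assumes "c \<in> At" "S \<in> sets borel" "S \<subseteq> cdom c"
  shows "emeasure vol S = (\<integral>\<^sup>+y. ennreal (volume_density (g c) y) * indicator (coord c ` S) y \<partial>lborel)"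
  using volume assms by (simp add: riemannian_volume_def volume_density_def)

lemma continuous_on_volume_density: "c \<in> At \<Longrightarrow> continuous_on (cimg c) (volume_density (g c))"
  using coordinate_metric.Ck_on_sqrt_det[OF coordinate_metric_chart] Ck_on_imp_continuous_on by blast

text \<open>The volume is specified only by its values on Borel subsets of chart domains. These
  values say that its restriction to \<open>cdom c\<close> is the image under \<open>param c\<close>
  of Lebesgue measure with density \<open>volume_density (g c)\<close>, and the formula follows from
  the rules for densities and image measures.\<close>

lemma chart_integral:
  fixes u :: "'m \<Rightarrow> real"
  assumes c: "c \<in> At" and u: "continuous_on (cdom c) u"
  shows "(LINT x:cdom c|vol. u x) = (LINT y:cimg c|lborel. volume_density (g c) y * u (param c y))"
proof -
  let ?w = "\<lambda>y. indicator (cimg c) y * volume_density (g c) y"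
  let ?N = "density lborel (\<lambda>y. ennreal (?w y))"
  \<comment> \<open>Constant outside the chart image, to obtain a Borel map on the whole space; the
    density \<open>?w\<close> vanishes there.\<close>
  let ?p = "\<lambda>y. if y \<in> cimg c then param c y else undefined"
  interpret C: coordinate_metric "cimg c" "g c" by (rule coordinate_metric_chart[OF c])
  have dom: "cdom c \<in> sets borel" "cimg c \<in> sets borel" using open_cdom open_cimg c by auto
  have w: "?w \<in> borel_measurable borel"
    using borel_measurable_continuous_on_indicator[OF dom(2) continuous_on_volume_density[OF c]] by simp
  have w0: "0 \<le> ?w y" for y using C.sqrt_det_pos by (simp add: indicator_def less_imp_le)
  have p: "?p \<in> borel_measurable borel"
    by (intro borel_measurable_continuous_on_if dom continuous_param c continuous_on_const)
  have u': "(\<lambda>x. indicator (cdom c) x * u x) \<in> borel_measurable borel"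
    using borel_measurable_continuous_on_indicator[OF dom(1) u] by simp
  have eq: "density vol (indicator (cdom c)) = distr ?N borel ?p"
  proof (rule measure_eqI)
    fix S assume "S \<in> sets (density vol (indicator (cdom c)))"
    then have S: "S \<in> sets borel" "S \<in> sets vol" by (auto simp: sets_vol)
    have "emeasure (density vol (indicator (cdom c))) S = (\<integral>\<^sup>+x. indicator (cdom c) x * indicator S x \<partial>vol)"
      using dom S by (intro emeasure_density) (auto simp: sets_vol intro!: borel_measurable_indicator)
    also have "\<dots> = (\<integral>\<^sup>+x. indicator (cdom c \<inter> S) x \<partial>vol)"
      by (intro nn_integral_cong) (simp add: indicator_inter_arith)
    also have "\<dots> = emeasure vol (cdom c \<inter> S)"
      using dom S by (subst nn_integral_indicator) (auto simp: sets_vol)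
    also have "\<dots> = (\<integral>\<^sup>+y. ennreal (volume_density (g c) y) * indicator (coord c ` (cdom c \<inter> S)) y \<partial>lborel)"
      using dom S by (intro emeasure_vol c) auto
    also have "\<dots> = (\<integral>\<^sup>+y. ennreal (?w y) * indicator (?p -` S \<inter> UNIV) y \<partial>lborel)"
      by (intro nn_integral_cong) (auto simp: indicator_def coord_image[OF c] param_in[OF c])
    also have "\<dots> = emeasure ?N (?p -` S \<inter> UNIV)"
      using w measurable_sets[OF p S(1)] by (subst emeasure_density) auto
    also have "\<dots> = emeasure (distr ?N borel ?p) S"
      using S p by (subst emeasure_distr) auto
    finally show "emeasure (density vol (indicator (cdom c))) S = emeasure (distr ?N borel ?p) S" .
  qed (simp add: sets_vol)
  have "(LINT x:cdom c|vol. u x) = (LINT x|vol. indicator (cdom c) x *\<^sub>R (indicator (cdom c) x * u x))"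
    unfolding set_lebesgue_integral_def by (intro Bochner_Integration.integral_cong) (auto simp: indicator_def)
  also have "\<dots> = (LINT x|density vol (\<lambda>x. ennreal (indicator (cdom c) x)). indicator (cdom c) x * u x)"
    using dom u' by (subst integral_density) (auto simp: sets_vol cong: measurable_cong_sets[OF sets_vol refl])
  also have "\<dots> = (LINT x|distr ?N borel ?p. indicator (cdom c) x * u x)"
    unfolding eq[symmetric] by (simp add: ennreal_indicator)
  also have "\<dots> = (LINT y|?N. indicator (cdom c) (?p y) * u (?p y))"
    using p u' by (subst integral_distr) auto
  also have "\<dots> = (LINT y|lborel. ?w y *\<^sub>R (indicator (cdom c) (?p y) * u (?p y)))"
    using measurable_compose[OF p u'] w w0 by (subst integral_density) auto
  also have "\<dots> = (LINT y:cimg c|lborel. volume_density (g c) y * u (param c y))"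
    unfolding set_lebesgue_integral_def
    by (intro Bochner_Integration.integral_cong) (auto simp: indicator_def param_in[OF c])
  finally show ?thesis .
qed

lemma green_in_chart:
  assumes c: "c \<in> At" and f: "smooth_fun At f" and h: "Ck_on 1 (cimg c) (h \<circ> param c)"
    and K: "compact K" "K \<subseteq> cdom c" "\<And>x. x \<in> cdom c - K \<Longrightarrow> h x = 0"
  shows "(LINT x:cdom c|vol. h x * lap c f x + gprod c h f x) = 0"
proof -
  interpret C: coordinate_metric "cimg c" "g c" by (rule coordinate_metric_chart[OF c])
  have fc: "smooth_on (cimg c) (f \<circ> param c)" using f c by (auto simp: smooth_fun_def)
  have hc: "continuous_on (cdom c) h"
  proof (rule continuous_on_eq)
    show "continuous_on (cdom c) (\<lambda>x. (h \<circ> param c) (coord c x))"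
      using coord_in[OF c] by (intro continuous_on_compose2[OF Ck_on_imp_continuous_on[OF h] continuous_coord[OF c]]) auto
  qed (simp add: param_coord c)
  have "(LINT x:cdom c|vol. h x * lap c f x + gprod c h f x) =
    (LINT y:cimg c|lborel. volume_density (g c) y *
        (h (param c y) * lap c f (param c y) + gprod c h f (param c y)))"
    using fc h
    by (intro chart_integral c continuous_intros hc continuous_on_lap f continuous_on_gprod)
       (auto simp: smooth_on_def)
  also have "\<dots> = (LINT y:cimg c|lborel. volume_density (g c) y *
        ((h \<circ> param c) y * laplacian_coord (g c) (f \<circ> param c) y + gradient_product (g c) (h \<circ> param c) (f \<circ> param c) y))"
    using C.open_U by (intro set_lebesgue_integral_cong) (auto simp: lap_def gprod_def coord_param c)
  also have "\<dots> = 0"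
  proof (rule C.green_chart[OF fc h])
    show "compact (coord c ` K)"
      using K by (intro compact_continuous_image continuous_on_subset[OF continuous_coord[OF c]]) auto
    show "coord c ` K \<subseteq> cimg c" using K(2) coord_in[OF c] by auto
    show "(h \<circ> param c) y = 0" if "y \<in> cimg c - coord c ` K" for y
      using that K param_in[OF c] coord_param[OF c] by (auto intro!: K(3) simp: image_iff) 
  qed
  finally show ?thesis .
qed

end

text \<open>The outer square makes the truncated quadratic C^1 across the sphere of radius
  \<open>r\<close>, which is the regularity demanded of test functions in Green's identity.\<close>

definition radial_bump :: "'a::euclidean_space \<Rightarrow> real \<Rightarrow> 'a \<Rightarrow> real" where
  "radial_bump y\<^sub>0 r y = (max 0 (r\<^sup>2 - (y - y\<^sub>0) \<bullet> (y - y\<^sub>0)))\<^sup>2"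

lemma max_0_power2_has_derivative:
  "((\<lambda>s::real. (max 0 s)\<^sup>2) has_real_derivative 2 * max 0 s) (at s)"
proof -
  consider "s > 0" | "s < 0" | "s = 0" by linarith
  then show ?thesis
  proof cases
    case 1
    have "((\<lambda>s. s\<^sup>2) has_real_derivative 2 * max 0 s) (at s)"
      using 1 by (auto intro!: derivative_eq_intros)
    then show ?thesis
      by (rule has_field_derivative_transform_within_open[where S = "{0<..}"]) (use 1 in auto)
  next
    case 2
    have "((\<lambda>s. 0) has_real_derivative 2 * max 0 s) (at s)"
      using 2 by (auto intro!: derivative_eq_intros)
    then show ?thesis
      by (rule has_field_derivative_transform_within_open[where S = "{..<0}"]) (use 2 in auto)
  next
    case 3
    have "((\<lambda>h. (max 0 h)\<^sup>2 / h) \<longlongrightarrow> 0) (at (0::real))"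
    proof (rule Lim_null_comparison)
      show "\<forall>\<^sub>F h in at 0. norm ((max 0 h)\<^sup>2 / h) \<le> \<bar>h\<bar>"
        by (intro always_eventually) (auto simp: max_def power2_eq_square)
      show "((\<lambda>h. \<bar>h\<bar>) \<longlongrightarrow> 0) (at (0::real))" by (auto intro!: tendsto_eq_intros)
    qed
    then show ?thesis by (simp add: has_field_derivative_iff 3)
  qed
qed

lemma Ck_on_radial_bump: 
  assumes "open S" shows "Ck_on 1 S (radial_bump y\<^sub>0 r)"
  unfolding One_nat_def
proof (rule Ck_on_SucI[OF assms])
  fix y
  let ?s = "\<lambda>y. r\<^sup>2 - (y - y\<^sub>0) \<bullet> (y - y\<^sub>0)"
  have "(?s has_derivative (\<lambda>v. - 2 * ((y - y\<^sub>0) \<bullet> v))) (at y)"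
    by (auto intro!: derivative_eq_intros simp: inner_commute)
  from has_derivative_compose[OF this max_0_power2_has_derivative[unfolded has_field_derivative_def]]
  show "(radial_bump y\<^sub>0 r has_derivative (\<lambda>v. 2 * max 0 (?s y) * (- 2 * ((y - y\<^sub>0) \<bullet> v)))) (at y)"
    unfolding radial_bump_def[abs_def] .
qed (auto intro!: continuous_intros)

lemma radial_bump_nonneg: "0 \<le> radial_bump y\<^sub>0 r y"
  by (simp add: radial_bump_def)

lemma radial_bump_pos: "y \<in> ball y\<^sub>0 r \<Longrightarrow> 0 < radial_bump y\<^sub>0 r y"
proof -
  assume "y \<in> ball y\<^sub>0 r"
  then have "norm (y - y\<^sub>0) < r" by (simp add: dist_norm norm_minus_commute)
  then have "(norm (y - y\<^sub>0))\<^sup>2 < r\<^sup>2" by (intro power_strict_mono) auto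
  then show ?thesis by (simp add: radial_bump_def power2_norm_eq_inner)
qed

lemma radial_bump_eq_0: "0 < r \<Longrightarrow> y \<notin> cball y\<^sub>0 r \<Longrightarrow> radial_bump y\<^sub>0 r y = 0"
proof -
  assume "0 < r" "y \<notin> cball y\<^sub>0 r"
  then have "r < norm (y - y\<^sub>0)" by (simp add: dist_norm norm_minus_commute)
  then have "r\<^sup>2 < (norm (y - y\<^sub>0))\<^sup>2" using \<open>0 < r\<close> by (intro power_strict_mono) auto
  then show ?thesis by (simp add: radial_bump_def power2_norm_eq_inner)
qed

section \<open>Bumps on the manifold, finite covers, finiteness of the volume and
  integrability\<close>

context closed_riemannian_manifold
begin

definition bump :: "('m, 'n) chart \<Rightarrow> real^'n \<Rightarrow> real \<Rightarrow> 'm \<Rightarrow> real" where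
  "bump c y\<^sub>0 r x = (if x \<in> cdom c then radial_bump y\<^sub>0 r (coord c x) else 0)"

lemma bump_nonneg: "0 \<le> bump c y\<^sub>0 r x"
  by (simp add: bump_def radial_bump_nonneg)

lemma bump_pos:
  "c \<in> At \<Longrightarrow> cball y\<^sub>0 r \<subseteq> cimg c \<Longrightarrow> x \<in> param c ` ball y\<^sub>0 r \<Longrightarrow> 0 < bump c y\<^sub>0 r x"
  using radial_bump_pos ball_subset_cball[of y\<^sub>0 r] by (auto simp: bump_def coord_param param_in subset_iff)

lemma bump_eq_0:
  assumes "c \<in> At" "0 < r" "x \<notin> param c ` cball y\<^sub>0 r"
  shows "bump c y\<^sub>0 r x = 0"
proof (cases "x \<in> cdom c")
  case True
  then have "coord c x \<notin> cball y\<^sub>0 r"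
    using assms(3) param_coord[OF assms(1) True] by (metis imageI)
  then show ?thesis using radial_bump_eq_0[OF assms(2), of "coord c x" y\<^sub>0] by (simp add: bump_def)
qed (simp add: bump_def)

text \<open>In another chart \<open>d\<close> the bump is a radial bump composed with the transition
  map near points of \<open>cdom c\<close>. Near all other points it vanishes, since the compact set
  carrying it lies in \<open>cdom c\<close> and is closed by the Hausdorff property.\<close>

lemma C1_fun_bump:
  assumes c: "c \<in> At" and r: "0 < r" "cball y\<^sub>0 r \<subseteq> cimg c"
  shows "C1_fun (bump c y\<^sub>0 r)"
  unfolding C1_fun_def
proof (intro ballI Ck_on_local)
  fix d y assume d: "d \<in> At" and y: "y \<in> cimg d"
  let ?K = "param c ` cball y\<^sub>0 r"
  show "\<exists>U. open U \<and> y \<in> U \<and> Ck_on 1 U (bump c y\<^sub>0 r \<circ> param d)"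
  proof (cases "param d y \<in> cdom c")
    case True
    let ?U = "coord d ` (cdom d \<inter> cdom c)"
    have U: "open ?U" by (rule transition_smooth(2)[OF d c])
    have "y \<in> ?U" using True y coord_param[OF d y] param_in[OF d y] by (metis IntI imageI)
    moreover have "Ck_on 1 ?U (bump c y\<^sub>0 r \<circ> param d)"
    proof (rule Ck_on_cong[OF U])
      show "Ck_on 1 ?U (\<lambda>z. radial_bump y\<^sub>0 r (transition d c z))"
        using transition_smooth(1)[OF d c] unfolding smooth_on_def
        by (intro Ck_on_compose[OF U _ Ck_on_radial_bump[OF open_UNIV]]) auto
    qed (auto simp: bump_def transition_def param_coord d)
    ultimately show ?thesis using U by blast
  next
    case False
    let ?U = "{z \<in> cimg d. param d z \<in> - ?K}"
    have K: "closed ?K" "?K \<subseteq> cdom c"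
      using compact_param_image[OF c compact_cball r(2)] compact_imp_closed r param_in[OF c] by auto
    have U: "open ?U" by (rule open_param_vimage[OF d open_Compl[OF K(1)]])
    have "y \<in> ?U" using y False K by auto
    moreover have "Ck_on 1 ?U (bump c y\<^sub>0 r \<circ> param d)"
      by (rule Ck_on_cong[OF U _ Ck_on_const[OF U, of _ 0]]) (simp add: bump_eq_0[OF c r(1)])
    ultimately show ?thesis using U by blast
  qed
qed

text \<open>The open balls do the covering, while the closed balls stay inside the chart image: they
  give the bumps compact support in one chart and bound the volume density.\<close>

lemma finite_ball_cover:
  obtains I where "finite I" 
    "\<And>c y\<^sub>0 r. (c, y\<^sub>0, r) \<in> I \<Longrightarrow> c \<in> At \<and> 0 < r \<and> cball y\<^sub>0 r \<subseteq> cimg c"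
    "UNIV = (\<Union>(c, y\<^sub>0, r)\<in>I. param c ` ball y\<^sub>0 r)"
proof -
  let ?A = "{(c, y\<^sub>0, r). c \<in> At \<and> 0 < r \<and> cball y\<^sub>0 r \<subseteq> cimg c}"
  let ?B = "\<lambda>(c, y\<^sub>0, r). param c ` ball y\<^sub>0 r"
  have op: "open (?B i)" if "i \<in> ?A" for i
    using that ball_subset_cball by (auto intro!: open_param_image)
  have cov: "x \<in> (\<Union>i\<in>?A. ?B i)" for x
  proof -
    let ?c = "chart_at At x"
    note c = chart_at_in[of x]
    obtain r where "0 < r" "cball (coord ?c x) r \<subseteq> cimg ?c"
      using open_cimg[OF c(1)] coord_in[OF c] by (meson open_contains_cball)
    moreover have "x \<in> param ?c ` ball (coord ?c x) r"
      using \<open>0 < r\<close> param_coord[OF c] by (intro image_eqI[of _ _ "coord ?c x"]) auto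
    ultimately show ?thesis using c(1) by (intro UN_I[of "(?c, coord ?c x, r)"]) auto
  qed
  obtain I where "I \<subseteq> ?A" "finite I" "UNIV \<subseteq> (\<Union>i\<in>I. ?B i)"
    by (rule compactE_image[OF compact_M, of ?A ?B]) (use op cov in \<open>simp_all add: subsetI\<close>)
  then show ?thesis by (intro that[of I]) auto
qed

text \<open>The density may be unbounded on a chart image, but it is bounded on each of the finitely
  many closed balls.\<close>

lemma emeasure_vol_finite: "emeasure vol UNIV < \<infinity>"
proof -
  obtain I where I: "finite I" "\<And>c y\<^sub>0 r. (c, y\<^sub>0, r) \<in> I \<Longrightarrow> c \<in> At \<and> 0 < r \<and> cball y\<^sub>0 r \<subseteq> cimg c"
    "UNIV = (\<Union>(c, y\<^sub>0, r)\<in>I. param c ` ball y\<^sub>0 r)"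
    by (rule finite_ball_cover) blast
  have B: "(case i of (c, y\<^sub>0, r) \<Rightarrow> param c ` ball y\<^sub>0 r) \<in> sets vol \<and>
      emeasure vol (case i of (c, y\<^sub>0, r) \<Rightarrow> param c ` ball y\<^sub>0 r) < \<infinity>" if "i \<in> I" for i
  proof -
    obtain c y\<^sub>0 r where i: "i = (c, y\<^sub>0, r)" using prod_cases3 by blast
    have c: "c \<in> At" "cball y\<^sub>0 r \<subseteq> cimg c" using I(2) that i by auto
    have b: "ball y\<^sub>0 r \<subseteq> cimg c" using c(2) ball_subset_cball by blast
    have meas: "param c ` ball y\<^sub>0 r \<in> sets borel"
      using open_param_image[OF c(1) open_ball b] by simp
    have im: "coord c ` param c ` ball y\<^sub>0 r = ball y\<^sub>0 r"
      using b coord_param[OF c(1)] by (force simp: image_image image_iff)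
    have "compact (volume_density (g c) ` cball y\<^sub>0 r)"
      by (intro compact_continuous_image continuous_on_subset[OF continuous_on_volume_density[OF c(1)] c(2)]) simp
    then obtain M where M: "\<And>y. y \<in> cball y\<^sub>0 r \<Longrightarrow> volume_density (g c) y \<le> M"
      using compact_imp_bounded[THEN bounded_real[THEN iffD1]] by (meson abs_le_D1 imageI)
    have "emeasure vol (param c ` ball y\<^sub>0 r) = (\<integral>\<^sup>+y. ennreal (volume_density (g c) y) * indicator (ball y\<^sub>0 r) y \<partial>lborel)"
      using emeasure_vol[OF c(1) meas] im b param_in[OF c(1)] by auto
    also have "\<dots> \<le> (\<integral>\<^sup>+y. ennreal M * indicator (ball y\<^sub>0 r) y \<partial>lborel)"
      using M ball_subset_cball[of y\<^sub>0 r]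
      by (intro nn_integral_mono) (auto simp: indicator_def intro!: ennreal_leI)
    also have "\<dots> = ennreal M * emeasure lborel (ball y\<^sub>0 r)"
      by (simp add: nn_integral_cmult_indicator)
    also have "\<dots> < \<infinity>"
      using emeasure_bounded_finite[OF bounded_ball[of y\<^sub>0 r]] by (simp add: ennreal_mult_less_top)
    finally show ?thesis using meas by (simp add: i sets_vol)
  qed
  have "emeasure vol (\<Union>i\<in>I. case i of (c, y\<^sub>0, r) \<Rightarrow> param c ` ball y\<^sub>0 r)
     \<le> (\<Sum>i\<in>I. emeasure vol (case i of (c, y\<^sub>0, r) \<Rightarrow> param c ` ball y\<^sub>0 r))"
    using B by (intro emeasure_subadditive_finite I(1)) auto
  also have "\<dots> < \<infinity>" using B I(1) by simp
  finally show ?thesis using I(3) by simp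
qed

lemma finite_measure_vol: "finite_measure vol"
  using emeasure_vol_finite by (intro finite_measureI) auto

lemma integrable_vol_compact:
  fixes u :: "'m \<Rightarrow> real"
  assumes "compact K" "continuous_on K u"
  shows "integrable vol (\<lambda>x. indicator K x * u x)"
proof -
  have "compact (u ` K)" using assms compact_continuous_image by blast
  then obtain M where M: "\<And>x. x \<in> K \<Longrightarrow> \<bar>u x\<bar> \<le> M"
    using compact_imp_bounded[THEN bounded_real[THEN iffD1]] by (meson imageI)
  have "(\<lambda>x. indicator K x * u x) \<in> borel_measurable vol"
    using borel_measurable_continuous_on_indicator[OF borel_compact[OF assms(1)] assms(2)]
    by (simp cong: measurable_cong_sets[OF sets_vol refl])
  moreover have "AE x in vol. norm (indicator K x * u x) \<le> \<bar>M\<bar>"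
    using M by (intro AE_I2) (fastforce simp: indicator_def)
  ultimately show ?thesis
    by (intro finite_measure.integrable_const_bound[OF finite_measure_vol])
qed

lemma integrable_vol: "continuous_on UNIV u \<Longrightarrow> integrable vol (u :: 'm \<Rightarrow> real)"
  using integrable_vol_compact[OF compact_M, of u] by simp

text \<open>Testing against bump functions, Green's identity determines the Laplacian, and its other term
  does not depend on the chart.\<close>

lemma lap_le:
  assumes cd: "c \<in> At" "d \<in> At" "x\<^sub>0 \<in> cdom c" "x\<^sub>0 \<in> cdom d" and f: "smooth_fun At f"
  shows "lap c f x\<^sub>0 \<le> lap d f x\<^sub>0"
proof (rule ccontr)
  assume gt: "\<not> lap c f x\<^sub>0 \<le> lap d f x\<^sub>0"
  \<comment> \<open>Under the negated claim this open set contains \<open>x\<^sub>0\<close>; a bump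
    supported inside it can only see a positive gap between the two Laplacians.\<close>
  define V where "V = {x \<in> cdom c \<inter> cdom d. lap d f x < lap c f x}"
  let ?X = "cdom c \<inter> cdom d"
  have contl: "continuous_on ?X (lap c f)" "continuous_on ?X (lap d f)"
    using continuous_on_subset[OF continuous_on_lap[OF cd(1) f]]
      continuous_on_subset[OF continuous_on_lap[OF cd(2) f]] by auto
  have "open V"
  proof -
    have "open (?X \<inter> (\<lambda>x. lap c f x - lap d f x) -` {0<..})"
      by (intro continuous_open_preimage continuous_on_diff contl open_Int open_cdom cd open_greaterThan)
    moreover have "V = ?X \<inter> (\<lambda>x. lap c f x - lap d f x) -` {0<..}" by (auto simp: V_def)
    ultimately show ?thesis by simp
  qed
  moreover have "x\<^sub>0 \<in> V" using gt cd by (simp add: V_def)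
  moreover have "V \<subseteq> cdom c" by (auto simp: V_def)
  ultimately have "open (coord c ` V)" "coord c x\<^sub>0 \<in> coord c ` V"
    using open_coord_image[OF cd(1)] by auto
  then obtain r where r: "0 < r" "cball (coord c x\<^sub>0) r \<subseteq> coord c ` V"
    using open_contains_cball by blast
  define b where "b = bump c (coord c x\<^sub>0) r"
  define K where "K = param c ` cball (coord c x\<^sub>0) r"
  have rc: "cball (coord c x\<^sub>0) r \<subseteq> cimg c"
    using r(2) coord_in[OF cd(1)] \<open>V \<subseteq> cdom c\<close> by auto
  have KV: "K \<subseteq> V" using r(2) coord_image[OF cd(1) \<open>V \<subseteq> cdom c\<close>] by (auto simp: K_def)
  have K: "compact K" "K \<subseteq> cdom c" "K \<subseteq> cdom d"
    using compact_param_image[OF cd(1) compact_cball rc] KV by (auto simp: K_def V_def)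
  have bC: "C1_fun b" unfolding b_def by (rule C1_fun_bump[OF cd(1) r(1) rc])
  have b0: "x \<notin> K \<Longrightarrow> b x = 0" for x using bump_eq_0[OF cd(1) r(1)] by (simp add: b_def K_def)
  have g0: "gprod e b f x = 0" if "e \<in> At" "x \<in> cdom e" "x \<notin> K" for e x
    by (rule gprod_eq_0[of e "- K"]) (use that b0 compact_imp_closed[OF K(1)] in auto)
  have fC: "C1_fun f" by (rule smooth_imp_C1_fun[OF f])
  \<comment> \<open>Cutting off to \<open>K\<close>, where both charts are defined, makes the
    identities of the two charts comparable; off \<open>K\<close> the bump and its gradient term
    vanish anyway.\<close>
  have green: "(LINT x|vol. indicator K x * (b x * lap e f x + gprod e b f x)) = 0"
    and int: "integrable vol (\<lambda>x. indicator K x * (b x * lap e f x + gprod e b f x))"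
    if e: "e \<in> At" "K \<subseteq> cdom e" for e
  proof -
    have "(LINT x:cdom e|vol. b x * lap e f x + gprod e b f x) = 0"
      using bC e b0 by (intro green_in_chart[OF e(1) f _ K(1)]) (auto simp: C1_fun_def)
    moreover have "indicator (cdom e) x *\<^sub>R (b x * lap e f x + gprod e b f x)
        = indicator K x * (b x * lap e f x + gprod e b f x)" for x
      using e b0[of x] g0[OF e(1), of x] by (auto simp: indicator_def)
    ultimately show "(LINT x|vol. indicator K x * (b x * lap e f x + gprod e b f x)) = 0"
      by (simp only: set_lebesgue_integral_def)
    have "continuous_on (cdom e) (gprod e b f)"
      using bC fC e by (intro continuous_on_gprod) (auto simp: C1_fun_def simp del: Ck_on.simps One_nat_def)
    then show "integrable vol (\<lambda>x. indicator K x * (b x * lap e f x + gprod e b f x))"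
      using e by (intro integrable_vol_compact K(1) continuous_intros continuous_on_subset[OF C1_fun_continuous[OF bC]]
          continuous_on_subset[OF continuous_on_lap[OF e(1) f]]) (auto intro: continuous_on_subset)
  qed
  \<comment> \<open>Subtracting the two identities cancels the gradient terms by
    \<open>gprod_chart\<close>; what is left is nonnegative with integral zero.\<close>
  let ?F = "\<lambda>x. indicator K x * (b x * (lap c f x - lap d f x))"
  have eq: "?F x = indicator K x * (b x * lap c f x + gprod c b f x)
      - indicator K x * (b x * lap d f x + gprod d b f x)" for x
  proof (cases "x \<in> K")
    case True
    have "gprod c b f x = gprod d b f x"
      by (intro gprod_chart cd C1_fun_differentiable[OF bC cd(2)] C1_fun_differentiable[OF fC cd(2)]
          coord_in[OF cd(2)] subsetD[OF K(2) True] subsetD[OF K(3) True])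
    then show ?thesis by (simp add: algebra_simps)
  qed simp
  have "(LINT x|vol. ?F x) = 0" "integrable vol ?F"
    unfolding eq using green[OF cd(1) K(2)] green[OF cd(2) K(3)] int[OF cd(1) K(2)] int[OF cd(2) K(3)] by simp_all
  moreover have F0: "0 \<le> ?F x" for x
    using KV bump_nonneg[of c "coord c x\<^sub>0" r x] by (auto simp: b_def indicator_def V_def intro!: mult_nonneg_nonneg)
  ultimately have AE: "AE x in vol. ?F x = 0"
    using integral_nonneg_eq_0_iff_AE by blast
  let ?B = "param c ` ball (coord c x\<^sub>0) r"
  have bc: "ball (coord c x\<^sub>0) r \<subseteq> cimg c" using rc ball_subset_cball by blast
  have BK: "?B \<subseteq> K" using ball_subset_cball by (auto simp: K_def)
  have meas: "?B \<in> sets borel" using open_param_image[OF cd(1) open_ball bc] by simp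
  have "?F x \<noteq> 0" if "x \<in> ?B" for x
  proof -
    have "x \<in> K" using that BK by blast
    then have "lap d f x < lap c f x" using KV by (auto simp: V_def)
    then show ?thesis using bump_pos[OF cd(1) rc that] \<open>x \<in> K\<close> by (simp add: b_def)
  qed
  \<comment> \<open>The image of the open ball is thus a null set for the volume. Its density in the
    chart is positive, so the Euclidean ball itself would have Lebesgue measure zero.\<close>
  then have "AE x in vol. x \<notin> ?B" using AE by (auto elim: eventually_mono)
  then have "emeasure vol ?B = 0"
    using meas by (subst AE_iff_measurable[symmetric, where P = "\<lambda>x. x \<notin> ?B"]) (auto simp: sets_vol)
  moreover have "coord c ` ?B = ball (coord c x\<^sub>0) r"
    using bc coord_param[OF cd(1)] by (force simp: image_image image_iff)
  ultimately have "(\<integral>\<^sup>+y. ennreal (volume_density (g c) y) * indicator (ball (coord c x\<^sub>0) r) y \<partial>lborel) = 0"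
    using emeasure_vol[OF cd(1) meas] BK K(2) by auto
  then have "AE y in lborel. ennreal (volume_density (g c) y) * indicator (ball (coord c x\<^sub>0) r) y = 0"
  proof (subst (asm) nn_integral_0_iff_AE)
    have "(\<lambda>y. indicator (ball (coord c x\<^sub>0) r) y *\<^sub>R volume_density (g c) y) \<in> borel_measurable borel"
      by (intro borel_measurable_continuous_on_indicator continuous_on_subset[OF continuous_on_volume_density[OF cd(1)] bc]) simp
    then have "(\<lambda>y. ennreal (indicator (ball (coord c x\<^sub>0) r) y *\<^sub>R volume_density (g c) y)) \<in> borel_measurable lborel"
      by simp
    also have "(\<lambda>y. ennreal (indicator (ball (coord c x\<^sub>0) r) y *\<^sub>R volume_density (g c) y))
        = (\<lambda>y. ennreal (volume_density (g c) y) * indicator (ball (coord c x\<^sub>0) r) y)"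
      by (auto simp: indicator_def fun_eq_iff)
    finally show "(\<lambda>y. ennreal (volume_density (g c) y) * indicator (ball (coord c x\<^sub>0) r) y) \<in> borel_measurable lborel" .
  qed
  then have "AE y in lborel. y \<notin> ball (coord c x\<^sub>0) r"
    using coordinate_metric.sqrt_det_pos[OF coordinate_metric_chart[OF cd(1)]] bc
    by (auto elim!: eventually_mono simp: indicator_def ennreal_eq_0_iff split: if_splits) (meson mem_ball not_le subsetD)
  then have "emeasure lborel (ball (coord c x\<^sub>0) r) = 0"
    by (subst AE_iff_measurable[symmetric, where P = "\<lambda>y. y \<notin> ball (coord c x\<^sub>0) r"]) auto
  moreover have "0 < unit_ball_vol (real CARD('n)) * r ^ CARD('n)"
    using r(1) by (intro mult_pos_pos unit_ball_vol_pos) auto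
  ultimately show False using r(1) by (simp add: emeasure_ball ennreal_eq_0_iff)
qed

section \<open>The global Laplacian and gradient product, and Green's identity\<close>

lemma laplacian_eq_lap:
  assumes "c \<in> At" "x \<in> cdom c" "smooth_fun At f"
  shows "laplacian At g f x = lap c f x"
proof -
  have "laplacian At g f x = lap (chart_at At x) f x" by (simp add: laplacian_def lap_def Let_def)
  then show ?thesis
    using lap_le[OF assms(1) chart_at_in(1) assms(2) chart_at_in(2) assms(3)]
     lap_le[OF chart_at_in(1) assms(1) chart_at_in(2) assms(2) assms(3)] by simp
qed

definition grad_pair :: "('m \<Rightarrow> real) \<Rightarrow> ('m \<Rightarrow> real) \<Rightarrow> 'm \<Rightarrow> real" where
  "grad_pair h f x = gprod (chart_at At x) h f x"

lemma grad_pair_eq_gprod: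
  assumes "c \<in> At" "x \<in> cdom c" "C1_fun h" "C1_fun f"
  shows "grad_pair h f x = gprod c h f x"
  unfolding grad_pair_def
  by (rule gprod_chart) (use assms chart_at_in C1_fun_differentiable coord_in in auto)

lemma continuous_grad_pair:
  assumes "C1_fun h" "C1_fun f"
  shows "continuous_on UNIV (grad_pair h f)"
proof (rule continuous_at_imp_continuous_on, rule ballI)
  fix x
  note c = chart_at_in[of x]
  have "continuous_on (cdom (chart_at At x)) (gprod (chart_at At x) h f)"
    using assms c by (intro continuous_on_gprod) (auto simp: C1_fun_def simp del: Ck_on.simps One_nat_def)
  then have "continuous_on (cdom (chart_at At x)) (grad_pair h f)"
    by (rule continuous_on_eq) (simp add: grad_pair_eq_gprod[OF c(1) _ assms])
  then show "isCont (grad_pair h f) x"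
    using c open_cdom continuous_on_eq_continuous_at by blast
qed

lemma continuous_laplacian:
  assumes "smooth_fun At f"
  shows "continuous_on UNIV (laplacian At g f)"
proof (rule continuous_at_imp_continuous_on, rule ballI)
  fix x
  note c = chart_at_in[of x]
  have "continuous_on (cdom (chart_at At x)) (laplacian At g f)"
    by (rule continuous_on_eq[OF continuous_on_lap[OF c(1) assms]]) (simp add: laplacian_eq_lap[OF c(1) _ assms])
  then show "isCont (laplacian At g f) x"
    using c open_cdom continuous_on_eq_continuous_at by blast
qed

text \<open>The bumps of a finite cover, divided by their sum, split \<open>h\<close> into pieces
  with compact support in one chart each. The sum is positive everywhere because the open balls
  cover the manifold.\<close>

lemma green:
  assumes h: "C1_fun h" and f: "smooth_fun At f"
  shows "(LINT x|vol. h x * laplacian At g f x) = - (LINT x|vol. grad_pair h f x)"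
proof -
  have fC: "C1_fun f" by (rule smooth_imp_C1_fun[OF f])
  obtain I where I: "finite I" "\<And>c y\<^sub>0 r. (c, y\<^sub>0, r) \<in> I \<Longrightarrow> c \<in> At \<and> 0 < r \<and> cball y\<^sub>0 r \<subseteq> cimg c"
    "UNIV = (\<Union>(c, y\<^sub>0, r)\<in>I. param c ` ball y\<^sub>0 r)"
    by (rule finite_ball_cover) blast
  define b where "b = (\<lambda>i. case i of (c, y\<^sub>0, r) \<Rightarrow> bump c y\<^sub>0 r)"
  define s where "s x = (\<Sum>i\<in>I. b i x)" for x
  have bC: "C1_fun (b i)" if "i \<in> I" for i
    using that I(2) C1_fun_bump by (cases i) (auto simp: b_def)
  have b_nonneg: "0 \<le> b i x" for i x
    using bump_nonneg by (cases i) (auto simp: b_def)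
  have s: "s x \<noteq> 0" for x
  proof -
    have "x \<in> (\<Union>(c, y\<^sub>0, r)\<in>I. param c ` ball y\<^sub>0 r)" using I(3) by (metis UNIV_I)
    then obtain j where j: "j \<in> I" "x \<in> (case j of (c, y\<^sub>0, r) \<Rightarrow> param c ` ball y\<^sub>0 r)" by (rule UN_E)
    obtain c y\<^sub>0 r where "j = (c, y\<^sub>0, r)" using prod_cases3 by blast
    with j have i: "(c, y\<^sub>0, r) \<in> I" "x \<in> param c ` ball y\<^sub>0 r" by auto
    then have "0 < b (c, y\<^sub>0, r) x" using I(2) bump_pos by (simp add: b_def)
    then have "0 < s x" unfolding s_def using i I(1) b_nonneg by (intro sum_pos2) auto
    then show ?thesis by simp
  qed
  define h' where "h' i x = b i x * (h x * inverse (s x))" for i x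
  have hC: "C1_fun (h' i)" if "i \<in> I" for i
    unfolding h'_def s_def
    by (intro C1_fun_mult bC that h C1_fun_inverse C1_fun_sum) (use s s_def in auto)
  have sum_h': "(\<Sum>i\<in>I. h' i x) = h x" for x
    using s[of x] by (simp add: h'_def sum_distrib_right[symmetric] s_def[symmetric])
  have cont: "continuous_on UNIV (\<lambda>x. h' i x * laplacian At g f x + grad_pair (h' i) f x)" if "i \<in> I" for i
    by (intro continuous_intros C1_fun_continuous hC that continuous_laplacian f continuous_grad_pair fC)
  have zero: "(LINT x|vol. h' i x * laplacian At g f x + grad_pair (h' i) f x) = 0" if i: "i \<in> I" for i
  proof -
    obtain c y\<^sub>0 r where ic: "i = (c, y\<^sub>0, r)" using prod_cases3 by blast
    have c: "c \<in> At" "0 < r" "cball y\<^sub>0 r \<subseteq> cimg c" using I(2) i ic by auto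
    let ?K = "param c ` cball y\<^sub>0 r"
    have K: "compact ?K" "?K \<subseteq> cdom c"
      using compact_param_image[OF c(1) compact_cball c(3)] c param_in[OF c(1)] by auto
    have h0: "x \<notin> ?K \<Longrightarrow> h' i x = 0" for x
      using bump_eq_0[OF c(1,2)] by (simp add: h'_def b_def ic)
    have g0: "grad_pair (h' i) f x = 0" if "x \<notin> ?K" for x unfolding grad_pair_def
      by (rule gprod_eq_0[of _ "- ?K"]) (use that h0 compact_imp_closed[OF K(1)] chart_at_in in auto)
    have "(LINT x:cdom c|vol. h' i x * lap c f x + gprod c (h' i) f x) = 0"
      using hC[OF i] c h0 by (intro green_in_chart[OF c(1) f _ K]) (auto simp: C1_fun_def)
    \<comment> \<open>Inside \<open>cdom c\<close> this is chart independence; outside, both sides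
      are zero because the piece is supported in \<open>?K\<close>. The chart integral is therefore
      a global one.\<close>
    moreover have "indicator (cdom c) x *\<^sub>R (h' i x * lap c f x + gprod c (h' i) f x)
        = h' i x * laplacian At g f x + grad_pair (h' i) f x" for x
    proof (cases "x \<in> cdom c")
      case True
      then show ?thesis
        by (simp add: laplacian_eq_lap[OF c(1) True f] grad_pair_eq_gprod[OF c(1) True hC[OF i] fC])
    next
      case False
      then have "x \<notin> ?K" using K(2) by blast
      then show ?thesis using False h0 g0 by simp
    qed
    ultimately show ?thesis by (simp add: set_lebesgue_integral_def)
  qed
  have pair_sum: "grad_pair h f x = (\<Sum>i\<in>I. grad_pair (h' i) f x)" for x
  proof -
    let ?c = "chart_at At x"
    note c = chart_at_in[of x]
    have "h \<circ> param ?c = (\<lambda>z. \<Sum>i\<in>I. (h' i \<circ> param ?c) z)" using sum_h' by (simp add: fun_eq_iff)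
    then have "partial j (h \<circ> param ?c) (coord ?c x) = (\<Sum>i\<in>I. partial j (h' i \<circ> param ?c) (coord ?c x))" for j
      using C1_fun_differentiable[OF hC c(1)] coord_in[OF c] by (simp only: partial_sum)
    then have "grad_pair h f x = (\<Sum>k\<in>UNIV. \<Sum>j\<in>UNIV. \<Sum>i\<in>I. matrix_inv (g ?c (coord ?c x)) $ k $ j *
        partial k (h' i \<circ> param ?c) (coord ?c x) * partial j (f \<circ> param ?c) (coord ?c x))"
      by (simp add: grad_pair_def gprod_def gradient_product_def sum_distrib_left sum_distrib_right)
    also have "\<dots> = (\<Sum>k\<in>UNIV. \<Sum>i\<in>I. \<Sum>j\<in>UNIV. matrix_inv (g ?c (coord ?c x)) $ k $ j *
        partial k (h' i \<circ> param ?c) (coord ?c x) * partial j (f \<circ> param ?c) (coord ?c x))"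
      by (intro sum.cong refl sum.swap)
    also have "\<dots> = (\<Sum>i\<in>I. grad_pair (h' i) f x)"
      unfolding grad_pair_def gprod_def gradient_product_def by (rule sum.swap)
    finally show ?thesis .
  qed
  have "(LINT x|vol. h x * laplacian At g f x + grad_pair h f x)
      = (LINT x|vol. (\<Sum>i\<in>I. h' i x * laplacian At g f x + grad_pair (h' i) f x))"
    unfolding pair_sum sum.distrib sum_distrib_right[symmetric] sum_h' ..
  also have "\<dots> = 0"
    using zero integrable_vol[OF cont] by (subst Bochner_Integration.integral_sum) auto
  finally show ?thesis
    using integrable_vol[OF continuous_on_mult[OF C1_fun_continuous[OF h] continuous_laplacian[OF f]]]
      integrable_vol[OF continuous_grad_pair[OF h fC]] by simp
qed

lemma grad_pair_commute: "grad_pair f h x = grad_pair h f x"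
proof -
  let ?c = "chart_at At x"
  note c = chart_at_in[of x]
  interpret C: coordinate_metric "cimg ?c" "g ?c" by (rule coordinate_metric_chart[OF c(1)])
  show ?thesis
    unfolding grad_pair_def gprod_def gradient_product_def
    by (subst sum.swap) (simp add: C.H_sym[OF coord_in[OF c]] mult_ac)
qed

lemma laplacian_self_adjoint:
  assumes "smooth_fun At f" "smooth_fun At h"
  shows "(LINT x|vol. h x * laplacian At g f x) = (LINT x|vol. f x * laplacian At g h x)"
  using green[OF smooth_imp_C1_fun[OF assms(1)] assms(2)] green[OF smooth_imp_C1_fun[OF assms(2)] assms(1)]
  by (simp add: grad_pair_commute[of f h])

text \<open>Lowering the index of the gradient with the Gram matrix undoes the inverse in
  \<open>gradient_coord\<close> and returns the differential.\<close>

lemma grad_norm_sq_eq: "grad_norm_sq At g f x = grad_pair f f x"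
proof -
  let ?c = "chart_at At x"
  note c = chart_at_in[of x]
  interpret C: coordinate_metric "cimg ?c" "g ?c" by (rule coordinate_metric_chart[OF c(1)])
  note inv = matrix_inv[OF C.invertible_G[OF coord_in[OF c]]]
  have "w \<bullet> (A *v w) = (\<chi> i. partial i (f \<circ> param ?c) (coord ?c x)) \<bullet> w"
    if "A = g ?c (coord ?c x)" "w = gradient_coord (g ?c) (f \<circ> param ?c) (coord ?c x)" for A w
    using that inv(1) by (simp add: gradient_coord_def matrix_vector_mul_assoc inner_commute)
  then show ?thesis
    by (simp add: grad_norm_sq_def Let_def grad_pair_def gprod_def gradient_product_eq_inner gradient_coord_def)
qed

lemma grad_norm_sq_nonneg: "0 \<le> grad_norm_sq At g f x"
proof -
  let ?c = "chart_at At x"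
  note c = chart_at_in[of x]
  interpret C: coordinate_metric "cimg ?c" "g ?c" by (rule coordinate_metric_chart[OF c(1)])
  show ?thesis
    using C.pos_G[OF coord_in[OF c]] unfolding grad_norm_sq_def Let_def pos_def_matrix_def
    by (metis inner_zero_left less_eq_real_def)
qed

end

section \<open>Waves and their energy\<close>

lemma partial_cong:
  assumes "open U" "y \<in> U" "\<And>z. z \<in> U \<Longrightarrow> f z = h z" "f differentiable at y"
  shows "partial i h y = partial i f y"
proof -
  have "(f has_derivative frechet_derivative f (at y)) (at y)"
    using assms(4) frechet_derivative_works by blast
  then have "(h has_derivative frechet_derivative f (at y)) (at y)"
    by (rule has_derivative_transform_within_open[OF _ assms(1,2)]) (rule assms(3))
  then have "partial i h y = frechet_derivative f (at y) (axis i 1)" by (rule partialI)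
  then show ?thesis by (simp add: partial_def[of i f])
qed

text \<open>Both functions have the same set of derivatives at each point, so the choice in
  \<open>frechet_derivative\<close> gives the same value, even where that set is empty.\<close>

lemma partial_diff_const: "partial i (\<lambda>z. f z - C) = partial i f"
proof -
  have "((\<lambda>z. f z - C) has_derivative D) F \<longleftrightarrow> (f has_derivative D) F" for D F
    using has_derivative_diff[of f D F "\<lambda>z. C" "\<lambda>z. 0"]
      has_derivative_add[of "\<lambda>z. f z - C" D F "\<lambda>z. C" "\<lambda>z. 0"] by auto
  then show ?thesis by (simp add: partial_def[abs_def] frechet_derivative_def)
qed

lemma laplacian_coord_cong:
  assumes U: "open U" "y \<in> U" and eq: "\<And>z. z \<in> U \<Longrightarrow> f z = h z" and f: "smooth_on U f"
  shows "laplacian_coord G h y = laplacian_coord G f y"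
proof -
  have 1: "partial j h z = partial j f z" if "z \<in> U" for j z
    by (rule partial_cong[OF U(1) that eq smooth_on_imp_differentiable[OF f that]])
  have "partial i (partial j h) y = partial i (partial j f) y" for i j
    by (rule partial_cong[OF U _ smooth_on_imp_differentiable[OF smooth_on_partial[OF f] U(2)]])
       (simp add: 1)
  then show ?thesis by (simp add: laplacian_coord_def hessian_coord_def 1[OF U(2)])
qed

lemma partial_lincomb:
  assumes "f differentiable at y" "h differentiable at y"
  shows "partial i (\<lambda>z. \<alpha> * f z + \<beta> * h z) y = \<alpha> * partial i f y + \<beta> * partial i h y"
  using assms[unfolded frechet_derivative_works]
  by (subst partialI[where f' = "\<lambda>v. \<alpha> * frechet_derivative f (at y) v + \<beta> * frechet_derivative h (at y) v"])
     (auto intro!: has_derivative_add has_derivative_mult_right simp: partial_def)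

lemma laplacian_coord_lincomb:
  assumes U: "open U" "y \<in> U" and f: "smooth_on U f" and h: "smooth_on U h"
  shows "laplacian_coord G (\<lambda>z. \<alpha> * f z + \<beta> * h z) y
    = \<alpha> * laplacian_coord G f y + \<beta> * laplacian_coord G h y"
proof -
  note d = smooth_on_imp_differentiable[OF f] smooth_on_imp_differentiable[OF h]
    smooth_on_imp_differentiable[OF smooth_on_partial[OF f]]
    smooth_on_imp_differentiable[OF smooth_on_partial[OF h]]
  have 1: "partial j (\<lambda>z. \<alpha> * f z + \<beta> * h z) z = \<alpha> * partial j f z + \<beta> * partial j h z" if "z \<in> U" for j z
    using d that by (intro partial_lincomb)
  have "partial i (partial j (\<lambda>z. \<alpha> * f z + \<beta> * h z)) y
      = partial i (\<lambda>z. \<alpha> * partial j f z + \<beta> * partial j h z) y" for i j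
    by (rule partial_cong[OF U]) (use d U(2) 1 in \<open>auto intro!: differentiable_add differentiable_mult\<close>)
  then have "partial i (partial j (\<lambda>z. \<alpha> * f z + \<beta> * h z)) y
      = \<alpha> * partial i (partial j f) y + \<beta> * partial i (partial j h) y" for i j
    using d U(2) by (simp add: partial_lincomb)
  then show ?thesis
    by (simp add: laplacian_coord_def hessian_coord_def 1[OF U(2)] sum_distrib_left sum.distrib
        sum_subtractf algebra_simps)
qed

section \<open>Time slices, and exchanging time and space derivatives in a chart\<close>

lemma has_real_derivative_slice:
  fixes F :: "real \<times> 'b::real_normed_vector \<Rightarrow> real"
  assumes "(F has_derivative F') (at (t, y))"
  shows "((\<lambda>s. F (s, y)) has_real_derivative F' (1, 0)) (at t)"
  using has_real_derivative_along[of F F' "(0, y)" t "(1, 0)"] assms by simp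

lemma partial_slice:
  fixes F :: "real \<times> (real^'n) \<Rightarrow> real"
  assumes "(F has_derivative F') (at (t, y))"
  shows "partial i (\<lambda>z. F (t, z)) y = F' (0, axis i 1)"
proof (rule partialI)
  show "((\<lambda>z. F (t, z)) has_derivative (\<lambda>v. F' (0, v))) (at y)"
    by (rule has_derivative_compose[of "\<lambda>z. (t, z)" "\<lambda>v. (0, v)" y UNIV F, OF _ assms])
       (auto intro!: derivative_eq_intros)
qed

lemma smooth_on_slice:
  fixes F :: "real \<times> (real^'n) \<Rightarrow> real"
  assumes "open U" "smooth_on ({0::real<..} \<times> U) F" "0 < t"
  shows "smooth_on U (\<lambda>y. F (t, y))"
proof -
  have "smooth_on U (\<lambda>y. F ((t, 0) + (0, y)))"
    by (rule smooth_on_compose_affine[OF assms(1) _ _ assms(2)])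
       (use assms(3) in \<open>auto intro!: bounded_linear_Pair bounded_linear_zero bounded_linear_ident\<close>)
  then show ?thesis by simp
qed

lemma smooth_on_lift:
  fixes k :: "real^'n \<Rightarrow> real"
  assumes "open U" "smooth_on U k"
  shows "smooth_on ({0::real<..} \<times> U) (\<lambda>p :: real \<times> (real^'n). k (snd p))"
proof -
  have "smooth_on ({0::real<..} \<times> U) (\<lambda>p :: real \<times> (real^'n). k (0 + snd p))"
    by (rule smooth_on_compose_affine[OF _ bounded_linear_snd _ assms(2)])
       (auto intro!: open_Times assms(1))
  then show ?thesis by simp
qed

text \<open>A spatial partial at fixed time is the derivative of \<open>F\<close> along
  \<open>(0, axis i 1)\<close>, and the time derivative is the one along \<open>(1, 0)\<close>. The
  second claim is therefore the symmetry of second derivatives on the product.\<close>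

lemma smooth_on_partial_slice:
  fixes F :: "real \<times> (real^'n) \<Rightarrow> real"
  assumes U: "open U" and F: "smooth_on ({0::real<..} \<times> U) F"
  shows "smooth_on ({0::real<..} \<times> U) (\<lambda>(t, y). partial i (\<lambda>z. F (t, z)) y)"
    and "\<lbrakk>0 < t; y \<in> U\<rbrakk> \<Longrightarrow> ((\<lambda>s. partial i (\<lambda>z. F (s, z)) y) has_real_derivative
      partial i (\<lambda>z. frechet_derivative F (at (t, z)) (1, 0)) y) (at t)"
proof -
  let ?S = "{0::real<..} \<times> U"
  have S: "open ?S" using U by (simp add: open_Times)
  let ?D = "\<lambda>p. frechet_derivative F (at p) (0, axis i 1)"
  have eq: "?D (t, y) = partial i (\<lambda>z. F (t, z)) y" if "(t, y) \<in> ?S" for t y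
    using partial_slice[OF smooth_on_has_derivative[OF F that]] by simp
  show "smooth_on ?S (\<lambda>(t, y). partial i (\<lambda>z. F (t, z)) y)"
    by (rule smooth_on_cong[OF S _ smooth_on_directional[OF F, of "(0, axis i 1)"]]) (use eq in auto)
  assume ty: "0 < t" "y \<in> U"
  then have p: "(t, y) \<in> ?S" by simp
  have "((\<lambda>s. ?D (s, y)) has_real_derivative frechet_derivative ?D (at (t, y)) (1, 0)) (at t)"
    by (rule has_real_derivative_slice[OF smooth_on_has_derivative[OF smooth_on_directional[OF F] p]])
  then have "((\<lambda>s. partial i (\<lambda>z. F (s, z)) y) has_real_derivative frechet_derivative ?D (at (t, y)) (1, 0)) (at t)"
    by (rule has_field_derivative_transform_within_open[of _ _ _ "{0<..}"]) (use ty eq in auto)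
  moreover have "frechet_derivative ?D (at (t, y)) (1, 0) =
      frechet_derivative (\<lambda>p. frechet_derivative F (at p) (1, 0)) (at (t, y)) (0, axis i 1)"
    by (rule frechet_derivative_commute[OF S F p])
  moreover have "\<dots> = partial i (\<lambda>z. frechet_derivative F (at (t, z)) (1, 0)) y"
    by (rule partial_slice[symmetric, OF smooth_on_has_derivative[OF smooth_on_directional[OF F] p]])
  ultimately show "((\<lambda>s. partial i (\<lambda>z. F (s, z)) y) has_real_derivative
      partial i (\<lambda>z. frechet_derivative F (at (t, z)) (1, 0)) y) (at t)" by simp
qed

context coordinate_metric
begin

lemma smooth_laplacian_slice:
  fixes F :: "real \<times> (real^'n) \<Rightarrow> real"
  assumes F: "smooth_on ({0::real<..} \<times> U) F"
  shows "smooth_on ({0::real<..} \<times> U) (\<lambda>(t, y). laplacian_coord G (\<lambda>z. F (t, z)) y)"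
proof -
  let ?S = "{0::real<..} \<times> U"
  have S: "open ?S" using open_U by (simp add: open_Times)
  have 1: "smooth_on ?S (\<lambda>p. partial i (\<lambda>z. F (fst p, z)) (snd p))" for i
    using smooth_on_partial_slice(1)[OF open_U F, of i] by (simp add: case_prod_unfold)
  have 2: "smooth_on ?S (\<lambda>p. partial i (partial j (\<lambda>z. F (fst p, z))) (snd p))" for i j
    using smooth_on_partial_slice(1)[OF open_U smooth_on_partial_slice(1)[OF open_U F, of j], of i]
    by (simp add: case_prod_unfold)
  show ?thesis
    unfolding laplacian_coord_def hessian_coord_def case_prod_unfold
    by (intro smooth_on_sum[OF S] smooth_on_mult[OF S] smooth_on_diff[OF S] 1 2
        smooth_on_lift[OF open_U smooth_H] smooth_on_lift[OF open_U smooth_christoffel])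
qed

text \<open>The coefficients of the Laplacian depend on the space variable alone, so only the
  partials of \<open>F\<close> are differentiated in time. For the second-order part the exchange is
  made once for \<open>F\<close> and once for its first partials.\<close>

lemma laplacian_slice_has_derivative:
  fixes F :: "real \<times> (real^'n) \<Rightarrow> real"
  assumes F: "smooth_on ({0::real<..} \<times> U) F" and t: "0 < t" and y: "y \<in> U"
  shows "((\<lambda>s. laplacian_coord G (\<lambda>z. F (s, z)) y) has_real_derivative
      laplacian_coord G (\<lambda>z. frechet_derivative F (at (t, z)) (1, 0)) y) (at t)"
proof -
  let ?S = "{0::real<..} \<times> U"
  let ?Ft = "\<lambda>z. frechet_derivative F (at (t, z)) (1, 0)"
  let ?P = "\<lambda>j. \<lambda>(t, y). partial j (\<lambda>z. F (t, z)) y"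
  note P = smooth_on_partial_slice(1)[OF open_U F]
  have Ft: "smooth_on U ?Ft"
    by (rule smooth_on_slice[OF open_U smooth_on_directional[OF F] t])
  have 1: "((\<lambda>s. partial i (\<lambda>z. F (s, z)) y) has_real_derivative partial i ?Ft y) (at t)" for i
    by (rule smooth_on_partial_slice(2)[OF open_U F t y])
  have "frechet_derivative (?P j) (at (t, z)) (1, 0) = partial j ?Ft z" if z: "z \<in> U" for j z
  proof -
    have "((\<lambda>s. (?P j) (s, z)) has_real_derivative frechet_derivative (?P j) (at (t, z)) (1, 0)) (at t)"
      by (rule has_real_derivative_slice[OF smooth_on_has_derivative[OF P]]) (use t z in auto)
    then show ?thesis
      using smooth_on_partial_slice(2)[OF open_U F t z, of j] DERIV_unique by simp
  qed
  then have "partial i (\<lambda>z. frechet_derivative (?P j) (at (t, z)) (1, 0)) y = partial i (partial j ?Ft) y" for i j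
    by (intro partial_cong[OF open_U y] smooth_on_imp_differentiable[OF smooth_on_partial[OF Ft] y]) simp
  then have 2: "((\<lambda>s. partial i (partial j (\<lambda>z. F (s, z))) y) has_real_derivative partial i (partial j ?Ft) y) (at t)" for i j
    using smooth_on_partial_slice(2)[OF open_U P[of j] t y, of i] by simp
  show ?thesis unfolding laplacian_coord_def hessian_coord_def
    by (intro DERIV_sum DERIV_cmult DERIV_diff 1 2)
qed

end

section \<open>Spacetime functions on the manifold and the time derivative of integrals\<close>

context closed_riemannian_manifold
begin

lemma laplacian_diff_const: "laplacian At g (\<lambda>x. f x - C) = laplacian At g f"
  by (simp add: fun_eq_iff laplacian_def Let_def laplacian_coord_def hessian_coord_def comp_def partial_diff_const)

lemma laplacian_lincomb:
  assumes "smooth_fun At f" "smooth_fun At h"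
  shows "laplacian At g (\<lambda>x. \<alpha> * f x + \<beta> * h x) x = \<alpha> * laplacian At g f x + \<beta> * laplacian At g h x"
  using laplacian_coord_lincomb[OF open_cimg coord_in, of "chart_at At x" x "f \<circ> param (chart_at At x)"
      "h \<circ> param (chart_at At x)"] assms chart_at_in[of x]
  by (simp add: laplacian_def Let_def smooth_fun_def comp_def)

context
  fixes \<psi> :: "real \<Rightarrow> 'm \<Rightarrow> real"
  assumes \<psi>: "smooth_spacetime_fun At \<psi>"
begin

lemma smooth_spacetime_chart:
  "c \<in> At \<Longrightarrow> smooth_on ({0::real<..} \<times> cimg c) (\<lambda>(t, y). \<psi> t (param c y))"
  using \<psi> by (simp add: smooth_spacetime_fun_def)

lemma dt_chart:
  assumes "c \<in> At" "0 < t" "y \<in> cimg c"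
  shows "((\<lambda>s. \<psi> s (param c y)) has_real_derivative
      frechet_derivative (\<lambda>(t, y). \<psi> t (param c y)) (at (t, y)) (1, 0)) (at t)"
    and "dt \<psi> t (param c y) = frechet_derivative (\<lambda>(t, y). \<psi> t (param c y)) (at (t, y)) (1, 0)"
proof -
  show *: "((\<lambda>s. \<psi> s (param c y)) has_real_derivative
      frechet_derivative (\<lambda>(t, y). \<psi> t (param c y)) (at (t, y)) (1, 0)) (at t)"
    using has_real_derivative_slice[OF smooth_on_has_derivative[OF smooth_spacetime_chart[OF assms(1)]], of t y]
      assms by simp
  then show "dt \<psi> t (param c y) = frechet_derivative (\<lambda>(t, y). \<psi> t (param c y)) (at (t, y)) (1, 0)"
    by (simp add: dt_def DERIV_imp_deriv)
qed

lemma dt_has_derivative: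
  assumes "0 < t"
  shows "((\<lambda>s. \<psi> s x) has_real_derivative dt \<psi> t x) (at t)"
proof -
  note c = chart_at_in[of x]
  show ?thesis
    using dt_chart[OF c(1) assms coord_in[OF c]] by (simp add: param_coord[OF c])
qed

lemma smooth_spacetime_dt: "smooth_spacetime_fun At (dt \<psi>)"
  unfolding smooth_spacetime_fun_def
proof
  fix c assume c: "c \<in> At"
  have "open ({0::real<..} \<times> cimg c)" using open_cimg[OF c] by (simp add: open_Times)
  then show "smooth_on ({0::real<..} \<times> cimg c) (\<lambda>(t, y). dt \<psi> t (param c y))"
    by (rule smooth_on_cong[OF _ _ smooth_on_directional[OF smooth_spacetime_chart[OF c], of "(1, 0)"]])
       (use dt_chart(2)[OF c] in auto)
qed

lemma smooth_fun_slice: "0 < t \<Longrightarrow> smooth_fun At (\<psi> t)"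
  unfolding smooth_fun_def
proof
  fix c assume "c \<in> At" "0 < t"
  then show "smooth_on (cimg c) (\<psi> t \<circ> param c)"
    using smooth_on_slice[OF open_cimg smooth_spacetime_chart, of c t] by (simp add: comp_def)
qed

lemma laplacian_chart:
  assumes "c \<in> At" "0 < t" "y \<in> cimg c"
  shows "laplacian At g (\<psi> t) (param c y) = laplacian_coord (g c) (\<lambda>z. \<psi> t (param c z)) y"
  using laplacian_eq_lap[OF assms(1) param_in[OF assms(1,3)] smooth_fun_slice[OF assms(2)]]
  by (simp add: lap_def coord_param assms comp_def)

lemma smooth_spacetime_laplacian: "smooth_spacetime_fun At (\<lambda>t. laplacian At g (\<psi> t))"
  unfolding smooth_spacetime_fun_def
proof
  fix c assume c: "c \<in> At"
  interpret C: coordinate_metric "cimg c" "g c" by (rule coordinate_metric_chart[OF c])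
  have "open ({0::real<..} \<times> cimg c)" using open_cimg[OF c] by (simp add: open_Times)
  then show "smooth_on ({0::real<..} \<times> cimg c) (\<lambda>(t, y). laplacian At g (\<psi> t) (param c y))"
    by (rule smooth_on_cong[OF _ _ C.smooth_laplacian_slice[OF smooth_spacetime_chart[OF c]]])
       (use laplacian_chart[OF c] in auto)
qed

lemma continuous_on_spacetime: "continuous_on ({0::real<..} \<times> UNIV) (\<lambda>p. \<psi> (fst p) (snd p))"
proof (rule continuous_on_charts_product)
  fix c assume "c \<in> At"
  from smooth_on_imp_continuous_on[OF smooth_spacetime_chart[OF this]]
  show "continuous_on ({0::real<..} \<times> cimg c) (\<lambda>(t, y). \<psi> (fst (t, param c y)) (snd (t, param c y)))"
    by simp
qed simp

end

lemma laplacian_has_derivative: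
  assumes \<psi>: "smooth_spacetime_fun At \<psi>" and t: "0 < t"
  shows "((\<lambda>s. laplacian At g (\<psi> s) x) has_real_derivative laplacian At g (dt \<psi> t) x) (at t)"
proof -
  let ?c = "chart_at At x"
  let ?y = "coord ?c x" and ?F = "\<lambda>(t, y). \<psi> t (param ?c y)"
  note c = chart_at_in[of x]
  note y = coord_in[OF c]
  interpret C: coordinate_metric "cimg ?c" "g ?c" by (rule coordinate_metric_chart[OF c(1)])
  have "((\<lambda>s. laplacian_coord (g ?c) (\<lambda>z. ?F (s, z)) ?y) has_real_derivative
      laplacian_coord (g ?c) (\<lambda>z. frechet_derivative ?F (at (t, z)) (1, 0)) ?y) (at t)"
    by (rule C.laplacian_slice_has_derivative[OF smooth_spacetime_chart[OF \<psi> c(1)] t y])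
  moreover have "laplacian_coord (g ?c) (\<lambda>z. frechet_derivative ?F (at (t, z)) (1, 0)) ?y
      = laplacian_coord (g ?c) (\<lambda>z. dt \<psi> t (param ?c z)) ?y"
  proof (rule laplacian_coord_cong[OF open_cimg[OF c(1)] y])
    show "smooth_on (cimg ?c) (\<lambda>z. dt \<psi> t (param ?c z))"
      using smooth_fun_slice[OF smooth_spacetime_dt[OF \<psi>] t] c(1) by (simp add: smooth_fun_def comp_def)
  qed (rule dt_chart(2)[OF \<psi> c(1) t])
  moreover have "\<dots> = laplacian At g (dt \<psi> t) x"
    using laplacian_chart[OF smooth_spacetime_dt[OF \<psi>] c(1) t y] by (simp add: param_coord[OF c])
  ultimately have "((\<lambda>s. laplacian_coord (g ?c) (\<lambda>z. \<psi> s (param ?c z)) ?y) has_real_derivative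
      laplacian At g (dt \<psi> t) x) (at t)" by simp
  then show ?thesis
    by (rule has_field_derivative_transform_within_open[of _ _ _ "{0<..}"])
       (use t laplacian_chart[OF \<psi> c(1) _ y] in \<open>auto simp: param_coord[OF c]\<close>)
qed

text \<open>The Laplacian commutes with time derivatives, and the coefficients of the wave equation
  are constant in space. Hence it can be applied to the equation solved for the second time
  derivative.\<close>

lemma smooth_wave_laplacian:
  assumes "smooth_wave At g a \<psi>"
  shows "smooth_wave At g a (\<lambda>t. laplacian At g (\<psi> t))"
  unfolding smooth_wave_def
proof (intro conjI allI impI)
  have \<psi>: "smooth_spacetime_fun At \<psi>" using assms by (simp add: smooth_wave_def)
  note \<psi>' = smooth_spacetime_dt[OF \<psi>]
  let ?L = "\<lambda>t. laplacian At g (\<psi> t)"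
  show "smooth_spacetime_fun At ?L" by (rule smooth_spacetime_laplacian[OF \<psi>])
  fix t :: real and x assume t: "0 < t"
  have dtL: "dt ?L s x = laplacian At g (dt \<psi> s) x" if "0 < s" for s
    unfolding dt_def[of ?L] by (rule DERIV_imp_deriv[OF laplacian_has_derivative[OF \<psi> that]])
  have "((\<lambda>s. laplacian At g (dt \<psi> s) x) has_real_derivative laplacian At g (dt (dt \<psi>) t) x) (at t)"
    by (rule laplacian_has_derivative[OF \<psi>' t])
  then have "((\<lambda>s. dt ?L s x) has_real_derivative laplacian At g (dt (dt \<psi>) t) x) (at t)"
    by (rule has_field_derivative_transform_within_open[of _ _ _ "{0<..}"]) (use t dtL in auto)
  then have "dt (dt ?L) t x = laplacian At g (dt (dt \<psi>) t) x"
    unfolding dt_def[of "dt ?L"] by (rule DERIV_imp_deriv)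
  also have "dt (dt \<psi>) t = (\<lambda>x. 1 / (a t)\<^sup>2 * ?L t x + - (3 * (deriv a t / a t)) * dt \<psi> t x)"
    using assms t by (simp add: smooth_wave_def fun_eq_iff algebra_simps)
  also have "laplacian At g \<dots> x = 1 / (a t)\<^sup>2 * laplacian At g (?L t) x
      + - (3 * (deriv a t / a t)) * laplacian At g (dt \<psi> t) x"
    by (rule laplacian_lincomb[OF smooth_fun_slice[OF smooth_spacetime_laplacian[OF \<psi>] t] smooth_fun_slice[OF \<psi>' t]])
  finally show "- dt (dt ?L) t x + 1 / (a t)\<^sup>2 * laplacian At g (?L t) x
                - 3 * (deriv a t / a t) * dt ?L t x = 0"
    by (simp add: dtL[OF t])
qed

text \<open>Dominated convergence for the difference quotients: a bound of \<open>F'\<close> on the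
  compact set [t/2, 2t] times the manifold also bounds the quotients, and constants are integrable
  since the volume is finite.\<close>

lemma integral_has_derivative:
  fixes F F' :: "real \<Rightarrow> 'm \<Rightarrow> real"
  assumes F: "\<And>t x. 0 < t \<Longrightarrow> ((\<lambda>s. F s x) has_real_derivative F' t x) (at t)"
    and contF: "continuous_on ({0::real<..} \<times> UNIV) (\<lambda>p. F (fst p) (snd p))"
    and contF': "continuous_on ({0::real<..} \<times> UNIV) (\<lambda>p. F' (fst p) (snd p))"
    and t: "0 < t"
  shows "((\<lambda>s. LINT x|vol. F s x) has_real_derivative (LINT x|vol. F' t x)) (at t)"
proof -
  have slice: "continuous_on UNIV (u s)" if "continuous_on ({0::real<..} \<times> UNIV) (\<lambda>p. u (fst p) (snd p))" "0 < s"
    for u :: "real \<Rightarrow> 'm \<Rightarrow> real" and s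
  proof -
    have "continuous_on UNIV (\<lambda>x. u (fst (s, x)) (snd (s, x)))"
      by (rule continuous_on_compose2[OF that(1)]) (use that(2) in \<open>auto intro!: continuous_intros\<close>)
    then show ?thesis by simp
  qed
  let ?I = "{t / 2..2 * t}"
  have "compact ((\<lambda>p. F' (fst p) (snd p)) ` (?I \<times> UNIV))"
    using t by (intro compact_continuous_image continuous_on_subset[OF contF'] compact_Times compact_M) auto
  then obtain M where "\<And>p. p \<in> ?I \<times> UNIV \<Longrightarrow> \<bar>F' (fst p) (snd p)\<bar> \<le> M"
    using compact_imp_bounded[THEN bounded_real[THEN iffD1]] by (meson imageI)
  then have M: "\<bar>F' s x\<bar> \<le> M" if "s \<in> ?I" for s x using that by force
  let ?q = "\<lambda>s x. (F s x - F t x) / (s - t)"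
  have int: "integrable vol (F s)" if "0 < s" for s
    by (intro integrable_vol slice contF that)
  have "((\<lambda>s. ((LINT x|vol. F s x) - (LINT x|vol. F t x)) / (s - t)) \<longlongrightarrow> (LINT x|vol. F' t x)) (at t)"
    unfolding tendsto_at_iff_sequentially
  proof (intro allI impI)
    fix X :: "nat \<Rightarrow> real" assume X: "\<forall>i. X i \<in> UNIV - {t}" "X \<longlonglongrightarrow> t"
    \<comment> \<open>The bound \<open>M\<close> holds only near \<open>t\<close>, so the sequence
      is shifted by \<open>N\<close> to start inside the interval.\<close>
    have "eventually (\<lambda>n. X n \<in> {t / 2<..<2 * t}) sequentially"
      by (rule topological_tendstoD[OF X(2)]) (use t in auto)
    then obtain N where N: "\<And>n. N \<le> n \<Longrightarrow> X n \<in> {t / 2<..<2 * t}" by (auto simp: eventually_sequentially)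
    have XN: "X (n + N) \<in> ?I" "0 < X (n + N)" "X (n + N) \<noteq> t" for n
      using N[of "n + N"] X(1) t by auto
    have lim: "(\<lambda>n. X (n + N)) \<longlonglongrightarrow> t" using X(2) by (rule LIMSEQ_ignore_initial_segment)
    have "(\<lambda>n. LINT x|vol. ?q (X (n + N)) x) \<longlonglongrightarrow> (LINT x|vol. F' t x)"
    proof (rule integral_dominated_convergence)
      show "F' t \<in> borel_measurable vol"
        by (intro borel_measurable_integrable integrable_vol slice contF' t)
      show "(\<lambda>x. ?q (X (n + N)) x) \<in> borel_measurable vol" for n
        using int[OF XN(2)] int[OF t] by (intro borel_measurable_integrable) auto
      show "integrable vol (\<lambda>x. M)" by (intro integrable_vol continuous_on_const)
      have "(\<lambda>n. ?q (X (n + N)) x) \<longlonglongrightarrow> F' t x" for x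
      proof -
        have "((\<lambda>s. ?q s x) \<longlongrightarrow> F' t x) (at t)" 
          using F[OF t, of x] by (simp add: has_field_derivative_iff)
        moreover have "filterlim (\<lambda>n. X (n + N)) (at t) sequentially"
          using lim XN(3) by (auto simp: filterlim_at intro!: always_eventually)
        ultimately show ?thesis by (rule filterlim_compose)
      qed
      then show "AE x in vol. (\<lambda>n. ?q (X (n + N)) x) \<longlonglongrightarrow> F' t x" by simp
      have "\<bar>?q s x\<bar> \<le> M" if s: "s \<in> ?I" "s \<noteq> t" for s x
      proof -
        have "\<bar>F s x - F t x\<bar> \<le> M * \<bar>s - t\<bar>"
        proof (rule field_differentiable_bound[of ?I "\<lambda>s. F s x" "\<lambda>s. F' s x" M s t, unfolded real_norm_def])
          fix r assume r: "r \<in> ?I"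
          then have "0 < r" using t by auto
          then show "((\<lambda>s. F s x) has_real_derivative F' r x) (at r within ?I)"
            using F has_field_derivative_at_within by blast
          show "\<bar>F' r x\<bar> \<le> M" using M[OF r] .
        qed (use s t in auto)
        then show ?thesis using s by (simp add: divide_simps)
      qed
      then show "AE x in vol. norm (?q (X (n + N)) x) \<le> M" for n using XN by simp
    qed
    moreover have "(LINT x|vol. ?q (X (n + N)) x)
        = ((LINT x|vol. F (X (n + N)) x) - (LINT x|vol. F t x)) / (X (n + N) - t)" for n
      using int[OF XN(2)] int[OF t] by simp
    ultimately have "(\<lambda>n. ((\<lambda>s. ((LINT x|vol. F s x) - (LINT x|vol. F t x)) / (s - t)) \<circ> X) (n + N))
        \<longlonglongrightarrow> (LINT x|vol. F' t x)" by (simp only: comp_def)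
    then show "((\<lambda>s. ((LINT x|vol. F s x) - (LINT x|vol. F t x)) / (s - t)) \<circ> X) \<longlonglongrightarrow> (LINT x|vol. F' t x)"
      by (rule LIMSEQ_offset)
  qed
  then show ?thesis by (simp add: has_field_derivative_iff)
qed

text \<open>Here \<open>c\<close> is the spatially constant part to be subtracted, and the condition
  on \<open>c'\<close> is its wave equation. Carrying \<open>c\<close> beside \<open>\<psi>\<close>
  with two derivatives avoids showing that the profile, an improper integral in type -1, is a smooth
  spacetime function. The lemma serves twice: for \<open>\<psi>\<close> with the homogeneous wave,
  and for its Laplacian with \<open>c = 0\<close>.\<close>

lemma
  fixes a a' c c' :: "real \<Rightarrow> real"
  assumes wave: "smooth_wave At g a \<psi>"
    and a: "\<And>t. 0 < t \<Longrightarrow> 0 < a t" "\<And>t. 0 < t \<Longrightarrow> (a has_real_derivative a' t) (at t)"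
      "\<And>t. 0 < t \<Longrightarrow> 0 \<le> a' t" "continuous_on {0<..} a'"
    and c: "\<And>t. 0 < t \<Longrightarrow> (c has_real_derivative c' t) (at t)"
      "\<And>t. 0 < t \<Longrightarrow> (c' has_real_derivative - (3 * (a' t / a t) * c' t)) (at t)"
    and t: "0 < t"
  shows energy_monotone: "t \<le> t' \<Longrightarrow> a t ^ 6 * energy At g vol a t (\<lambda>t x. \<psi> t x - c t)
       \<le> a t' ^ 6 * energy At g vol a t' (\<lambda>t x. \<psi> t x - c t)"
    and energy_ge_time_derivative:
      "(LINT x|vol. (dt \<psi> t x - c' t)\<^sup>2) \<le> energy At g vol a t (\<lambda>t x. \<psi> t x - c t)"
proof -
  have \<psi>: "smooth_spacetime_fun At \<psi>" using wave by (simp add: smooth_wave_def)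
  note \<psi>' = smooth_spacetime_dt[OF \<psi>]
  note L\<psi> = smooth_spacetime_laplacian[OF \<psi>]
  have eq: "dt (dt \<psi>) s x = laplacian At g (\<psi> s) x / (a s)\<^sup>2 - 3 * (a' s / a s) * dt \<psi> s x" if "0 < s" for s x
    using wave that DERIV_imp_deriv[OF a(2)[OF that]] by (simp add: smooth_wave_def algebra_simps)
  define \<phi> where "\<phi> s x = \<psi> s x - c s" for s x
  define \<phi>\<^sub>1 where "\<phi>\<^sub>1 s x = dt \<psi> s x - c' s" for s x
  define \<phi>\<^sub>2 where "\<phi>\<^sub>2 s x = dt (dt \<psi>) s x + 3 * (a' s / a s) * c' s" for s x
  let ?L = "\<lambda>s. laplacian At g (\<psi> s)" and ?L\<^sub>1 = "\<lambda>s. laplacian At g (dt \<psi> s)"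
  have \<phi>L: "laplacian At g (\<phi> s) = ?L s" "laplacian At g (\<phi>\<^sub>1 s) = ?L\<^sub>1 s" for s
    by (simp_all add: \<phi>_def[abs_def] \<phi>\<^sub>1_def[abs_def] laplacian_diff_const)
  have smooth: "smooth_fun At (\<phi> s)" "smooth_fun At (\<phi>\<^sub>1 s)" if "0 < s" for s
    using smooth_fun_slice[OF \<psi> that] smooth_fun_slice[OF \<psi>' that] open_cimg
    by (simp_all add: \<phi>_def[abs_def] \<phi>\<^sub>1_def[abs_def] smooth_fun_def comp_def smooth_on_diff smooth_on_const)
  have der\<phi>: "((\<lambda>s. \<phi> s x) has_real_derivative \<phi>\<^sub>1 s x) (at s)" if "0 < s" for s x
    unfolding \<phi>_def \<phi>\<^sub>1_def by (intro DERIV_diff dt_has_derivative \<psi> c(1) that)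
  have der\<phi>\<^sub>1: "((\<lambda>s. \<phi>\<^sub>1 s x) has_real_derivative \<phi>\<^sub>2 s x) (at s)" if "0 < s" for s x
    using DERIV_diff[OF dt_has_derivative[OF \<psi>' that] c(2)[OF that]] unfolding \<phi>\<^sub>1_def \<phi>\<^sub>2_def by simp
  have cont_c: "continuous_on {0<..} c" "continuous_on {0<..} c'" "continuous_on {0<..} a"
    using c a(2) by (meson DERIV_isCont continuous_at_imp_continuous_on greaterThan_iff)+
  have lift: "continuous_on ({0<..} \<times> UNIV) (\<lambda>p :: real \<times> 'm. k (fst p))" if "continuous_on {0<..} k" for k :: "real \<Rightarrow> real"
    by (rule continuous_on_compose2[OF that]) (auto intro!: continuous_intros)
  have cont: "continuous_on ({0<..} \<times> UNIV) (\<lambda>p. \<phi> (fst p) (snd p))"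
    "continuous_on ({0<..} \<times> UNIV) (\<lambda>p. \<phi>\<^sub>1 (fst p) (snd p))"
    "continuous_on ({0<..} \<times> UNIV) (\<lambda>p. \<phi>\<^sub>2 (fst p) (snd p))"
    "continuous_on ({0<..} \<times> UNIV) (\<lambda>p. ?L (fst p) (snd p))"
    "continuous_on ({0<..} \<times> UNIV) (\<lambda>p. ?L\<^sub>1 (fst p) (snd p))"
    unfolding \<phi>_def \<phi>\<^sub>1_def \<phi>\<^sub>2_def
    using a(1)
    by (intro continuous_intros continuous_on_spacetime[OF \<psi>] continuous_on_spacetime[OF \<psi>']
        continuous_on_spacetime[OF smooth_spacetime_dt[OF \<psi>']] continuous_on_spacetime[OF L\<psi>]
        continuous_on_spacetime[OF smooth_spacetime_laplacian[OF \<psi>']] lift cont_c a(4); force)+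
  define P where "P s = (LINT x|vol. (\<phi>\<^sub>1 s x)\<^sup>2)" for s
  \<comment> \<open>Minus the Dirichlet integral. In this form its time derivative needs only that
    of the Laplacian, not that of the gradient norm.\<close>
  define Q where "Q s = (LINT x|vol. \<phi> s x * ?L s x)" for s
  define R where "R s = (LINT x|vol. \<phi>\<^sub>1 s x * ?L s x)" for s
  have int: "integrable vol (\<lambda>x. u x * v x)" if "continuous_on UNIV u" "continuous_on UNIV v" for u v :: "'m \<Rightarrow> real"
    by (intro integrable_vol continuous_on_mult that)
  note cs = C1_fun_continuous[OF smooth_imp_C1_fun]
  have cslice: "continuous_on UNIV (\<phi> s)" "continuous_on UNIV (\<phi>\<^sub>1 s)" "continuous_on UNIV (?L s)" "continuous_on UNIV (?L\<^sub>1 s)" if "0 < s" for s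
    using cs[OF smooth(1)[OF that]] cs[OF smooth(2)[OF that]]
      cs[OF smooth_fun_slice[OF L\<psi> that]] cs[OF smooth_fun_slice[OF smooth_spacetime_laplacian[OF \<psi>'] that]] by auto
  have Q_grad: "- Q s = (LINT x|vol. grad_norm_sq At g (\<phi> s) x)" if "0 < s" for s
    using green[OF smooth_imp_C1_fun[OF smooth(1)[OF that]] smooth(1)[OF that]]
    by (simp add: Q_def \<phi>L grad_norm_sq_eq)
  have Q_nonpos: "Q s \<le> 0" if "0 < s" for s
  proof -
    have "0 \<le> (LINT x|vol. grad_norm_sq At g (\<phi> s) x)" by (intro integral_nonneg_AE AE_I2 grad_norm_sq_nonneg)
    then show ?thesis using Q_grad[OF that] by simp
  qed
  have energy: "energy At g vol a s (\<lambda>t x. \<psi> t x - c t) = P s - Q s / (a s)\<^sup>2" if s: "0 < s" for s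
  proof -
    have "dt (\<lambda>t x. \<psi> t x - c t) s x = \<phi>\<^sub>1 s x" for x
      using DERIV_imp_deriv[OF der\<phi>[OF s, of x]] by (simp add: dt_def \<phi>_def)
    then have "energy At g vol a s (\<lambda>t x. \<psi> t x - c t)
        = (LINT x|vol. \<phi>\<^sub>1 s x * \<phi>\<^sub>1 s x + 1 / (a s)\<^sup>2 * grad_norm_sq At g (\<phi> s) x)"
      by (simp add: energy_def \<phi>_def[abs_def] power2_eq_square)
    also have "\<dots> = P s + 1 / (a s)\<^sup>2 * (LINT x|vol. grad_norm_sq At g (\<phi> s) x)"
    proof -
      have "integrable vol (grad_norm_sq At g (\<phi> s))"
        using integrable_vol[OF continuous_grad_pair[OF smooth_imp_C1_fun smooth_imp_C1_fun, OF smooth(1)[OF s] smooth(1)[OF s]]]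
        by (simp add: grad_norm_sq_eq[abs_def])
      then show ?thesis using int[OF cslice(2) cslice(2), OF s s] by (simp add: P_def power2_eq_square)
    qed
    finally show ?thesis unfolding Q_grad[OF s, symmetric] by simp
  qed
  have derP: "(P has_real_derivative 2 * R s / (a s)\<^sup>2 - 6 * (a' s / a s) * P s) (at s)" if s: "0 < s" for s
  proof -
    have "(P has_real_derivative (LINT x|vol. 2 * (\<phi>\<^sub>1 s x * \<phi>\<^sub>2 s x))) (at s)"
      unfolding P_def
      by (rule integral_has_derivative[OF _ _ _ s])
         (auto intro!: derivative_eq_intros der\<phi>\<^sub>1 continuous_intros cont)
    also have "(LINT x|vol. 2 * (\<phi>\<^sub>1 s x * \<phi>\<^sub>2 s x))
       = (LINT x|vol. 2 / (a s)\<^sup>2 * (\<phi>\<^sub>1 s x * ?L s x) - 6 * (a' s / a s) * (\<phi>\<^sub>1 s x * \<phi>\<^sub>1 s x))"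
    proof (intro Bochner_Integration.integral_cong refl)
      fix x
      define k where "k = 3 * (a' s / a s)"
      have "\<phi>\<^sub>2 s x = ?L s x / (a s)\<^sup>2 - k * \<phi>\<^sub>1 s x"
        unfolding \<phi>\<^sub>2_def \<phi>\<^sub>1_def eq[OF s] k_def[symmetric] by (simp add: algebra_simps)
      moreover have "6 * (a' s / a s) = 2 * k" by (simp add: k_def)
      ultimately show "2 * (\<phi>\<^sub>1 s x * \<phi>\<^sub>2 s x)
          = 2 / (a s)\<^sup>2 * (\<phi>\<^sub>1 s x * ?L s x) - 6 * (a' s / a s) * (\<phi>\<^sub>1 s x * \<phi>\<^sub>1 s x)"
        by (simp only:) (simp add: algebra_simps)
    qed
    also have "\<dots> = 2 * R s / (a s)\<^sup>2 - 6 * (a' s / a s) * P s"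
      using int[OF cslice(2) cslice(3), OF s s] int[OF cslice(2) cslice(2), OF s s]
      by (simp add: R_def P_def power2_eq_square)
    finally show ?thesis .
  qed
  have derQ: "(Q has_real_derivative 2 * R s) (at s)" if s: "0 < s" for s
  proof -
    have "(Q has_real_derivative (LINT x|vol. \<phi>\<^sub>1 s x * ?L s x + \<phi> s x * ?L\<^sub>1 s x)) (at s)"
      unfolding Q_def
      by (rule integral_has_derivative[OF _ _ _ s])
         (auto intro!: derivative_eq_intros der\<phi> laplacian_has_derivative[OF \<psi>] continuous_intros cont)
    also have "(LINT x|vol. \<phi>\<^sub>1 s x * ?L s x + \<phi> s x * ?L\<^sub>1 s x) = R s + (LINT x|vol. \<phi> s x * ?L\<^sub>1 s x)"
      using int[OF cslice(2) cslice(3), OF s s] int[OF cslice(1) cslice(4), OF s s] by (simp add: R_def)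
    \<comment> \<open>Self-adjointness moves the Laplacian from the time derivative back to
      \<open>\<phi>\<close>, so both halves of the derivative of \<open>Q\<close> equal
      \<open>R\<close>.\<close>
    also have "(LINT x|vol. \<phi> s x * ?L\<^sub>1 s x) = R s"
      using laplacian_self_adjoint[OF smooth(2)[OF s] smooth(1)[OF s]] by (simp add: \<phi>L R_def)
    finally show ?thesis by simp
  qed
  define W where "W s = a s ^ 6 * P s - a s ^ 4 * Q s" for s
  have W: "a s ^ 6 * energy At g vol a s (\<lambda>t x. \<psi> t x - c t) = W s" if "0 < s" for s
    using a(1)[OF that] by (simp add: energy[OF that] W_def power2_eq_square field_simps power_numeral_reduce)
  \<comment> \<open>Two cancellations: the derivative of \<open>a s ^ 6\<close> against the friction
    term in the derivative of \<open>P\<close>, and the \<open>R\<close> terms of the two summands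
    against each other, since a^6 / a^2 = a^4.\<close>
  have derW: "(W has_real_derivative - (4 * a s ^ 3 * a' s * Q s)) (at s)" if s: "0 < s" for s
    unfolding W_def
    by (rule derivative_eq_intros derP derQ a(2) s refl)+
       (use a(1)[OF s] in \<open>simp add: field_simps power_numeral_reduce power2_eq_square\<close>)
  show "a t ^ 6 * energy At g vol a t (\<lambda>t x. \<psi> t x - c t)
       \<le> a t' ^ 6 * energy At g vol a t' (\<lambda>t x. \<psi> t x - c t)" if "t \<le> t'"
  proof -
    have "W t \<le> W t'"
    proof (rule DERIV_nonneg_imp_nondecreasing[OF that])
      fix s assume "t \<le> s" "s \<le> t'"
      then have s: "0 < s" using t by simp
      have "4 * a s ^ 3 * a' s * Q s \<le> 0"
        using a(1,3)[OF s] Q_nonpos[OF s] by (intro mult_nonneg_nonpos) auto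
      then show "\<exists>y. (W has_real_derivative y) (at s) \<and> 0 \<le> y" using derW[OF s] by auto
    qed
    then show ?thesis using t that by (simp add: W)
  qed
  have "Q t / (a t)\<^sup>2 \<le> 0" using Q_nonpos[OF t] by (simp add: divide_nonpos_nonneg)
  then show "(LINT x|vol. (dt \<psi> t x - c' t)\<^sup>2) \<le> energy At g vol a t (\<lambda>t x. \<psi> t x - c t)"
    unfolding energy[OF t] P_def \<phi>\<^sub>1_def by simp
qed

end

section \<open>Scale factors\<close>

lemma filterlim_powr_neg_at_right_0:
  assumes "e < 0"
  shows "filterlim (\<lambda>t::real. t powr e) at_top (at_right 0)"
proof -
  have "filterlim (\<lambda>t::real. (- e) * (- ln t)) at_top (at_right 0)"
    by (rule filterlim_tendsto_pos_mult_at_top[OF tendsto_const])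
       (use assms ln_at_0 in \<open>auto simp: filterlim_uminus_at_top\<close>)
  from filterlim_compose[OF exp_at_top this]
  show ?thesis
    by (rule filterlim_cong[THEN iffD1, rotated -1])
       (auto simp: powr_def eventually_at_right_less eventually_at_filter)
qed

text \<open>The common interface of both types. The derivative of \<open>\<eta>\<close> says that
  a^3 \<eta>' is the constant \<kappa>, which is the wave equation for a function of time alone; the
  sign of \<kappa> and the blow-up at 0 make \<open>\<eta>\<close> usable as a comparison
  function.\<close>

locale scale_factor_profile =
  fixes a a' \<eta> :: "real \<Rightarrow> real" and \<kappa> :: real
  assumes a_pos: "0 < t \<Longrightarrow> 0 < a t"
    and a_deriv: "0 < t \<Longrightarrow> (a has_real_derivative a' t) (at t)"
    and a'_nonneg: "0 < t \<Longrightarrow> 0 \<le> a' t"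
    and a'_cont: "continuous_on {0<..} a'"
    and \<kappa>_neg: "\<kappa> < 0"
    and \<eta>_deriv: "0 < t \<Longrightarrow> (\<eta> has_real_derivative \<kappa> / a t ^ 3) (at t)"
    and \<eta>_limit: "filterlim \<eta> at_top (at_right 0)"

text \<open>Here a^3 = t^(2/\<gamma>), so differentiating the power t^(1 - 2/\<gamma>) yields
  \<kappa> / a^3 with \<kappa> = 1 - 2/\<gamma>, negative because \<gamma> < 2.\<close>

lemma scale_factor_profile_type_0:
  assumes \<gamma>: "2 / 3 < \<gamma>" "\<gamma> < 2" and "scale_factor Type_0 \<gamma> a"
  shows "scale_factor_profile a (\<lambda>t. 2 / (3 * \<gamma>) * t powr (2 / (3 * \<gamma>) - 1))
    (chi_profile Type_0 \<gamma> a) (1 - 2 / \<gamma>)"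
proof
  let ?p = "2 / (3 * \<gamma>)"
  have a: "a t = t powr ?p" if "0 < t" for t using assms(3) that by simp
  show "0 < a t" if "0 < t" for t using a that by simp
  show "0 \<le> ?p * t powr (?p - 1)" if "0 < t" for t using \<gamma> by simp
  show "(a has_real_derivative ?p * t powr (?p - 1)) (at t)" if "0 < t" for t
    by (rule has_field_derivative_transform_within_open[OF has_real_derivative_powr[OF that], of "{0<..}"])
       (use a that in auto)
  show "continuous_on {0<..} (\<lambda>t. ?p * t powr (?p - 1))"
    by (intro continuous_intros) auto
  have eq: "chi_profile Type_0 \<gamma> a = (\<lambda>t. t powr (1 - 2 / \<gamma>))" by (simp add: fun_eq_iff)
  show "1 - 2 / \<gamma> < 0" using \<gamma> by (simp add: field_simps)
  then show "filterlim (chi_profile Type_0 \<gamma> a) at_top (at_right 0)"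
    unfolding eq by (rule filterlim_powr_neg_at_right_0)
  show "(chi_profile Type_0 \<gamma> a has_real_derivative (1 - 2 / \<gamma>) / a t ^ 3) (at t)" if "0 < t" for t
  proof -
    have "a t ^ 3 = t powr (real 3 * ?p)" unfolding a[OF that] by (rule powr_power) (use that in simp)
    also have "real 3 * ?p = 2 / \<gamma>" by simp
    finally have "a t ^ 3 = t powr (2 / \<gamma>)" .
    then have "(1 - 2 / \<gamma>) / a t ^ 3 = (1 - 2 / \<gamma>) * t powr (1 - 2 / \<gamma> - 1)"
      by (simp add: powr_minus divide_inverse)
    then show ?thesis unfolding eq using has_real_derivative_powr[OF that, of "1 - 2 / \<gamma>"] by simp
  qed
qed

text \<open>The divergence of \<open>\<eta>\<close> at \<open>0\<close> comes from comparing \<open>\<eta>\<close> with \<open>a powr (3 * \<gamma> / 2 - 3)\<close>: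
  where \<open>a \<le> 1\<close>, the derivative of the latter is dominated by \<open>a powr (-3)\<close>.\<close>

lemma scale_factor_profile_type_minus_1:
  assumes \<gamma>: "2 / 3 < \<gamma>" "\<gamma> < 2" and "scale_factor Type_minus_1 \<gamma> a"
  obtains a' where "scale_factor_profile a a' (chi_profile Type_minus_1 \<gamma> a) (- 1)"
proof -
  obtain B where B: "B > 0" "continuous_on {0..} a" "\<And>t. t > 0 \<Longrightarrow> 0 < a t" "a 0 = 0"
    "\<And>t. t > 0 \<Longrightarrow> (a has_real_derivative sqrt (8 * pi * B / 3 * a t powr (2 - 3 * \<gamma>) + 1)) (at t)"
    using assms(3) by auto
  define k where "k = 8 * pi * B / 3"
  have k: "0 < k" using B(1) by (simp add: k_def)
  define a' where "a' t = sqrt (k * a t powr (2 - 3 * \<gamma>) + 1)" for t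
  have der: "(a has_real_derivative a' t) (at t)" if "t > 0" for t
    using B(5)[OF that] by (simp add: a'_def k_def)
  have a'1: "1 \<le> a' t" for t using k by (simp add: a'_def)
  \<comment> \<open>From a' \<ge> 1 and a(0) = 0. This lower bound makes the integral of 1 / a^3
    converge at infinity, by comparison with 1 / s^3.\<close>
  have a_ge: "t \<le> a t" if t: "t > 0" for t
  proof -
    have "\<exists>l z. 0 < z \<and> z < t \<and> (a has_real_derivative l) (at z) \<and> a t - a 0 = (t - 0) * l"
      by (rule MVT[OF t continuous_on_subset[OF B(2)]])
         (use der in \<open>auto simp: real_differentiable_def\<close>)
    then obtain l z where z: "0 < z" "(a has_real_derivative l) (at z)" "a t = t * l"
      using B(4) by auto
    then have "l = a' z" using der[OF z(1)] DERIV_unique by blast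
    then show ?thesis using z(3) a'1[of z] t by simp
  qed
  let ?h = "\<lambda>s. 1 / a s ^ 3"
  have conth: "continuous_on S ?h" if "S \<subseteq> {0<..}" for S
  proof -
    have "continuous_on S a" using that by (intro continuous_on_subset[OF B(2)]) auto
    moreover have "\<forall>s\<in>S. a s ^ 3 \<noteq> 0"
    proof
      fix s assume "s \<in> S"
      then show "a s ^ 3 \<noteq> 0" using B(3)[of s] that by auto
    qed
    ultimately show ?thesis by (intro continuous_intros) auto
  qed
  have int: "set_integrable lborel {t..} ?h" if t: "0 < t" for t
  proof -
    have meas: "(\<lambda>s. indicator {t..} s *\<^sub>R ?h s) \<in> borel_measurable lborel"
    proof -
      have "{t..} \<subseteq> {0<..}" using t by auto
      from borel_measurable_continuous_on_indicator[OF _ conth[OF this]] show ?thesis by simp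
    qed
    \<comment> \<open>From \<open>t\<close> on the integrand is 1 / s^3; truncation by
      \<open>max s t\<close> keeps it bounded and continuous on the whole line.\<close>
    have "(\<integral>\<^sup>+s. ennreal (1 / (max s t) ^ 3) * indicator {t..} s \<partial>lborel) = ennreal (0 - (- 1 / (2 * t ^ 2)))"
    proof (rule nn_integral_FTC_atLeast)
      show "(\<lambda>s. 1 / (max s t) ^ 3) \<in> borel_measurable borel" by measurable
      show "((\<lambda>s. - 1 / (2 * s ^ 2)) has_real_derivative 1 / (max s t) ^ 3) (at s)" if "t \<le> s" for s
        using t that by (auto intro!: derivative_eq_intros simp: max_absorb1 field_simps power_numeral_reduce)
      show "((\<lambda>s::real. - 1 / (2 * s ^ 2)) \<longlongrightarrow> 0) at_top"
        by (rule tendsto_divide_0[OF tendsto_const filterlim_at_top_imp_at_infinity])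
           (intro filterlim_tendsto_pos_mult_at_top[OF tendsto_const] filterlim_pow_at_top filterlim_ident; simp)
    qed (use t in auto)
    then have fin: "(\<integral>\<^sup>+s. ennreal (1 / (max s t) ^ 3) * indicator {t..} s \<partial>lborel) < \<infinity>" by simp
    have "(\<integral>\<^sup>+s. ennreal (norm (indicator {t..} s *\<^sub>R ?h s)) \<partial>lborel)
        \<le> (\<integral>\<^sup>+s. ennreal (1 / (max s t) ^ 3) * indicator {t..} s \<partial>lborel)"
    proof (intro nn_integral_mono)
      fix s :: real
      have "?h s \<le> 1 / s ^ 3" if "t \<le> s"
        using a_ge[of s] t that by (intro divide_left_mono power_mono) (auto intro!: mult_pos_pos B(3) zero_less_power)
      moreover have "0 \<le> ?h s" if "t \<le> s" using B(3)[of s] t that by simp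
      ultimately show "ennreal (norm (indicator {t..} s *\<^sub>R ?h s)) \<le> ennreal (1 / (max s t) ^ 3) * indicator {t..} s"
        by (auto simp: indicator_def max_absorb1 intro!: ennreal_leI)
    qed
    then have "(\<integral>\<^sup>+s. ennreal (norm (indicator {t..} s *\<^sub>R ?h s)) \<partial>lborel) < \<infinity>" using fin by (rule le_less_trans)
    then show ?thesis unfolding set_integrable_def using meas by (intro integrableI_bounded)
  qed
  define \<eta> where "\<eta> = chi_profile Type_minus_1 \<gamma> a"
  have \<eta>: "\<eta> t = integral {t..} ?h" "?h integrable_on {t..}" if "0 < t" for t
    using set_borel_integral_eq_integral[OF int[OF that]] by (simp_all add: \<eta>_def)
  have \<eta>_split: "\<eta> b = integral {b..s} ?h + \<eta> s" if "0 < b" "b \<le> s" for b s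
  proof -
    have "?h integrable_on {b..s}"
      by (intro integrable_continuous_real conth) (use that in auto)
    then have "(?h has_integral (integral {b..s} ?h + \<eta> s)) ({b..s} \<union> {s..})"
      using \<eta>[of s] that
      by (intro has_integral_Un) (auto simp: has_integral_integral[symmetric] intro!: negligible_subset[of "{s}"])
    moreover have "{b..s} \<union> {s..} = {b..}" using that by auto
    ultimately show ?thesis using \<eta>[OF that(1)] by (simp add: integral_unique)
  qed
  have \<eta>_der: "(\<eta> has_real_derivative - 1 / a t ^ 3) (at t)" if t: "0 < t" for t
  proof -
    \<comment> \<open>The tail integral is split at \<open>t / 2\<close>, so that only an integral
      over a bounded interval is differentiated, at an interior point of
      \<open>{t / 2..2 * t}\<close>.\<close>
    have "((\<lambda>s. integral {t / 2..s} ?h) has_real_derivative ?h t) (at t within {t / 2..2 * t})"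
      by (rule integral_has_real_derivative) (use t in \<open>auto intro!: conth\<close>)
    then have "((\<lambda>s. integral {t / 2..s} ?h) has_real_derivative ?h t) (at t)"
      using t by (subst (asm) at_within_Icc_at) auto
    then have "((\<lambda>s. \<eta> (t / 2) - integral {t / 2..s} ?h) has_real_derivative - 1 / a t ^ 3) (at t)"
      by (auto intro!: derivative_eq_intros)
    then show ?thesis
    proof (rule has_field_derivative_transform_within_open[of _ _ _ "{t / 2<..}"])
      fix s assume "s \<in> {t / 2<..}"
      then show "\<eta> (t / 2) - integral {t / 2..s} ?h = \<eta> s" using t \<eta>_split[of "t / 2" s] by simp
    qed (use t in auto)
  qed
  \<comment> \<open>Near the singularity a' behaves like a^(1 - 3\<gamma>/2), so the derivative of
    a^(-\<beta>) has exponent -\<beta> - 1 + 1 - 3\<gamma>/2, and this is -3 exactly for this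
    \<beta>. It is positive because \<gamma> < 2.\<close>
  define \<beta> where "\<beta> = 3 - 3 * \<gamma> / 2"
  have \<beta>: "0 < \<beta>" using \<gamma> by (simp add: \<beta>_def)
  let ?F = "\<lambda>t. a t powr (- \<beta>)"
  define C where "C = \<beta> * sqrt (k + 1)"
  have C: "0 < C" using \<beta> k by (simp add: C_def)
  have "(a \<longlongrightarrow> a 0) (at 0 within {0..})" using B(2) by (auto simp: continuous_on_def)
  then have a0: "(a \<longlongrightarrow> 0) (at_right 0)"
    unfolding B(4) by (rule tendsto_within_subset) auto
  have ev_pos: "eventually (\<lambda>t. 0 < t) (at_right (0::real))" by (rule eventually_at_right_less)
  then have "eventually (\<lambda>t. a t \<in> {0<..} \<and> a t \<noteq> 0) (at_right 0)"
  proof (rule eventually_mono)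
    fix t :: real assume "0 < t"
    then show "a t \<in> {0<..} \<and> a t \<noteq> 0" using B(3)[of t] by simp
  qed
  then have "filterlim a (at_right 0) (at_right 0)"
    using a0 by (simp add: filterlim_at)
  then have F_lim: "filterlim ?F at_top (at_right 0)"
    using filterlim_compose[OF filterlim_powr_neg_at_right_0[of "- \<beta>"]] \<beta> by simp
  have "eventually (\<lambda>t. a t < 1) (at_right 0)" using order_tendstoD(2)[OF a0] by simp
  then obtain d where d: "0 < d" "\<And>t. 0 < t \<Longrightarrow> t < d \<Longrightarrow> a t < 1"
    unfolding eventually_at_right_field by blast
  define t\<^sub>1 where "t\<^sub>1 = d / 2"
  have t\<^sub>1: "0 < t\<^sub>1" "t\<^sub>1 < d" using d by (auto simp: t\<^sub>1_def)
  have F_der: "(?F has_real_derivative - \<beta> * a t powr (- \<beta> - 1) * a' t) (at t)" if "0 < t" for t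
    using DERIV_chain2[OF has_real_derivative_powr[OF B(3)[OF that]] der[OF that], of "- \<beta>"] by simp
  have le: "\<beta> * a t powr (- \<beta> - 1) * a' t \<le> C / a t ^ 3" if t: "0 < t" "t < d" for t
  proof -
    note at = B(3)[OF t(1)] d(2)[OF t]
    have "1 \<le> a t powr (2 - 3 * \<gamma>)"
      \<comment> \<open>The exponent 2 - 3\<gamma> is negative since \<gamma> > 2/3, and a < 1. The
        summand 1 under the root can thus be absorbed into the power, which is the origin of
        \<open>k + 1\<close> in \<open>C\<close>.\<close>
      using at \<gamma> powr_mono'[of "2 - 3 * \<gamma>" 0 "a t"] by simp
    then have "a' t \<le> sqrt ((k + 1) * a t powr (2 - 3 * \<gamma>))"
      unfolding a'_def by (intro real_sqrt_le_mono) (simp add: algebra_simps)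
    also have "\<dots> = sqrt (k + 1) * a t powr (1 - 3 * \<gamma> / 2)"
      using at by (simp add: real_sqrt_mult powr_half_sqrt[symmetric] powr_powr diff_divide_distrib)
    finally have "\<beta> * a t powr (- \<beta> - 1) * a' t
        \<le> \<beta> * a t powr (- \<beta> - 1) * (sqrt (k + 1) * a t powr (1 - 3 * \<gamma> / 2))"
      using \<beta> by (intro mult_left_mono) auto
    also have "\<dots> = C * (a t powr (- \<beta> - 1) * a t powr (1 - 3 * \<gamma> / 2))" by (simp add: C_def)
    also have "a t powr (- \<beta> - 1) * a t powr (1 - 3 * \<gamma> / 2) = a t powr (- 3)"
      by (simp add: powr_add[symmetric] \<beta>_def)
    also have "a t powr (- 3) = 1 / a t ^ 3" using at by (simp add: powr_minus divide_inverse)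
    finally show ?thesis by simp
  qed
  \<comment> \<open>By \<open>le\<close> the function C \<eta> - F is nonincreasing, so towards 0 it
    stays above its value at \<open>t\<^sub>1\<close>, and \<open>\<eta>\<close> inherits the
    blow-up of \<open>?F\<close>.\<close>
  have bound: "(?F t + (C * \<eta> t\<^sub>1 - ?F t\<^sub>1)) / C \<le> \<eta> t" if t: "0 < t" "t < t\<^sub>1" for t
  proof -
    have "C * \<eta> t\<^sub>1 - ?F t\<^sub>1 \<le> C * \<eta> t - ?F t"
    proof (rule DERIV_nonpos_imp_nonincreasing[OF less_imp_le[OF t(2)]])
      fix s assume "t \<le> s" "s \<le> t\<^sub>1"
      then have s: "0 < s" "s < d" using t t\<^sub>1 by auto
      have "((\<lambda>t. C * \<eta> t - ?F t) has_real_derivative C * (- 1 / a s ^ 3) - - \<beta> * a s powr (- \<beta> - 1) * a' s) (at s)"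
        by (intro DERIV_diff DERIV_cmult \<eta>_der F_der s)
      then show "\<exists>y. ((\<lambda>t. C * \<eta> t - ?F t) has_real_derivative y) (at s) \<and> y \<le> 0"
        using le[OF s] by (intro exI[of _ "C * (- 1 / a s ^ 3) - - \<beta> * a s powr (- \<beta> - 1) * a' s"]) auto
    qed
    then show ?thesis using C by (simp add: divide_simps algebra_simps)
  qed
  have "filterlim (\<lambda>t. (1 / C) * ((C * \<eta> t\<^sub>1 - ?F t\<^sub>1) + ?F t)) at_top (at_right 0)"
    using C by (intro filterlim_tendsto_pos_mult_at_top[OF tendsto_const]
        filterlim_tendsto_add_at_top[OF tendsto_const] F_lim) auto
  then have \<eta>_lim: "filterlim \<eta> at_top (at_right 0)"
  proof (rule filterlim_at_top_mono)
    show "eventually (\<lambda>t. (1 / C) * ((C * \<eta> t\<^sub>1 - ?F t\<^sub>1) + ?F t) \<le> \<eta> t) (at_right 0)"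
      using bound t\<^sub>1 unfolding eventually_at_right_field
      by (auto intro!: exI[of _ t\<^sub>1] simp: add.commute)
  qed
  have "scale_factor_profile a a' \<eta> (- 1)"
  proof
    have "continuous_on {0<..} a" by (rule continuous_on_subset[OF B(2)]) auto
    moreover have "\<forall>t\<in>{0<..}. a t \<noteq> 0"
    proof
      fix t :: real assume "t \<in> {0<..}"
      then show "a t \<noteq> 0" using B(3)[of t] by simp
    qed
    ultimately show "continuous_on {0<..} a'"
      unfolding a'_def by (intro continuous_intros)
    show "0 \<le> a' t" for t using a'1[of t] by simp
  qed (use B(3) der \<eta>_der \<eta>_lim in auto)
  then show ?thesis using that unfolding \<eta>_def by blast
qed

section \<open>The leading coefficient\<close>

context closed_riemannian_manifold
begin

text \<open>A real supremum is an upper bound only for bounded families; compactness supplies the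
  boundedness.\<close>

lemma abs_le_sup_norm:
  assumes "smooth_fun At \<phi>" shows "\<bar>\<phi> x\<bar> \<le> sup_norm \<phi>"
proof -
  have "compact (\<phi> ` UNIV)"
    by (intro compact_continuous_image C1_fun_continuous smooth_imp_C1_fun assms compact_M)
  then obtain M where "\<And>x. \<bar>\<phi> x\<bar> \<le> M"
    using compact_imp_bounded[THEN bounded_real[THEN iffD1]] by (meson rangeI)
  then show ?thesis unfolding sup_norm_def
    by (intro cSUP_upper bdd_aboveI[of _ M]) auto
qed

text \<open>The quantitative statement behind the theorem: the amplitude hypothesis says precisely
  that this bound is smaller than |\<A>|.\<close>

lemma leading_coefficient_near_amplitude:
  assumes profile: "scale_factor_profile a a' (chi_profile ty \<gamma> a) \<kappa>"
    and K_pos: "0 < K"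
    and K_bound: "\<And>\<phi>. smooth_fun At \<phi> \<Longrightarrow>
          (sup_norm \<phi>)\<^sup>2 \<le> K\<^sup>2 * ((L2_norm vol \<phi>)\<^sup>2 + (L2_norm vol (laplacian At g \<phi>))\<^sup>2)"
    and eps: "0 < \<epsilon>"
    and wave: "smooth_wave At g a \<psi>"
    and leading: "leading_coefficient At ty \<gamma> a \<psi> A"
    and t0: "0 < t\<^sub>0"
    and small: "a t\<^sub>0 ^ 6 *
          (energy At g vol a t\<^sub>0 (\<lambda>t x. \<psi> t x - psi_hom ty \<gamma> a \<A> t x) +
           energy At g vol a t\<^sub>0
             (\<lambda>t. laplacian At g (\<lambda>x. \<psi> t x - psi_hom ty \<gamma> a \<A> t x))) \<le> \<epsilon>\<^sup>2"
  shows "\<bar>A x - \<A>\<bar> \<le> K * \<epsilon> / \<bar>\<kappa>\<bar>"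
proof -
  let ?\<eta> = "chi_profile ty \<gamma> a"
  interpret S: scale_factor_profile a a' ?\<eta> \<kappa> by (rule profile)
  have \<psi>: "smooth_spacetime_fun At \<psi>" using wave by (simp add: smooth_wave_def)
  define c where "c t = \<A> * ?\<eta> t" for t
  define c' where "c' t = \<A> * (\<kappa> / a t ^ 3)" for t
  let ?L = "\<lambda>t. laplacian At g (\<psi> t)"
  define E where "E t = energy At g vol a t (\<lambda>t x. \<psi> t x - c t)" for t
  define E' where "E' t = energy At g vol a t (\<lambda>t x. ?L t x - 0)" for t
  have c: "(c has_real_derivative c' t) (at t)" if "0 < t" for t
    unfolding c_def c'_def by (intro DERIV_cmult S.\<eta>_deriv that)
  \<comment> \<open>\<open>a t ^ 3 * c' t\<close> is constant in time; differentiating this gives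
    the wave equation of the homogeneous part.\<close>
  have c': "(c' has_real_derivative - (3 * (a' t / a t) * c' t)) (at t)" if "0 < t" for t
    unfolding c'_def
    using S.a_pos[OF that]
    by (auto intro!: derivative_eq_intros S.a_deriv[OF that] simp: field_simps power_numeral_reduce power2_eq_square)
  \<comment> \<open>The second instance concerns the Laplacian of \<open>\<psi>\<close> with zero
    homogeneous part, because the Laplacian annihilates functions of time alone.\<close>
  note mono = energy_monotone[OF wave S.a_pos S.a_deriv S.a'_nonneg S.a'_cont c c']
    energy_monotone[OF smooth_wave_laplacian[OF wave] S.a_pos S.a_deriv S.a'_nonneg S.a'_cont, of "\<lambda>_. 0" "\<lambda>_. 0"]
  note ge = energy_ge_time_derivative[OF wave S.a_pos S.a_deriv S.a'_nonneg S.a'_cont c c']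
    energy_ge_time_derivative[OF smooth_wave_laplacian[OF wave] S.a_pos S.a_deriv S.a'_nonneg S.a'_cont, of "\<lambda>_. 0" "\<lambda>_. 0"]
  have small': "a t\<^sub>0 ^ 6 * (E t\<^sub>0 + E' t\<^sub>0) \<le> \<epsilon>\<^sup>2"
    using small by (simp add: E_def E'_def c_def psi_hom_def laplacian_diff_const)
  let ?u = "\<lambda>t x. dt \<psi> t x - c' t"
  have u_bound: "\<bar>?u t x\<bar> \<le> K * \<epsilon> / a t ^ 3" if t: "0 < t" "t \<le> t\<^sub>0" for t x
  proof -
    note at = S.a_pos[OF t(1)]
    have u: "smooth_fun At (?u t)"
      using smooth_fun_slice[OF smooth_spacetime_dt[OF \<psi>] t(1)] open_cimg
      by (simp add: smooth_fun_def comp_def smooth_on_diff smooth_on_const)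
    \<comment> \<open>The Sobolev bound is used for \<open>?u t\<close>. Its Laplacian is the time
      derivative of \<open>?L\<close>, so the second energy controls it.\<close>
    have "laplacian At g (?u t) x = dt ?L t x" for x
      using DERIV_imp_deriv[OF laplacian_has_derivative[OF \<psi> t(1)]]
      by (simp add: laplacian_diff_const dt_def[of ?L])
    then have "(L2_norm vol (laplacian At g (?u t)))\<^sup>2 = (LINT x|vol. (dt ?L t x - 0)\<^sup>2)"
      by (simp add: L2_norm_def)
    also have "\<dots> \<le> E' t" unfolding E'_def by (rule ge(2)) (use t in auto)
    finally have 1: "(L2_norm vol (laplacian At g (?u t)))\<^sup>2 \<le> E' t" .
    have 2: "(L2_norm vol (?u t))\<^sup>2 \<le> E t"
      using ge(1)[of t] t by (simp add: L2_norm_def E_def)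
    have "(a t ^ 3 * \<bar>?u t x\<bar>)\<^sup>2 = a t ^ 6 * \<bar>?u t x\<bar>\<^sup>2" by (simp add: power_mult_distrib power_mult[symmetric])
    also have "\<dots> \<le> a t ^ 6 * (K\<^sup>2 * (E t + E' t))"
    proof (rule mult_left_mono)
      have "\<bar>?u t x\<bar>\<^sup>2 \<le> (sup_norm (?u t))\<^sup>2" using abs_le_sup_norm[OF u] by (intro power_mono) auto
      also have "\<dots> \<le> K\<^sup>2 * ((L2_norm vol (?u t))\<^sup>2 + (L2_norm vol (laplacian At g (?u t)))\<^sup>2)" by (rule K_bound[OF u])
      also have "\<dots> \<le> K\<^sup>2 * (E t + E' t)" using 1 2 by (intro mult_left_mono add_mono) auto
      finally show "\<bar>?u t x\<bar>\<^sup>2 \<le> K\<^sup>2 * (E t + E' t)" .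
    qed (use at in simp)
    also have "\<dots> = K\<^sup>2 * (a t ^ 6 * E t + a t ^ 6 * E' t)" by (simp add: algebra_simps)
    also have "\<dots> \<le> K\<^sup>2 * (a t\<^sub>0 ^ 6 * E t\<^sub>0 + a t\<^sub>0 ^ 6 * E' t\<^sub>0)"
      unfolding E_def E'_def
      by (intro mult_left_mono add_mono mono(1)) (use t mono(2)[of t t\<^sub>0] in auto)
    also have "\<dots> \<le> K\<^sup>2 * \<epsilon>\<^sup>2"
      using small' by (intro mult_left_mono) (auto simp: distrib_left)
    also have "\<dots> = (K * \<epsilon>)\<^sup>2" by (simp add: power_mult_distrib)
    finally have "(a t ^ 3 * \<bar>?u t x\<bar>)\<^sup>2 \<le> (K * \<epsilon>)\<^sup>2" .
    moreover have "0 \<le> K * \<epsilon>" using K_pos eps by simp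
    ultimately have "a t ^ 3 * \<bar>?u t x\<bar> \<le> K * \<epsilon>" by (rule power2_le_imp_le)
    moreover have "0 < a t ^ 3" using at by simp
    ultimately show ?thesis by (simp only: pos_le_divide_eq mult.commute[of "a t ^ 3"])
  qed
  \<comment> \<open>Chosen so that the derivative of \<open>m * ?\<eta> t\<close> is -K \<epsilon> /
    a^3, the negative of the bound in \<open>u_bound\<close>.\<close>
  define m where "m = K * \<epsilon> / \<bar>\<kappa>\<bar>"
  have m\<kappa>: "m * \<kappa> = - (K * \<epsilon>)" using S.\<kappa>_neg by (simp add: m_def)
  let ?\<phi> = "\<lambda>t. \<psi> t x - c t"
  have der: "(?\<phi> has_real_derivative ?u t x) (at t)" if "0 < t" for t
    by (intro DERIV_diff dt_has_derivative \<psi> c that)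
  \<comment> \<open>Monotonicity replaces integration of the bound on \<open>?u\<close>; the two
    signs \<sigma> give the upper and the lower estimate of \<open>?\<phi>\<close>.\<close>
  have mdec: "m * ?\<eta> t\<^sub>0 + \<sigma> * ?\<phi> t\<^sub>0 \<le> m * ?\<eta> t + \<sigma> * ?\<phi> t"
    if \<sigma>: "\<bar>\<sigma>\<bar> = 1" and t: "0 < t" "t \<le> t\<^sub>0" for \<sigma> t
  proof (rule DERIV_nonpos_imp_nonincreasing[OF t(2)])
    fix s assume "t \<le> s" "s \<le> t\<^sub>0"
    then have s: "0 < s" "s \<le> t\<^sub>0" using t by auto
    have "((\<lambda>t. m * ?\<eta> t + \<sigma> * ?\<phi> t) has_real_derivative m * (\<kappa> / a s ^ 3) + \<sigma> * ?u s x) (at s)"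
      by (intro DERIV_add DERIV_cmult S.\<eta>_deriv der s)
    moreover have "\<sigma> * ?u s x \<le> K * \<epsilon> / a s ^ 3"
      using u_bound[OF s, of x] abs_ge_self[of "\<sigma> * ?u s x"] \<sigma> by (simp add: abs_mult)
    moreover have "m * (\<kappa> / a s ^ 3) = - (K * \<epsilon> / a s ^ 3)" using m\<kappa> by simp
    ultimately show "\<exists>y. ((\<lambda>t. m * ?\<eta> t + \<sigma> * ?\<phi> t) has_real_derivative y) (at s) \<and> y \<le> 0"
      by (intro exI[of _ "m * (\<kappa> / a s ^ 3) + \<sigma> * ?u s x"]) auto
  qed
  \<comment> \<open>Any bound independent of \<open>t\<close> would do: divided by
    \<open>?\<eta> t\<close> it tends to zero.\<close>
  define D where "D = \<bar>?\<phi> t\<^sub>0\<bar> + \<bar>m * ?\<eta> t\<^sub>0\<bar>"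
  have \<phi>_bound: "\<bar>?\<phi> t\<bar> \<le> m * ?\<eta> t + D" if "0 < t" "t \<le> t\<^sub>0" for t
    using mdec[OF _ that, of 1, simplified] mdec[OF _ that, of "- 1", simplified] unfolding D_def by linarith
  have "((\<lambda>t. \<psi> t x / ?\<eta> t) \<longlongrightarrow> A x) (at_right 0)"
    using leading tendsto_uniform_limitI[where S = UNIV and x = x] unfolding leading_coefficient_def by blast
  then have lim1: "((\<lambda>t. \<bar>\<psi> t x / ?\<eta> t - \<A>\<bar>) \<longlongrightarrow> \<bar>A x - \<A>\<bar>) (at_right 0)"
    by (intro tendsto_intros)
  have "((\<lambda>t. D / ?\<eta> t) \<longlongrightarrow> 0) (at_right 0)"
    by (rule tendsto_divide_0[OF tendsto_const filterlim_at_top_imp_at_infinity[OF S.\<eta>_limit]])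
  then have lim2: "((\<lambda>t. m + D / ?\<eta> t) \<longlongrightarrow> m + 0) (at_right 0)"
    by (intro tendsto_intros)
  have "eventually (\<lambda>t. \<bar>\<psi> t x / ?\<eta> t - \<A>\<bar> \<le> m + D / ?\<eta> t) (at_right 0)"
  proof -
    have "eventually (\<lambda>t. 0 < ?\<eta> t) (at_right 0)" using S.\<eta>_limit by (simp add: filterlim_at_top_dense)
    moreover have "eventually (\<lambda>t. 0 < t \<and> t < t\<^sub>0) (at_right 0)"
      using t0 by (auto simp: eventually_at_right_field intro!: exI[of _ t\<^sub>0])
    ultimately show ?thesis
    proof eventually_elim
      case (elim t)
      then have "\<psi> t x / ?\<eta> t - \<A> = ?\<phi> t / ?\<eta> t" by (simp add: c_def field_simps)
      then have "\<bar>\<psi> t x / ?\<eta> t - \<A>\<bar> = \<bar>?\<phi> t\<bar> / ?\<eta> t" using elim by (simp add: abs_divide)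
      also have "\<dots> \<le> (m * ?\<eta> t + D) / ?\<eta> t" using elim \<phi>_bound[of t] by (intro divide_right_mono) auto
      also have "\<dots> = m + D / ?\<eta> t" using elim by (simp add: add_divide_distrib)
      finally show ?case .
    qed
  qed
  then have "\<bar>A x - \<A>\<bar> \<le> m + 0"
    by (rule tendsto_le[OF trivial_limit_at_right_real lim2 lim1])
  then show ?thesis by (simp add: m_def)
qed

end

theorem theorem5p8:
  fixes At :: "('m::{t2_space, second_countable_topology}, 3) chart set"
    and g :: "('m, 3) metric" and vol :: "'m measure"
    and ty :: spacetime_type and a :: "real \<Rightarrow> real"
    and \<gamma> K \<epsilon> \<A> t\<^sub>0 :: real
    and \<psi> :: "real \<Rightarrow> 'm \<Rightarrow> real" and A :: "'m \<Rightarrow> real"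
  assumes closed_manifold: "compact (UNIV :: 'm set)" "smooth_atlas At"
    and metric: "riemannian_metric At g" "riemannian_volume At g vol"
    and gamma: "2 / 3 < \<gamma>" "\<gamma> < 2"
    and scale: "scale_factor ty \<gamma> a"
    and K_pos: "0 < K"
    and K_bound: "\<And>\<phi>. smooth_fun At \<phi> \<Longrightarrow>
          (sup_norm \<phi>)\<^sup>2 \<le> K\<^sup>2 * ((L2_norm vol \<phi>)\<^sup>2 + (L2_norm vol (laplacian At g \<phi>))\<^sup>2)"
    and eps: "0 < \<epsilon>"
    and amplitude: "case ty of Type_0 \<Rightarrow> \<bar>\<A>\<bar> > K / \<bar>1 - 2 / \<gamma>\<bar> * \<epsilon>
                             | Type_minus_1 \<Rightarrow> \<bar>\<A>\<bar> > K * \<epsilon>"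
    and wave: "smooth_wave At g a \<psi>"
    and leading: "leading_coefficient At ty \<gamma> a \<psi> A"
    and t0: "0 < t\<^sub>0"
    and small: "a t\<^sub>0 ^ 6 *
          (energy At g vol a t\<^sub>0 (\<lambda>t x. \<psi> t x - psi_hom ty \<gamma> a \<A> t x) +
           energy At g vol a t\<^sub>0
             (\<lambda>t. laplacian At g (\<lambda>x. \<psi> t x - psi_hom ty \<gamma> a \<A> t x))) \<le> \<epsilon>\<^sup>2"
  shows "\<forall>x. A x \<noteq> 0"
proof
  fix x
  interpret closed_riemannian_manifold At g vol
    using closed_manifold metric by unfold_locales
  \<comment> \<open>The constant \<kappa> merges the two amplitude conditions into one; in type -1
    its modulus is 1.\<close>
  obtain a' \<kappa> where "scale_factor_profile a a' (chi_profile ty \<gamma> a) \<kappa>" "K * \<epsilon> / \<bar>\<kappa>\<bar> < \<bar>\<A>\<bar>"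
  proof (cases ty)
    case Type_0
    then show ?thesis
      using that[OF scale_factor_profile_type_0[OF gamma, of a, folded Type_0]] scale amplitude by simp
  next
    case Type_minus_1
    then obtain a' where "scale_factor_profile a a' (chi_profile ty \<gamma> a) (- 1)"
      using scale_factor_profile_type_minus_1[OF gamma, of a] scale by metis
    then show ?thesis using that amplitude Type_minus_1 by simp
  qed
  then have "\<bar>A x - \<A>\<bar> < \<bar>\<A>\<bar>"
    using leading_coefficient_near_amplitude[OF _ K_pos K_bound eps wave leading t0 small, of a' \<kappa> x] by simp
  then show "A x \<noteq> 0" by auto
qed

end
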